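(* Suppose that either (i) $3\le n\le 4$, $0<m<\frac{n-2}{n}$ and $\beta_0(m)<\beta<\beta_1(m)$, or (ii) $n>4$, $\frac{n-4}{n-2}<m<\frac{n-2}{n}$ and $\beta_0(m)<\beta<\beta_1(m)$. Let $\alpha=\frac{2\beta+1}{1-m}$ and $T>0$. Suppose $u_0$ satisfies $$u_0-U_{\lambda_0}(\cdot,0)\in L^1(\mathbb{R}^n)\qquad\text{and}\qquad 0\le u_0\le\min\{U_{\lambda_1}(\cdot,0),U_{\lambda_2}(\cdot,0)\}\ \text{ in }\mathbb{R}^n$$ for some constants $\lambda_2>\lambda_1>0$, $\lambda_0>0$. Let $u$ be the unique solution of $$u_t=\Delta u^m\ \text{ in }\mathbb{R}^n\times(0,T),\qquad u(x,0)=u_0(x)\ \text{ in }\mathbb{R}^n,$$ which satisfies $u_t\le\frac{u}{(1-m)t}$ in $\mathbb{R}^n\times(0,T)$. Then the rescaled solution $$\tilde u(y,\tau)=(T-t)^{-\alpha}u\left((T-t)^{-\beta}y,\,t\right),\qquad t=T(1-e^{-\tau}),\quad (y,\tau)\in\mathbb{R}^n\times[0,\infty),$$ converges to zero uniformly on any compact subset of $\mathbb{R}^n$ as $\tau\to\infty$.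
   Context: For $n\ge3$ and $0<m<\frac{n-2}{n}$ define $$\beta_1(m)=\frac{1}{n-2-nm},\quad \beta_e(m)=\frac{m}{n-2-nm},\quad \beta_2(m)=\sqrt{\frac{2(1-m)}{n-2-nm}}+\frac{(n+2)m-(n-2)}{2(n-2-nm)},$$ $$\beta_0(m)=\max(\beta_2(m),\beta_e(m)).$$ For $\lambda>0$, $f_\lambda$ is the unique radially symmetric solution (existence and uniqueness are known for $\beta\ge\beta_e(m)$) of $$\Delta f^m+\alpha f+\beta\, y\cdot\nabla f=0,\quad f>0\ \text{ in }\mathbb{R}^n,\qquad f(0)=\lambda^{\frac{2}{1-m}},$$ and $U_\lambda(x,t)=(T-t)^\alpha f_\lambda((T-t)^\beta x)$. For $0\le u_0\in L^1_{loc}(\mathbb{R}^n)$, $u$ is called a solution of the Cauchy problem in $\mathbb{R}^n\times(0,T)$ if $u>0$ in $\mathbb{R}^n\times(0,T)$, $u$ is a classical solution of $u_t=\Delta u^m$ there, and $\lim_{t\to0}\|u(\cdot,t)-u_0\|_{L^1(K)}=0$ for every compact set $K\subset\mathbb{R}^n$. Under the stated hypotheses on $u_0$, the paper's existence theorem gives a unique solution satisfying $u_t\le\frac{u}{(1-m)t}$; it satisfies $0<u\le\min(U_{\lambda_1},U_{\lambda_2})$ in $\mathbb{R}^n\times(0,T)$ and $\|u(\cdot,t)-U_{\lambda_0}(\cdot,t)\|_{L^1(\mathbb{R}^n)}\le\|u_0-U_{\lambda_0}(\cdot,0)\|_{L^1(\mathbb{R}^n)}$ for $0<t<T$. *)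

theory Defs
  imports "HOL-Analysis.Analysis"
begin

definition partial_deriv :: "'a::euclidean_space \<Rightarrow> ('a \<Rightarrow> real) \<Rightarrow> 'a \<Rightarrow> real" where
  "partial_deriv e f x = deriv (\<lambda>s. f (x + s *\<^sub>R e)) 0"

definition has_partial :: "'a::euclidean_space \<Rightarrow> ('a \<Rightarrow> real) \<Rightarrow> 'a \<Rightarrow> bool" where
  "has_partial e f x \<longleftrightarrow> (\<lambda>s. f (x + s *\<^sub>R e)) field_differentiable (at 0)"

definition grad :: "('a::euclidean_space \<Rightarrow> real) \<Rightarrow> 'a \<Rightarrow> 'a" where
  "grad f x = (\<Sum>i\<in>Basis. partial_deriv i f x *\<^sub>R i)"

definition laplacian :: "('a::euclidean_space \<Rightarrow> real) \<Rightarrow> 'a \<Rightarrow> real" where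
  "laplacian f x = (\<Sum>i\<in>Basis. partial_deriv i (partial_deriv i f) x)"

definition C2 :: "('a::euclidean_space \<Rightarrow> real) \<Rightarrow> bool" where
  "C2 f \<longleftrightarrow>
     continuous_on UNIV f \<and>
     (\<forall>i\<in>Basis. (\<forall>x. has_partial i f x) \<and> continuous_on UNIV (partial_deriv i f)) \<and>
     (\<forall>i\<in>Basis. \<forall>j\<in>Basis. (\<forall>x. has_partial j (partial_deriv i f) x) \<and>
        continuous_on UNIV (partial_deriv j (partial_deriv i f)))"

text \<open>The parabolic class C^{2,1} on \<open>UNIV \<times> {0<..<T}\<close>: all derivatives involved are
  continuous jointly in \<open>(x, t)\<close>.  A space-time function is curried, \<open>u x t\<close>; its values for
  \<open>t\<close> outside \<open>{0<..<T}\<close> are irrelevant.\<close>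

definition C21_on :: "real \<Rightarrow> ('a::euclidean_space \<Rightarrow> real \<Rightarrow> real) \<Rightarrow> bool" where
  "C21_on T u \<longleftrightarrow>
     continuous_on (UNIV \<times> {0<..<T}) (\<lambda>(x, t). u x t) \<and>
     (\<forall>x. \<forall>t\<in>{0<..<T}. u x field_differentiable (at t)) \<and>
     continuous_on (UNIV \<times> {0<..<T}) (\<lambda>(x, t). deriv (u x) t) \<and>
     (\<forall>i\<in>Basis.
        (\<forall>x. \<forall>t\<in>{0<..<T}. has_partial i (\<lambda>z. u z t) x) \<and>
        continuous_on (UNIV \<times> {0<..<T}) (\<lambda>(x, t). partial_deriv i (\<lambda>z. u z t) x)) \<and>
     (\<forall>i\<in>Basis. \<forall>j\<in>Basis.
        (\<forall>x. \<forall>t\<in>{0<..<T}. has_partial j (partial_deriv i (\<lambda>z. u z t)) x) \<and>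
        continuous_on (UNIV \<times> {0<..<T})
          (\<lambda>(x, t). partial_deriv j (partial_deriv i (\<lambda>z. u z t)) x))"

definition L1_loc :: "('a::euclidean_space \<Rightarrow> real) \<Rightarrow> bool" where
  "L1_loc g \<longleftrightarrow> (\<forall>K. compact K \<longrightarrow> set_integrable lebesgue K g)"

definition beta_1 :: "nat \<Rightarrow> real \<Rightarrow> real" where
  "beta_1 n m = 1 / (real n - 2 - real n * m)"

definition beta_e :: "nat \<Rightarrow> real \<Rightarrow> real" where
  "beta_e n m = m / (real n - 2 - real n * m)"

definition beta_2 :: "nat \<Rightarrow> real \<Rightarrow> real" where
  "beta_2 n m =
     sqrt (2 * (1 - m) / (real n - 2 - real n * m))
     + ((real n + 2) * m - (real n - 2)) / (2 * (real n - 2 - real n * m))"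

definition beta_0 :: "nat \<Rightarrow> real \<Rightarrow> real" where
  "beta_0 n m = max (beta_2 n m) (beta_e n m)"

text \<open>\<open>f\<^sub>\<lambda>\<close> is the unique \<open>f\<close> with \<open>is_profile m \<alpha> \<beta> \<lambda> f\<close>; existence and uniqueness
  are known for \<open>\<beta> \<ge> beta_e n m\<close>.\<close>

definition is_profile ::
    "real \<Rightarrow> real \<Rightarrow> real \<Rightarrow> real \<Rightarrow> ('a::euclidean_space \<Rightarrow> real) \<Rightarrow> bool" where
  "is_profile m \<alpha> \<beta> l f \<longleftrightarrow>
     C2 f \<and> (\<forall>y. f y > 0) \<and>
     (\<forall>x y. norm x = norm y \<longrightarrow> f x = f y) \<and>
     (\<forall>y. laplacian (\<lambda>z. f z powr m) y + \<alpha> * f y + \<beta> * (y \<bullet> grad f y) = 0) \<and>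
     f 0 = l powr (2 / (1 - m))"

definition self_similar ::
    "real \<Rightarrow> real \<Rightarrow> real \<Rightarrow> ('a::euclidean_space \<Rightarrow> real) \<Rightarrow> 'a \<Rightarrow> real \<Rightarrow> real" where
  "self_similar \<alpha> \<beta> T f x t = (T - t) powr \<alpha> * f ((T - t) powr \<beta> *\<^sub>R x)"

definition cauchy_solution ::
    "real \<Rightarrow> real \<Rightarrow> ('a::euclidean_space \<Rightarrow> real) \<Rightarrow> ('a \<Rightarrow> real \<Rightarrow> real) \<Rightarrow> bool" where
  "cauchy_solution m T u0 u \<longleftrightarrow>
     L1_loc u0 \<and> (AE x in lebesgue. 0 \<le> u0 x) \<and>
     (\<forall>x. \<forall>t\<in>{0<..<T}. u x t > 0) \<and>
     C21_on T u \<and>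
     (\<forall>x. \<forall>t\<in>{0<..<T}. deriv (u x) t = laplacian (\<lambda>z. u z t powr m) x) \<and>
     (\<forall>K. compact K \<longrightarrow>
        ((\<lambda>t. LINT x:K|lebesgue. \<bar>u x t - u0 x\<bar>) \<longlongrightarrow> 0) (at_right 0))"

definition rescaled ::
    "real \<Rightarrow> real \<Rightarrow> real \<Rightarrow> ('a::euclidean_space \<Rightarrow> real \<Rightarrow> real) \<Rightarrow> 'a \<Rightarrow> real \<Rightarrow> real" where
  "rescaled \<alpha> \<beta> T u y \<tau> =
     (let t = T * (1 - exp (- \<tau>))
      in (T - t) powr (- \<alpha>) * u ((T - t) powr (- \<beta>) *\<^sub>R y) t)"

end

theory Submission
  imports Defs
begin

text \<open>
  With \<open>q = 2/(1-m)\<close> all profiles are rescalings of one function,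
  \<open>f\<^sub>\<lambda>(y) = |y|\<^sup>-\<^sup>q \<omega>(\<lambda>|y|)\<close>.  In the given range of parameters \<open>\<omega>\<close> overshoots the
  constant belonging to the singular solution and then decreases back to it: it increases strictly on
  \<open>(0, r\<^sub>0]\<close> and decreases strictly on \<open>[r\<^sub>0, \<infinity>)\<close>.  Hence \<open>f\<^sub>\<lambda>\<^sub>1\<close> and \<open>f\<^sub>\<lambda>\<^sub>2\<close> cross, and the upper barrier
  \<open>min(U\<^sub>\<lambda>\<^sub>1, U\<^sub>\<lambda>\<^sub>2)\<close>, which \<open>u\<close> inherits from \<open>u\<^sub>0\<close> by Kato's inequality, is a strict supersolution.

  Let \<open>\<mu>\<close> be the infimum of all \<open>\<lambda>\<close> with \<open>u \<le> U\<^sub>\<lambda>\<close> close to the extinction time, and suppose \<open>\<mu> > 0\<close>.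
  On a ball \<open>|y| \<le> R\<close> in similarity variables with \<open>R\<close> slightly below \<open>r\<^sub>0/\<mu>\<close> the profiles increase
  with \<open>\<lambda>\<close>, so that \<open>u < U\<^sub>\<lambda>'\<close> there for some \<open>\<lambda>'\<close> slightly above \<open>\<mu>\<close>, while \<open>f\<^sub>\<lambda>\<^sub>2 < f\<^sub>\<mu>\<close> on the boundary
  of the ball and outside of it.  Moving the extinction time of \<open>U\<^sub>\<lambda>'\<close> to a slightly earlier moment gives a barrier
  which, relative to \<open>U\<^sub>\<lambda>'\<close>, decreases by a factor independent of the initial gap; this pushes \<open>u\<close> below
  some \<open>U\<^sub>\<lambda>\<close> with \<open>\<lambda> < \<mu>\<close>.  So \<open>\<mu> = 0\<close>, and \<open>f\<^sub>\<lambda> \<rightarrow> 0\<close> locally uniformly as \<open>\<lambda> \<rightarrow> 0\<close>.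
\<close>

section \<open>Partial derivatives and radial profiles\<close>

text \<open>With \<open>s = ln r\<close> the profile equation becomes an autonomous equation
  \<open>v'' = g v - a v * v'\<close>. At its equilibrium \<open>V\<close> the characteristic
  polynomial is \<open>x^2 + a V * x + 2 * N\<close>; the bound \<beta> > \<open>beta_2 n m\<close>
  says that its roots are real, distinct and negative, so that the orbit need not oscillate around
  \<open>V\<close>. Two obstacles shape the rest. The initial value is attained only in the sense of
  L^1_loc and nothing is known about \<open>u\<close> at infinity, so the maximum principle cannot
  start at time 0; an integral estimate replaces it, in which the sublinear power m < 1 makes the
  influence of infinity disappear. And the infimum \<mu> comes without any rate: parameters close to
  \<mu> may become admissible only very late and with a very small gap. The shifted barrier
  overcomes this because extinction times are unstable: for \<open>T' < T\<close> the ratio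
  \<open>(T' - t) / (T - t)\<close> falls from any value below 1 down to 0 as t increases to
  \<open>T'\<close>, so a fixed decrease is reached however small the initial shift was.\<close>

definition has_pd :: "'a::euclidean_space \<Rightarrow> ('a \<Rightarrow> real) \<Rightarrow> 'a \<Rightarrow> real \<Rightarrow> bool" where
  "has_pd e f x d \<longleftrightarrow> ((\<lambda>s. f (x + s *\<^sub>R e)) has_real_derivative d) (at 0)"

text \<open>\<open>has_pd\<close> packs existence and value into one relation, so the rules of
  calculus compose without separate differentiability goals; this equivalence leads back to the
  notions used in \<open>C2\<close> and \<open>laplacian\<close>.\<close>

lemma has_pd_iff: "has_pd e f x d \<longleftrightarrow> has_partial e f x \<and> partial_deriv e f x = d"
  unfolding has_pd_def has_partial_def partial_deriv_def
  by (metis DERIV_deriv_iff_field_differentiable DERIV_imp_deriv field_differentiable_def)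

lemma has_pd_partial_deriv: "has_partial e f x \<Longrightarrow> has_pd e f x (partial_deriv e f x)"
  by (simp add: has_pd_iff)

lemma has_pd_line:
  "has_pd e f (x + t *\<^sub>R e) d \<longleftrightarrow> ((\<lambda>s. f (x + s *\<^sub>R e)) has_real_derivative d) (at t)"
  using DERIV_shift[of "\<lambda>s. f (x + s *\<^sub>R e)" d 0 t]
  by (simp add: has_pd_def algebra_simps)

lemma has_pd_const: "has_pd e (\<lambda>x. c) x 0"
  by (simp add: has_pd_def)

lemma has_pd_diff:
  "has_pd e f x a \<Longrightarrow> has_pd e g x b \<Longrightarrow> has_pd e (\<lambda>x. f x - g x) x (a - b)"
  unfolding has_pd_def by (rule DERIV_diff)

lemma has_pd_mult:
  "has_pd e f x a \<Longrightarrow> has_pd e g x b \<Longrightarrow> has_pd e (\<lambda>x. f x * g x) x (a * g x + b * f x)"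
  unfolding has_pd_def by (drule (1) DERIV_mult) simp

lemma has_pd_chain:
  "(G has_real_derivative c) (at (f x)) \<Longrightarrow> has_pd e f x d \<Longrightarrow> has_pd e (\<lambda>x. G (f x)) x (c * d)"
  unfolding has_pd_def by (rule DERIV_chain2) simp_all

lemma has_pd_powr:
  assumes "has_pd e f x d" "0 < f x"
  shows "has_pd e (\<lambda>x. f x powr m) x (m * f x powr (m - 1) * d)"
  by (rule has_pd_chain[OF _ assms(1), where G = "\<lambda>z. z powr m"])
     (use assms(2) in \<open>auto intro!: derivative_eq_intros\<close>)

lemma has_pd_scale:
  assumes "has_pd e f (b *\<^sub>R x) d"
  shows "has_pd e (\<lambda>z. a * f (b *\<^sub>R z)) x (a * (b * d))"
proof -
  have "((\<lambda>s. f (b *\<^sub>R x + (b * s) *\<^sub>R e)) has_real_derivative d * (b * 1)) (at 0)"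
    by (rule DERIV_chain2[where f = "\<lambda>s. f (b *\<^sub>R x + s *\<^sub>R e)"])
       (use assms in \<open>auto simp: has_pd_def intro!: derivative_eq_intros\<close>)
  from DERIV_cmult[OF this, of a] show ?thesis
    by (simp add: has_pd_def algebra_simps)
qed

lemma partial_deriv_eqI: "has_pd e f x d \<Longrightarrow> partial_deriv e f x = d"
  by (simp add: has_pd_iff)

lemma C2D:
  assumes "C2 f" "i \<in> Basis"
  shows "has_pd i f x (partial_deriv i f x)" "continuous_on S (partial_deriv i f)"
    "j \<in> Basis \<Longrightarrow> has_pd j (partial_deriv i f) x (partial_deriv j (partial_deriv i f) x)"
    "j \<in> Basis \<Longrightarrow> continuous_on S (partial_deriv j (partial_deriv i f))"
  using assms continuous_on_subset[OF _ subset_UNIV] unfolding C2_def has_pd_iff by blast+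

section \<open>Powers and rescalings of functions with two derivatives\<close>

lemma laplacian_powr:
  fixes u :: "'a::euclidean_space \<Rightarrow> real"
  assumes u: "\<And>x. 0 < u x"
    and u1: "\<And>i x. i \<in> Basis \<Longrightarrow> has_pd i u x (u1 i x)"
    and u2: "\<And>i x. i \<in> Basis \<Longrightarrow> has_pd i (u1 i) x (u2 i x)"
    and i: "i \<in> Basis"
  shows "has_pd i (\<lambda>x. u x powr m) x (m * u x powr (m - 1) * u1 i x)"
    and "has_pd i (\<lambda>x. m * u x powr (m - 1) * u1 i x) x
       (m * (m - 1) * u x powr (m - 2) * (u1 i x)\<^sup>2 + m * u x powr (m - 1) * u2 i x)"
    and "laplacian (\<lambda>x. u x powr m) x =
      (\<Sum>i\<in>Basis. m * (m - 1) * u x powr (m - 2) * (u1 i x)\<^sup>2 + m * u x powr (m - 1) * u2 i x)"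
proof -
  have 1: "has_pd i (\<lambda>x. u x powr m) x (m * u x powr (m - 1) * u1 i x)" if "i \<in> Basis" for i x
    using has_pd_powr[OF u1[OF that] u] .
  have 2: "has_pd i (\<lambda>x. m * u x powr (m - 1) * u1 i x) x
       (m * (m - 1) * u x powr (m - 2) * (u1 i x)\<^sup>2 + m * u x powr (m - 1) * u2 i x)" if i: "i \<in> Basis" for i x
  proof -
    have "has_pd i (\<lambda>x. m * (u x powr (m - 1) * u1 i x)) x (0 * (u x powr (m - 1) * u1 i x) +
        (((m - 1) * u x powr (m - 1 - 1) * u1 i x) * u1 i x + u2 i x * u x powr (m - 1)) * m)"
      by (intro has_pd_mult has_pd_powr u1 u2 u i has_pd_const)
    thus ?thesis by (simp add: power2_eq_square algebra_simps)
  qed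
  have "partial_deriv i (\<lambda>x. u x powr m) = (\<lambda>x. m * u x powr (m - 1) * u1 i x)" if "i \<in> Basis" for i
    using partial_deriv_eqI[OF 1[OF that]] by (rule ext)
  thus "laplacian (\<lambda>x. u x powr m) x =
      (\<Sum>i\<in>Basis. m * (m - 1) * u x powr (m - 2) * (u1 i x)\<^sup>2 + m * u x powr (m - 1) * u2 i x)"
    unfolding laplacian_def by (intro sum.cong refl) (use partial_deriv_eqI[OF 2] in simp)
  show "has_pd i (\<lambda>x. u x powr m) x (m * u x powr (m - 1) * u1 i x)" by (rule 1[OF i])
  show "has_pd i (\<lambda>x. m * u x powr (m - 1) * u1 i x) x
       (m * (m - 1) * u x powr (m - 2) * (u1 i x)\<^sup>2 + m * u x powr (m - 1) * u2 i x)" by (rule 2[OF i])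
qed

lemma C2_powr:
  assumes C2: "C2 f" and pos: "\<And>x. 0 < f x" and i: "i \<in> Basis"
  shows "has_partial i (\<lambda>z. f z powr m) x"
    and "has_partial i (partial_deriv i (\<lambda>z. f z powr m)) x"
proof -
  have d1: "has_pd i f x (partial_deriv i f x)"
    and d2: "has_pd i (partial_deriv i f) x (partial_deriv i (partial_deriv i f) x)"
    if "i \<in> Basis" for i x
    using C2D(1,3)[OF C2 that] that by blast+
  note lp = laplacian_powr[OF pos d1 d2 i]
  show "has_partial i (\<lambda>z. f z powr m) x"
    using lp(1) by (simp add: has_pd_iff)
  have "partial_deriv i (\<lambda>z. f z powr m) = (\<lambda>x. m * f x powr (m - 1) * partial_deriv i f x)"
    using partial_deriv_eqI[OF lp(1)] by (simp add: fun_eq_iff)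
  thus "has_partial i (partial_deriv i (\<lambda>z. f z powr m)) x"
    using lp(2) by (simp add: has_pd_iff)
qed

text \<open>Only the repeated partial derivatives in each coordinate direction are assumed, not
  \<open>C2\<close>: the lemma is applied to \<open>f powr m\<close>, for which
  \<open>C2_powr\<close> supplies just these.\<close>

lemma laplacian_scale:
  fixes f :: "'a::euclidean_space \<Rightarrow> real"
  assumes "\<And>i x. i \<in> Basis \<Longrightarrow> has_partial i f x"
    and "\<And>i x. i \<in> Basis \<Longrightarrow> has_partial i (partial_deriv i f) x"
  shows "laplacian (\<lambda>z. a * f (b *\<^sub>R z)) x = a * b\<^sup>2 * laplacian f (b *\<^sub>R x)"
proof -
  have 1: "partial_deriv i (\<lambda>z. a * f (b *\<^sub>R z)) = (\<lambda>x. (a * b) * partial_deriv i f (b *\<^sub>R x))"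
    if "i \<in> Basis" for i
    using partial_deriv_eqI[OF has_pd_scale[OF has_pd_partial_deriv[OF assms(1)[OF that]]]]
    by (simp add: fun_eq_iff mult.assoc)
  have 2: "partial_deriv i (\<lambda>x. (a * b) * partial_deriv i f (b *\<^sub>R x)) x
      = a * b\<^sup>2 * partial_deriv i (partial_deriv i f) (b *\<^sub>R x)" if "i \<in> Basis" for i
    using partial_deriv_eqI[OF has_pd_scale[OF has_pd_partial_deriv[OF assms(2)[OF that]], where a = "a * b"]]
    by (simp add: power2_eq_square mult.assoc)
  show ?thesis
    unfolding laplacian_def by (simp add: 1 2 sum_distrib_left)
qed

lemma C2_scale:
  fixes f :: "'a::euclidean_space \<Rightarrow> real"
  assumes f: "C2 f"
  shows "C2 (\<lambda>z. a * f (b *\<^sub>R z))"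
    and "i \<in> Basis \<Longrightarrow> partial_deriv i (\<lambda>z. a * f (b *\<^sub>R z)) x = a * b * partial_deriv i f (b *\<^sub>R x)"
    and "i \<in> Basis \<Longrightarrow> j \<in> Basis \<Longrightarrow> partial_deriv j (partial_deriv i (\<lambda>z. a * f (b *\<^sub>R z))) x
      = a * b\<^sup>2 * partial_deriv j (partial_deriv i f) (b *\<^sub>R x)"
proof -
  have h1: "has_pd i (\<lambda>z. a * f (b *\<^sub>R z)) x ((a * b) * partial_deriv i f (b *\<^sub>R x))"
    if "i \<in> Basis" for i x
    using has_pd_scale[OF C2D(1)[OF f that]] by (simp add: mult.assoc)
  have 1: "partial_deriv i (\<lambda>z. a * f (b *\<^sub>R z)) = (\<lambda>x. (a * b) * partial_deriv i f (b *\<^sub>R x))"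
    if "i \<in> Basis" for i
    using partial_deriv_eqI[OF h1[OF that]] by (rule ext)
  have h2: "has_pd j (\<lambda>x. (a * b) * partial_deriv i f (b *\<^sub>R x)) x
       (a * b\<^sup>2 * partial_deriv j (partial_deriv i f) (b *\<^sub>R x))" if "i \<in> Basis" "j \<in> Basis" for i j x
    using has_pd_scale[OF C2D(3)[OF f that], where a = "a * b"] by (simp add: mult.assoc power2_eq_square)
  have 2: "partial_deriv j (\<lambda>x. (a * b) * partial_deriv i f (b *\<^sub>R x))
      = (\<lambda>x. a * b\<^sup>2 * partial_deriv j (partial_deriv i f) (b *\<^sub>R x))" if "i \<in> Basis" "j \<in> Basis" for i j
    using partial_deriv_eqI[OF h2[OF that]] by (rule ext)
  have c: "continuous_on UNIV (\<lambda>x. c * g (b *\<^sub>R x))" if "continuous_on UNIV g" for g :: "'a \<Rightarrow> real" and c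
    by (intro continuous_intros continuous_on_compose2[OF that]) auto
  have "continuous_on UNIV f" using f by (simp add: C2_def)
  thus "C2 (\<lambda>z. a * f (b *\<^sub>R z))"
    using h1 h2 c C2D(2)[OF f] C2D(4)[OF f]
    by (simp add: C2_def 1 2 has_pd_iff)
  show "i \<in> Basis \<Longrightarrow> partial_deriv i (\<lambda>z. a * f (b *\<^sub>R z)) x = a * b * partial_deriv i f (b *\<^sub>R x)"
    by (simp add: 1)
  show "i \<in> Basis \<Longrightarrow> j \<in> Basis \<Longrightarrow> partial_deriv j (partial_deriv i (\<lambda>z. a * f (b *\<^sub>R z))) x
      = a * b\<^sup>2 * partial_deriv j (partial_deriv i f) (b *\<^sub>R x)"
    by (simp add: 1 2)
qed

section \<open>Radial functions and the radial form of the profile equation\<close>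

lemma has_pd_radial:
  fixes x :: "'a::euclidean_space"
  assumes F: "(F has_real_derivative d) (at (norm x))" and "x \<noteq> 0"
  shows "has_pd i (\<lambda>x. F (norm x)) x (d * ((x \<bullet> i) / norm x))"
proof -
  have "((\<lambda>s. norm (x + s *\<^sub>R i)) has_derivative (\<lambda>s. (s *\<^sub>R i) \<bullet> sgn x)) (at 0)"
    by (rule has_derivative_compose[of "\<lambda>s. x + s *\<^sub>R i" "\<lambda>s. s *\<^sub>R i" 0 UNIV norm, simplified])
       (use has_derivative_norm[OF \<open>x \<noteq> 0\<close>] in \<open>auto intro!: derivative_eq_intros\<close>)
  hence "has_pd i norm x ((x \<bullet> i) / norm x)"
    unfolding has_pd_def has_field_derivative_def
    by (rule has_derivative_eq_rhs) (auto simp: fun_eq_iff sgn_div_norm inner_commute field_simps)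
  thus ?thesis by (rule has_pd_chain[where f = norm and G = F, OF F])
qed

text \<open>On a coordinate axis the directions separate: along \<open>e\<close> the function is
  \<open>G\<close> itself, and each of the remaining \<open>DIM('a) - 1\<close> directions
  contributes \<open>G1 r / r\<close>.\<close>

lemma laplacian_radial:
  fixes e :: "'a::euclidean_space"
  assumes e: "e \<in> Basis" and r: "0 < r"
    and G1: "\<And>r. 0 < r \<Longrightarrow> (G has_real_derivative G1 r) (at r)"
    and G2: "(G1 has_real_derivative G2) (at r)"
  shows "laplacian (\<lambda>x::'a. G (norm x)) (r *\<^sub>R e) = G2 + (real DIM('a) - 1) / r * G1 r"
proof -
  have ne: "norm e = 1" using e by simp
  have pd: "partial_deriv i (\<lambda>x::'a. G (norm x)) z = G1 (norm z) * ((z \<bullet> i) / norm z)"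
    if "z \<noteq> 0" for i z
    by (rule partial_deriv_eqI, rule has_pd_radial) (use that in \<open>auto intro!: G1\<close>)
  have ee: "partial_deriv e (partial_deriv e (\<lambda>x::'a. G (norm x))) (r *\<^sub>R e) = G2"
  proof (rule partial_deriv_eqI)
    have "\<forall>\<^sub>F s in nhds 0. G1 (r + s) = partial_deriv e (\<lambda>x::'a. G (norm x)) (r *\<^sub>R e + s *\<^sub>R e)"
    proof -
      have "\<forall>\<^sub>F s in nhds (0::real). s \<in> {-r<..<r}"
        by (rule eventually_nhds_in_open) (use r in auto)
      thus ?thesis
      proof eventually_elim
        case (elim s)
        have "r *\<^sub>R e + s *\<^sub>R e = (r + s) *\<^sub>R e" by (simp add: algebra_simps)
        moreover have "0 < r + s" using elim by simp
        ultimately show ?case using pd[of "(r + s) *\<^sub>R e" e] e nonzero_Basis[OF e] by simp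
      qed
    qed
    from DERIV_cong_ev[OF refl this refl, THEN iffD1]
    have "((\<lambda>s. G1 (r + s)) has_real_derivative G2) (at 0) \<Longrightarrow>
      has_pd e (partial_deriv e (\<lambda>x::'a. G (norm x))) (r *\<^sub>R e) G2"
      by (simp add: has_pd_def)
    moreover have "((\<lambda>s. G1 (r + s)) has_real_derivative G2) (at 0)"
      using DERIV_shift[of G1 G2 0 r] G2 by (simp add: add.commute)
    ultimately show "has_pd e (partial_deriv e (\<lambda>x::'a. G (norm x))) (r *\<^sub>R e) G2"
      by blast
  qed
  have ei: "partial_deriv i (partial_deriv i (\<lambda>x::'a. G (norm x))) (r *\<^sub>R e) = G1 r / r"
    if i: "i \<in> Basis" "i \<noteq> e" for i
  proof (rule partial_deriv_eqI)
    have ie: "e \<bullet> i = 0" using i e by (simp add: inner_Basis)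
    \<comment> \<open>Across the axis the first partial derivative is \<open>s * K s\<close>, so its
      derivative at 0 is the limit of \<open>K\<close>. Continuity of \<open>G1\<close> suffices
      here.\<close>
    define K where "K s = G1 (norm (r *\<^sub>R e + s *\<^sub>R i)) / norm (r *\<^sub>R e + s *\<^sub>R i)" for s
    have nz: "r *\<^sub>R e + s *\<^sub>R i \<noteq> 0" for s
    proof
      assume "r *\<^sub>R e + s *\<^sub>R i = 0"
      hence "(r *\<^sub>R e + s *\<^sub>R i) \<bullet> e = 0" by simp
      thus False using ie e r by (simp add: inner_add_left inner_commute[of i e])
    qed
    have eq: "partial_deriv i (\<lambda>x::'a. G (norm x)) (r *\<^sub>R e + s *\<^sub>R i) = s * K s" for s
      unfolding pd[OF nz] K_def using i ie by (simp add: inner_add_left)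
    have nrm: "isCont (\<lambda>s. norm (r *\<^sub>R e + s *\<^sub>R i)) 0" by (intro continuous_intros)
    have "isCont G1 (norm (r *\<^sub>R e + 0 *\<^sub>R i))" using DERIV_isCont[OF G2] r ne by simp
    with nrm have "isCont (\<lambda>s. G1 (norm (r *\<^sub>R e + s *\<^sub>R i))) 0" by (rule isCont_o2)
    from isCont_divide[OF this nrm] nz[of 0] have "isCont K 0"
      by (simp add: K_def[abs_def])
    hence "(K \<longlongrightarrow> G1 r / r) (at 0)" using r ne by (simp add: isCont_def K_def)
    hence "((\<lambda>s. (s * K s - 0 * K 0) / (s - 0)) \<longlongrightarrow> G1 r / r) (at 0)"
      by (rule Lim_transform_eventually) (auto simp: eventually_at_filter)
    hence "((\<lambda>s. s * K s) has_real_derivative G1 r / r) (at 0)"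
      by (simp add: has_field_derivative_iff)
    thus "has_pd i (partial_deriv i (\<lambda>x::'a. G (norm x))) (r *\<^sub>R e) (G1 r / r)"
      by (simp add: has_pd_def eq)
  qed
  have "laplacian (\<lambda>x::'a. G (norm x)) (r *\<^sub>R e) =
     G2 + (\<Sum>i\<in>Basis - {e}. G1 r / r)"
    unfolding laplacian_def by (subst sum.remove[OF _ e]) (auto simp: ee ei)
  also have "\<dots> = G2 + (real DIM('a) - 1) / r * G1 r"
    using e by (simp add: card_Diff_singleton of_nat_diff)
  finally show ?thesis .
qed

text \<open>Restricting to the axis through \<open>e\<close> turns the profile equation into an
  ordinary one. It is written for the flux \<open>m * F r powr (m - 1) * F1 r\<close> because both
  the phase-plane variable \<open>H\<close> and the uniqueness proof work with the flux, not with
  \<open>F1\<close>. The argument of \<open>F\<close> runs over all reals, so the derivative at 0 is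
  two-sided.\<close>

lemma profile_radial_ode:
  fixes f :: "'a::euclidean_space \<Rightarrow> real" and e :: 'a
  assumes f: "is_profile m \<alpha> \<beta> l f" and e: "e \<in> Basis"
    and F_def: "F = (\<lambda>r. f (r *\<^sub>R e))"
    and F1_def: "F1 = (\<lambda>r. partial_deriv e f (r *\<^sub>R e))"
  shows "f x = F (norm x)" "0 < F r" "F 0 = l powr (2 / (1 - m))"
    and "(F has_real_derivative F1 r) (at r)" "continuous_on S F1"
    and "y \<bullet> grad f y = norm y * F1 (norm y)"
    and "0 < r \<Longrightarrow> ((\<lambda>r. m * F r powr (m - 1) * F1 r) has_real_derivative
      - ((real DIM('a) - 1) / r * (m * F r powr (m - 1) * F1 r)) - \<alpha> * F r - \<beta> * r * F1 r) (at r)"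
proof -
  have C2: "C2 f" and pos: "0 < f y" and rad: "norm x = norm y \<Longrightarrow> f x = f y"
    and pde: "laplacian (\<lambda>z. f z powr m) y + \<alpha> * f y + \<beta> * (y \<bullet> grad f y) = 0"
    and f0: "f 0 = l powr (2 / (1 - m))" for x y
    using f unfolding is_profile_def by blast+
  have ne: "norm e = 1" using e by simp
  show fF: "f x = F (norm x)" for x
    unfolding F_def by (rule rad) (simp add: ne)
  show Fpos: "0 < F r" for r by (simp add: F_def pos)
  show "F 0 = l powr (2 / (1 - m))" using f0 by (simp add: F_def)
  show F1: "(F has_real_derivative F1 r) (at r)" for r
    using has_pd_line[of e f 0 r] C2D(1)[OF C2 e, of "r *\<^sub>R e"] by (simp add: F_def F1_def)
  show "continuous_on S F1" for S
    unfolding F1_def by (intro continuous_on_compose2[OF C2D(2)[OF C2 e, of UNIV]] continuous_intros) auto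
  show gr: "y \<bullet> grad f y = norm y * F1 (norm y)" for y
  proof (cases "y = 0")
    case False
    have "partial_deriv i f y = F1 (norm y) * ((y \<bullet> i) / norm y)" for i
      using partial_deriv_eqI[OF has_pd_radial[OF F1 False]] fF[abs_def] by simp
    hence "y \<bullet> grad f y = (\<Sum>i\<in>Basis. F1 (norm y) / norm y * ((y \<bullet> i) * (y \<bullet> i)))"
      unfolding grad_def by (simp add: inner_sum_right field_simps)
    also have "\<dots> = F1 (norm y) / norm y * (y \<bullet> y)"
      unfolding sum_distrib_left[symmetric] by (simp add: euclidean_inner[symmetric])
    also have "\<dots> = norm y * F1 (norm y)"
      using False by (simp add: dot_square_norm power2_eq_square)
    finally show ?thesis .
  qed simp
  define G1 where "G1 r = m * F r powr (m - 1) * F1 r" for r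
  show "((\<lambda>r. m * F r powr (m - 1) * F1 r) has_real_derivative
      - ((real DIM('a) - 1) / r * (m * F r powr (m - 1) * F1 r)) - \<alpha> * F r - \<beta> * r * F1 r) (at r)" if r: "0 < r"
  proof -
    have G: "((\<lambda>r. F r powr m) has_real_derivative G1 r) (at r)" for r
      unfolding G1_def using Fpos by (auto intro!: derivative_eq_intros F1)
    have "(F1 has_real_derivative partial_deriv e (partial_deriv e f) (r *\<^sub>R e)) (at r)"
      using has_pd_line[of e "partial_deriv e f" 0 r] C2D(3)[OF C2 e e, of "r *\<^sub>R e"] by (simp add: F1_def)
    hence "\<exists>G2. (G1 has_real_derivative G2) (at r)"
      unfolding G1_def[abs_def] using Fpos[of r] by (intro exI) (auto intro!: derivative_eq_intros F1)
    then obtain G2 where G2: "(G1 has_real_derivative G2) (at r)" by blast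
    have "laplacian (\<lambda>z. f z powr m) (r *\<^sub>R e) = G2 + (real DIM('a) - 1) / r * G1 r"
      using laplacian_radial[OF e r G G2] fF[abs_def] by simp
    moreover have "(r *\<^sub>R e) \<bullet> grad f (r *\<^sub>R e) = r * F1 r"
      unfolding gr using r ne by simp
    ultimately have "G2 = - ((real DIM('a) - 1) / r * G1 r) - \<alpha> * F r - \<beta> * r * F1 r"
      using pde[of "r *\<^sub>R e"] r by (auto simp: F_def algebra_simps)
    with G2 show ?thesis by (simp add: G1_def[abs_def])
  qed
qed

section \<open>The phase plane of the profile equation\<close>

lemma first_zero:
  fixes E :: "real \<Rightarrow> real"
  assumes cont: "continuous_on {a..b} E" and "a \<le> b" "0 < E a" "E b \<le> 0"
  obtains x where "a < x" "x \<le> b" "E x = 0" "\<And>y. a \<le> y \<Longrightarrow> y < x \<Longrightarrow> 0 < E y"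
proof -
  define S where "S = {a..b} \<inter> E -` {..0}"
  have "compact S"
    using continuous_closed_preimage[OF cont closed_atLeastAtMost closed_atMost[of 0]]
    by (simp add: S_def compact_eq_bounded_closed bounded_subset[of "{a..b}"])
  moreover have "S \<noteq> {}" using assms by (auto simp: S_def)
  ultimately obtain x where x: "x \<in> S" "\<And>y. y \<in> S \<Longrightarrow> x \<le> y"
    using compact_attains_inf[of S] by auto
  have lt: "0 < E y" if "a \<le> y" "y < x" for y
    using that x(1) x(2)[of y] by (auto simp: S_def not_le[symmetric])
  have ax: "a < x" using x(1) assms by (cases "a = x") (auto simp: S_def)
  have "E x = 0"
  proof (rule ccontr)
    assume ne: "E x \<noteq> 0"
    have "continuous_on {a..x} E"
      using cont by (rule continuous_on_subset) (use x in \<open>auto simp: S_def\<close>)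
    then obtain y where "a \<le> y" "y \<le> x" "E y = 0"
      using IVT2'[of E x 0 a] x(1) assms ax by (auto simp: S_def)
    with lt[of y] ne show False by (cases "y = x") auto
  qed
  show ?thesis by (rule that[of x]) (use ax x lt \<open>E x = 0\<close> in \<open>auto simp: S_def\<close>)
qed

text \<open>Every zero of \<open>D\<close> from \<open>s0\<close> on is crossed strictly downwards,
  so after leaving 0 at \<open>s0\<close> the function cannot come back to 0 from below.\<close>

lemma neg_after_zero:
  fixes D D' :: "real \<Rightarrow> real"
  assumes der: "\<And>s. s0 \<le> s \<Longrightarrow> (D has_real_derivative D' s) (at s)"
    and z: "D s0 = 0"
    and neg: "\<And>s. s0 \<le> s \<Longrightarrow> D s = 0 \<Longrightarrow> D' s < 0"
    and s: "s0 < s"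
  shows "D s < 0"
proof (rule ccontr)
  assume "\<not> D s < 0"
  hence Ds: "0 \<le> D s" by simp
  obtain d where d: "d > 0" "\<And>h. 0 < h \<Longrightarrow> h < d \<Longrightarrow> D (s0 + h) < D s0"
    using DERIV_neg_dec_right[OF der[of s0] neg[of s0]] z by auto
  define a where "a = s0 + min (d/2) ((s - s0)/2)"
  have a: "s0 < a" "a < s" using d s by (auto simp: a_def min_def field_simps)
  have Da: "D a < 0" using d(2)[of "min (d/2) ((s-s0)/2)"] d(1) s z by (auto simp: a_def min_def)
  have "continuous_on {a..s} (\<lambda>s. - D s)"
    by (intro continuous_intros continuous_at_imp_continuous_on ballI DERIV_isCont[OF der]) (use a in auto)
  then obtain b where b: "a < b" "b \<le> s" "- D b = 0" "\<And>y. a \<le> y \<Longrightarrow> y < b \<Longrightarrow> 0 < - D y"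
    by (rule first_zero) (use a Da Ds in auto)
  have sb: "s0 \<le> b" using a b by simp
  have Db: "D b = 0" using b by simp
  obtain e where e: "e > 0" "\<And>h. 0 < h \<Longrightarrow> h < e \<Longrightarrow> D b < D (b - h)"
    using DERIV_neg_dec_left[OF der[OF sb] neg[OF sb Db]] by auto
  have "D b < D (b - min (e/2) ((b-a)/2))" by (rule e(2)) (use e b in \<open>auto simp: min_def\<close>)
  moreover have "0 < - D (b - min (e/2) ((b-a)/2))"
    by (rule b(4)) (use e b in \<open>auto simp: min_def field_simps\<close>)
  ultimately show False using Db by simp
qed

lemma deriv_ge_imp_unbounded:
  fixes Y Y' :: "real \<Rightarrow> real"
  assumes "\<And>s. a \<le> s \<Longrightarrow> (Y has_real_derivative Y' s) (at s)" "\<And>s. a \<le> s \<Longrightarrow> d \<le> Y' s" "d > 0"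
  shows "\<exists>s1. \<forall>s\<ge>s1. Z \<le> Y s"
proof -
  have "Y s \<ge> Y a + d * (s - a)" if "s \<ge> a" for s
  proof -
    have "Y a - d * a \<le> Y s - d * s"
      by (rule DERIV_nonneg_imp_nondecreasing[OF that])
         (auto intro!: derivative_eq_intros assms(1) exI[of _ "Y' _ - d"] simp: assms(2))
    thus ?thesis by (simp add: algebra_simps)
  qed
  hence "Z \<le> Y s" if "s \<ge> max a (a + (Z - Y a) / d)" for s
    using that \<open>d > 0\<close> by (force simp: field_simps intro: order_trans)
  thus ?thesis by blast
qed

lemma powr_above_tangent:
  fixes x y p :: real
  assumes "1 < p" "0 < x" "0 < y"
  shows "p * x powr (p - 1) * (y - x) \<le> y powr p - x powr p"
proof -
  have "convex_on {0<..} (\<lambda>x::real. x powr p)"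
  proof (rule f''_ge0_imp_convex[where f' = "\<lambda>x. p * x powr (p-1)" and f'' = "\<lambda>x. p * ((p-1) * x powr (p-2))"])
    show "convex {0::real<..}" by simp
  qed (use assms in \<open>auto intro!: derivative_eq_intros simp: \<close>)
  thus ?thesis
    by (rule convex_on_imp_above_tangent[where A = "{0<..}"])
       (use assms in \<open>auto intro!: derivative_eq_intros connected_Ioi simp: interior_open\<close>)
qed

text \<open>The profile equation in Emden-Fowler variables: for \<open>s = ln r\<close> the
  instances are \<open>v = r^k * F^m\<close> and \<open>H = r^(k+1)\<close> times the sum of the
  diffusive flux and \<open>\<beta> * r * F\<close>. Adding the transport term keeps derivatives of
  \<open>F\<close> out of the equation for \<open>H\<close>. \<open>H_at_bot\<close> and
  \<open>v_inc_at_bot\<close> express regularity at the origin, \<open>supercritical\<close> rules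
  out a monotone approach to \<open>V\<close> from below, and \<open>barrier\<close> says that
  orbits above \<open>V\<close> cannot cross the line of slope \<open>- \<gamma>\<close> through the
  equilibrium downwards.\<close>

locale emden_fowler_orbit =
  fixes v H :: "real \<Rightarrow> real" and k N c \<beta> p V \<gamma> :: real
  assumes v_deriv: "(v has_real_derivative (H s + k * v s - \<beta> * v s powr p)) (at s)"
    and H_deriv: "(H has_real_derivative (- N * H s - c * v s powr p)) (at s)"
    and v_pos: "0 < v s"
    and params: "1 < p" "0 < k" "0 < N" "0 < c" "0 < \<beta>" "0 < V" "0 < \<gamma>"
    and equilibrium: "k * N * V = (c + \<beta> * N) * V powr p"
    and H_at_bot: "((\<lambda>s. exp (N * s) * H s) \<longlongrightarrow> 0) at_bot"
    and v_inc_at_bot: "\<forall>\<^sub>F s in at_bot. 0 < H s + k * v s - \<beta> * v s powr p"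
    and supercritical: "N + k < \<beta> * p * V powr (p - 1)"
    and barrier: "V \<le> x \<Longrightarrow> 0 \<le> k * N * x - (c + \<beta> * N) * x powr p
        + \<gamma> * (x - V) * (\<beta> * p * x powr (p - 1) + N - k - \<gamma>)"
begin

definition dv :: "real \<Rightarrow> real" where "dv s = H s + k * v s - \<beta> * v s powr p"
text \<open>\<open>g\<close> is the force and \<open>a\<close> the damping in the second-order
  equation for \<open>v\<close>, see \<open>dv_has_deriv\<close>; \<open>V\<close> is the only
  positive zero of \<open>g\<close>.\<close>

definition g :: "real \<Rightarrow> real" where "g x = k * N * x - (c + \<beta> * N) * x powr p"
definition a :: "real \<Rightarrow> real" where "a x = \<beta> * p * x powr (p - 1) + N - k"

lemma v_has_deriv: "(v has_real_derivative dv s) (at s)"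
  unfolding dv_def by (rule v_deriv)

lemma dv_has_deriv: "(dv has_real_derivative (g (v s) - a (v s) * dv s)) (at s)"
proof -
  have "(dv has_real_derivative (- N * H s - c * v s powr p + k * dv s
      - \<beta> * (p * v s powr (p - 1) * dv s))) (at s)"
    unfolding dv_def[abs_def]
    by (auto intro!: derivative_eq_intros H_deriv v_deriv simp: v_pos)
  moreover have "- N * H s - c * v s powr p + k * dv s - \<beta> * (p * v s powr (p - 1) * dv s)
      = g (v s) - a (v s) * dv s"
    by (simp add: g_def a_def dv_def algebra_simps)
  ultimately show ?thesis by simp
qed

lemma g_eq: assumes "0 < x" shows "g x = (c + \<beta> * N) * (x * (V powr (p-1) - x powr (p-1)))"
proof -
  have eq: "x powr p = x * x powr (p-1)" if "0 < x" for x
    using that by (simp add: powr_mult_base)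
  have "k * N = (c + \<beta> * N) * V powr (p-1)"
    using equilibrium eq[of V] params by simp
  hence "k * N * x = (c + \<beta> * N) * V powr (p-1) * x" by simp
  thus ?thesis
    using eq[OF assms] by (simp add: g_def algebra_simps)
qed

lemma coeff_pos: "0 < c + \<beta> * N" using params by (simp add: add_pos_pos)

lemma g_pos: "0 < x \<Longrightarrow> x < V \<Longrightarrow> 0 < g x"
  using g_eq[of x] coeff_pos params by (auto intro!: mult_pos_pos powr_less_mono2)

lemma g_neg: "V < x \<Longrightarrow> g x < 0"
  using g_eq[of x] coeff_pos params by (auto intro!: mult_pos_neg powr_less_mono2)

lemma isCont_v: "isCont v s" and isCont_dv: "isCont dv s"
  using v_has_deriv dv_has_deriv by (blast intro: DERIV_isCont)+

text \<open>The deviation of \<open>H\<close> from its value \<open>- c * V powr p / N\<close> at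
  the equilibrium.\<close>

definition h :: "real \<Rightarrow> real" where "h s = H s + c * V powr p / N"

lemma dv_eq_h: "dv s = h s - k * (V - v s) + \<beta> * (V powr p - v s powr p)"
proof -
  have "k * V = c * V powr p / N + \<beta> * V powr p"
    using equilibrium params by (simp add: field_simps)
  thus ?thesis by (simp add: dv_def h_def algebra_simps)
qed

lemma exp_h_deriv:
  "((\<lambda>s. exp (N * s) * h s) has_real_derivative exp (N * s) * (c * (V powr p - v s powr p))) (at s)"
  unfolding h_def[abs_def]
  by (auto intro!: derivative_eq_intros H_deriv) (use params in \<open>simp add: field_simps\<close>)

lemma exp_h_strict_mono:
  assumes "\<And>s. s < t \<Longrightarrow> v s < V" "x < y" "y \<le> t"
  shows "exp (N * x) * h x < exp (N * y) * h y"
proof -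
  have "continuous_on {x..y} (\<lambda>s. exp (N * s) * h s)"
    by (intro continuous_at_imp_continuous_on ballI DERIV_isCont[OF exp_h_deriv])
  moreover have "0 < exp (N * s) * (c * (V powr p - v s powr p))" if "s < y" for s
  proof -
    have "v s powr p < V powr p"
      using assms(1)[of s] that assms(3) v_pos[of s] params by (intro powr_less_mono2) auto
    thus ?thesis using params by simp
  qed
  ultimately show ?thesis
    by (intro DERIV_pos_imp_increasing_open[OF \<open>x < y\<close>]) (use exp_h_deriv in \<open>blast+\<close>)
qed

text \<open>Regularity at the origin makes \<open>exp (N * s) * h s\<close> tend to 0 at minus
  infinity, and by \<open>exp_h_deriv\<close> it increases strictly as long as \<open>v\<close>
  stays below \<open>V\<close>.\<close>

lemma h_pos:
  assumes "\<And>s. s < t \<Longrightarrow> v s < V"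
  shows "0 < h t"
proof -
  have lim: "((\<lambda>s. exp (N * s) * h s) \<longlongrightarrow> 0) at_bot"
  proof -
    have "filterlim (\<lambda>s. N * s) at_bot at_bot"
      using params by (simp add: filterlim_tendsto_pos_mult_at_bot[OF tendsto_const] filterlim_ident)
    hence "((\<lambda>s. exp (N * s)) \<longlongrightarrow> 0) at_bot"
      by (rule filterlim_compose[OF exp_at_bot])
    hence "((\<lambda>s. exp (N * s) * H s + exp (N * s) * (c * V powr p / N)) \<longlongrightarrow> 0 + 0 * (c * V powr p / N)) at_bot"
      by (intro tendsto_intros H_at_bot)
    thus ?thesis by (simp add: h_def algebra_simps)
  qed
  \<comment> \<open>The limit gives only a weak inequality; comparing at \<open>t - 1\<close> and
    then moving on to \<open>t\<close> makes it strict.\<close>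
  have "0 \<le> exp (N * (t - 1)) * h (t - 1)"
  proof (rule tendsto_upperbound[OF lim])
    show "\<forall>\<^sub>F s in at_bot. exp (N * s) * h s \<le> exp (N * (t - 1)) * h (t - 1)"
      using eventually_le_at_bot[of "t - 2"]
      by eventually_elim (intro less_imp_le exp_h_strict_mono[OF assms], auto)
  qed simp
  also have "\<dots> < exp (N * t) * h t"
    by (rule exp_h_strict_mono[OF assms]) auto
  finally show ?thesis by (simp add: zero_less_mult_iff)
qed

text \<open>The factor \<open>N\<close> is chosen so that \<open>H\<close> cancels: the derivative
  depends on \<open>v\<close> alone, and a sign of \<open>g\<close> can drive this combination to
  infinity.\<close>

lemma Y_deriv: "((\<lambda>s. H s + N * v s) has_real_derivative g (v s)) (at s)"
  by (rule derivative_eq_intros H_deriv v_deriv refl)+ (simp add: g_def algebra_simps)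

lemma powr_dominates_linear:
  obtains C where "\<And>x. 0 < x \<Longrightarrow> C \<le> (N - k) * x + \<beta> * x powr p"
proof -
  define K where "K = \<bar>N - k\<bar>"
  \<comment> \<open>Beyond \<open>x0\<close>, where \<open>\<beta> * x powr (p - 1)\<close> reaches
    \<open>K\<close>, the power dominates the linear term.\<close>
  define x0 where "x0 = (K / \<beta>) powr (1 / (p - 1))"
  have "- K * x0 \<le> (N - k) * x + \<beta> * x powr p" if x: "0 < x" for x
  proof -
    have 1: "- K * x \<le> (N - k) * x"
      using x by (intro mult_right_mono) (auto simp: K_def)
    have px: "x powr p = x * x powr (p-1)" using x by (simp add: powr_mult_base)
    show ?thesis
    proof (cases "x \<le> x0")
      case True
      hence "- K * x0 \<le> - K * x" by (simp add: K_def mult_left_mono)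
      moreover have "0 \<le> \<beta> * x powr p" using params by simp
      ultimately show ?thesis using 1 by linarith
    next
      case False
      have "K / \<beta> = x0 powr (p - 1)"
        using params by (simp add: x0_def powr_powr K_def)
      also have "\<dots> \<le> x powr (p - 1)" using False params by (intro powr_mono2) (auto simp: x0_def)
      finally have "K * x \<le> \<beta> * x powr (p-1) * x"
        using params x by (intro mult_right_mono) (auto simp: field_simps)
      moreover have "- K * x0 \<le> 0" by (simp add: K_def x0_def)
      ultimately show ?thesis using 1 px by (simp add: algebra_simps)
    qed
  qed
  thus ?thesis by (rule that)
qed

text \<open>Above \<open>V\<close> the force is negative and decreasing, so \<open>H + N * v\<close>
  would tend to minus infinity along an increasing orbit, while \<open>0 < dv\<close> keeps it above
  \<open>(N - k) * v + \<beta> * v powr p\<close>, which is bounded below.\<close>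

lemma not_increasing_above:
  assumes "\<And>s. 0 < dv s" "V < v s1"
  shows False
proof -
  have mono: "v s1 \<le> v s" if "s1 \<le> s" for s
    by (rule DERIV_nonneg_imp_nondecreasing[OF that]) (use v_has_deriv assms less_imp_le in blast)
  obtain C where C: "\<And>x. 0 < x \<Longrightarrow> C \<le> (N - k) * x + \<beta> * x powr p"
    using powr_dominates_linear by blast
  have "g (v s) \<le> g (v s1)" if "s1 \<le> s" for s
  proof -
    have "v s1 * (v s1 powr (p-1) - V powr (p-1)) \<le> v s * (v s powr (p-1) - V powr (p-1))"
      using mono[OF that] assms(2) params v_pos
      by (intro mult_mono diff_right_mono powr_mono2) (auto simp: less_imp_le intro!: powr_mono2)
    hence "v s * (V powr (p-1) - v s powr (p-1)) \<le> v s1 * (V powr (p-1) - v s1 powr (p-1))"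
      by (simp add: algebra_simps)
    thus ?thesis using coeff_pos v_pos by (simp add: g_eq)
  qed
  hence "\<exists>s2. \<forall>s\<ge>s2. 1 - C \<le> - (H s + N * v s)"
    by (intro deriv_ge_imp_unbounded[where a = s1 and d = "- g (v s1)" and Y' = "\<lambda>s. - g (v s)"]
        DERIV_minus Y_deriv) (use g_neg assms in auto)
  then obtain s where "1 - C \<le> - (H s + N * v s)" by blast
  moreover have "0 < H s + N * v s - ((N - k) * v s + \<beta> * v s powr p)"
    using assms(1)[of s] by (simp add: dv_def algebra_simps)
  ultimately show False using C[OF v_pos, of s] by linarith
qed

text \<open>If \<open>v\<close> stayed below \<open>L\<close>, the force would have a positive lower
  bound \<open>d\<close> for \<open>s \<ge> 0\<close>, so \<open>H + N * v\<close> would grow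
  without bound; as \<open>v\<close> is bounded, \<open>dv\<close> would then stay above 1 and carry
  \<open>v\<close> past \<open>L\<close>.\<close>

lemma increasing_exceeds:
  assumes inc: "\<And>s. 0 < dv s" and L: "L < V"
  obtains s where "L < v s"
proof (rule ccontr)
  assume "\<not> thesis"
  hence le: "v s \<le> L" for s using that by (meson not_le)
  have mono: "v 0 \<le> v s" if "0 \<le> s" for s
    by (rule DERIV_nonneg_imp_nondecreasing[OF that]) (use v_has_deriv assms less_imp_le in blast)
  have L0: "0 < L" using le[of 0] v_pos[of 0] by simp
  define d where "d = (c + \<beta> * N) * (v 0 * (V powr (p-1) - L powr (p-1)))"
  have d: "0 < d"
    unfolding d_def using L L0 v_pos coeff_pos params by (auto intro!: mult_pos_pos powr_less_mono2)
  have "d \<le> g (v s)" if "0 \<le> s" for s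
    unfolding d_def g_eq[OF v_pos] using coeff_pos mono[OF that] le[of s] v_pos[of 0] v_pos[of s] L L0 params
    by (intro mult_left_mono mult_mono diff_left_mono powr_mono2) (auto simp: less_imp_le powr_mono2)
  hence "\<exists>s1. \<forall>s\<ge>s1. 1 + \<bar>N - k\<bar> * L + \<beta> * L powr p \<le> H s + N * v s"
    by (intro deriv_ge_imp_unbounded[where a = 0 and d = d and Y' = "\<lambda>s. g (v s)"] Y_deriv d)
  then obtain s1 where s1: "\<And>s. s1 \<le> s \<Longrightarrow> 1 + \<bar>N - k\<bar> * L + \<beta> * L powr p \<le> H s + N * v s"
    by blast
  have "1 \<le> dv s" if "s1 \<le> s" for s
  proof -
    have "(N - k) * v s \<le> \<bar>N - k\<bar> * L" using le[of s] v_pos[of s] by (intro mult_mono) auto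
    moreover have "\<beta> * v s powr p \<le> \<beta> * L powr p"
      using params le[of s] v_pos[of s] by (intro mult_left_mono powr_mono2) (auto simp: less_imp_le)
    ultimately show ?thesis using s1[OF that] by (simp add: dv_def algebra_simps)
  qed
  hence "\<exists>s2. \<forall>s\<ge>s2. 1 + L \<le> v s"
    by (intro deriv_ge_imp_unbounded[where a = s1 and d = 1 and Y' = dv] v_has_deriv) auto
  then obtain s where "1 + L \<le> v s" by blast
  thus False using le[of s] by simp
qed

text \<open>An orbit increasing forever stays below \<open>V\<close> but exceeds every level below
  it. Near \<open>V\<close> the convexity of the power makes \<open>exp (N * s) * (V - v s)\<close>
  decrease at least at the positive rate \<open>exp (N * s1) * h s1\<close>, although it must remain
  positive.\<close>

lemma not_increasing: "\<exists>s. dv s \<le> 0"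
proof (rule ccontr)
  assume "\<not> (\<exists>s. dv s \<le> 0)"
  hence inc: "0 < dv s" for s by (meson not_le)
  have mono: "v x < v y" if "x < y" for x y
    by (rule DERIV_pos_imp_increasing[OF that]) (use v_has_deriv inc in blast)
  have below: "v s < V" for s
  proof (rule ccontr)
    assume "\<not> v s < V"
    hence "V < v (s + 1)" using mono[of s "s + 1"] by simp
    thus False using not_increasing_above[OF inc] by blast
  qed
  \<comment> \<open>\<open>L\<close> solves \<open>\<beta> * p * L powr (p - 1) = N + k\<close>; by
    \<open>supercritical\<close> it lies below \<open>V\<close>, and above it the tangent inequality
    absorbs the growing term \<open>(N + k) * z\<close>.\<close>
  define L where "L = ((N + k) / (\<beta> * p)) powr (1 / (p - 1))"
  have Lp: "L powr (p - 1) = (N + k) / (\<beta> * p)"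
    using params by (simp add: L_def powr_powr)
  have "L powr (p - 1) < V powr (p - 1)"
    unfolding Lp using supercritical params by (simp add: field_simps)
  hence "L < V" using params by (metis linorder_not_less powr_mono2 diff_gt_0_iff_gt less_imp_le)
  then obtain s1 where s1: "L < v s1" by (rule increasing_exceeds[OF inc])
  define z where "z s = exp (N * s) * (V - v s)" for s
  have "(z has_real_derivative ((N + k) * z s - exp (N * s) * (\<beta> * (V powr p - v s powr p)) - exp (N * s) * h s)) (at s)" for s
    unfolding z_def[abs_def]
    by (rule derivative_eq_intros v_has_deriv refl)+ (simp add: dv_eq_h algebra_simps)
  moreover have "exp (N * s1) * h s1 \<le> - ((N + k) * z s - exp (N * s) * (\<beta> * (V powr p - v s powr p)) - exp (N * s) * h s)"
    if s: "s1 \<le> s" for s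
  proof -
    have "exp (N * s1) * h s1 \<le> exp (N * s) * h s"
      using exp_h_strict_mono[of s s1 s] below s by (cases "s = s1") auto
    moreover have "(N + k) * z s \<le> exp (N * s) * (\<beta> * (V powr p - v s powr p))"
    proof -
      have Lv: "L \<le> v s" using s s1 mono[of s1 s] by (cases "s = s1") auto
      have "(N + k) = \<beta> * (p * L powr (p-1))" using params by (simp add: Lp)
      also have "\<dots> \<le> \<beta> * (p * v s powr (p-1))"
        using params Lv by (intro mult_left_mono powr_mono2) (auto simp: L_def)
      finally have "(N + k) * (V - v s) \<le> \<beta> * (p * v s powr (p-1)) * (V - v s)"
        by (rule mult_right_mono) (use below[of s] in simp)
      also have "\<dots> = \<beta> * (p * v s powr (p-1) * (V - v s))" by simp
      also have "\<dots> \<le> \<beta> * (V powr p - v s powr p)"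
        using params v_pos by (intro mult_left_mono powr_above_tangent) auto
      finally have "exp (N * s) * ((N + k) * (V - v s)) \<le> exp (N * s) * (\<beta> * (V powr p - v s powr p))"
        by simp
      thus ?thesis by (simp add: z_def mult.left_commute)
    qed
    ultimately show ?thesis by linarith
  qed
  moreover have "0 < exp (N * s1) * h s1" using h_pos[of s1] below by simp
  ultimately have "\<exists>s2. \<forall>s\<ge>s2. 1 \<le> - z s"
    by (intro deriv_ge_imp_unbounded[where a = s1 and d = "exp (N * s1) * h s1" and
        Y' = "\<lambda>s. - ((N + k) * z s - exp (N * s) * (\<beta> * (V powr p - v s powr p)) - exp (N * s) * h s)"] DERIV_minus)
  then obtain s where "1 \<le> - z s" by blast
  moreover have "0 < z s" using below by (simp add: z_def)
  ultimately show False by simp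
qed

text \<open>The orbit starts above the line \<open>dv = - \<gamma> * (v - V)\<close>, that is with
  \<open>E > 0\<close>, and \<open>barrier\<close> prevents it from reaching the line as long as
  \<open>V < v\<close>. Above the line \<open>exp (\<gamma> * s) * (v - V)\<close> increases, so
  \<open>V < v\<close> persists. The two statements depend on each other; the first zero of
  \<open>E\<close> breaks the circle.\<close>

lemma stays_above:
  assumes "V < v s0" "dv s0 = 0" "s0 \<le> s"
  shows "V < v s"
proof -
  define E where "E s = dv s + \<gamma> * (v s - V)" for s
  have E_deriv: "(E has_real_derivative (g (v s) - a (v s) * dv s + \<gamma> * dv s)) (at s)" for s
    unfolding E_def[abs_def] by (rule derivative_eq_intros v_has_deriv dv_has_deriv refl)+ simp
  have above: "V < v t" if "s0 \<le> t" "\<And>y. s0 \<le> y \<Longrightarrow> y < t \<Longrightarrow> 0 < E y" for t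
  proof -
    have der: "((\<lambda>s. exp (\<gamma> * s) * (v s - V)) has_real_derivative exp (\<gamma> * s) * E s) (at s)" for s
      by (rule derivative_eq_intros v_has_deriv refl)+ (simp add: E_def algebra_simps)
    have "exp (\<gamma> * s0) * (v s0 - V) \<le> exp (\<gamma> * t) * (v t - V)"
    proof (cases "s0 = t")
      case False
      have "continuous_on {s0..t} (\<lambda>s. exp (\<gamma> * s) * (v s - V))"
        by (intro continuous_at_imp_continuous_on ballI DERIV_isCont[OF der])
      moreover have "s0 < t" using False that by simp
      ultimately have "exp (\<gamma> * s0) * (v s0 - V) < exp (\<gamma> * t) * (v t - V)"
        by (intro DERIV_pos_imp_increasing_open[of s0 t "\<lambda>s. exp (\<gamma> * s) * (v s - V)"])
           (auto intro!: exI[of _ "exp (\<gamma> * _) * E _"] der that mult_pos_pos)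
      thus ?thesis by simp
    qed simp
    moreover have "0 < exp (\<gamma> * s0) * (v s0 - V)" using assms(1) by simp
    ultimately have "0 < exp (\<gamma> * t) * (v t - V)" by linarith
    thus ?thesis by (simp add: zero_less_mult_iff)
  qed
  have Epos: "0 < E t" if "s0 \<le> t" for t
  proof (rule ccontr)
    assume Et: "\<not> 0 < E t"
    have E0: "0 < E s0" using assms params by (simp add: E_def)
    have "continuous_on {s0..t} E"
      by (intro continuous_at_imp_continuous_on ballI DERIV_isCont[OF E_deriv])
    then obtain b where b: "s0 < b" "b \<le> t" "E b = 0" "\<And>y. s0 \<le> y \<Longrightarrow> y < b \<Longrightarrow> 0 < E y"
      by (rule first_zero) (use \<open>s0 \<le> t\<close> Et E0 in auto)
    \<comment> \<open>The damping varies along the orbit; an upper bound \<open>K\<close> on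
      \<open>{s0..b}\<close> gives an integrating factor with constant exponent, and then
      \<open>E\<close> cannot have dropped to 0 at \<open>b\<close>.\<close>
    have "continuous_on {s0..b} (\<lambda>s. a (v s))"
      unfolding a_def
      by (intro continuous_intros continuous_at_imp_continuous_on ballI isCont_v) (use v_pos in \<open>auto simp: less_imp_neq[symmetric]\<close>)
    hence "compact ((\<lambda>s. a (v s)) ` {s0..b})" by (intro compact_continuous_image) auto
    hence "bdd_above ((\<lambda>s. a (v s)) ` {s0..b})"
      by (intro bounded_imp_bdd_above compact_imp_bounded)
    then obtain K where K: "\<And>s. s0 \<le> s \<Longrightarrow> s \<le> b \<Longrightarrow> a (v s) \<le> K"
      unfolding bdd_above_def by (metis atLeastAtMost_iff imageI)
    have "exp ((K - \<gamma>) * s0) * E s0 \<le> exp ((K - \<gamma>) * b) * E b"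
    proof (rule DERIV_nonneg_imp_nondecreasing[of s0 b])
      fix s assume s: "s0 \<le> s" "s \<le> b"
      have Vv: "V < v s" using above[of s] s b by auto
      have Es: "0 \<le> E s" using b(3) b(4)[of s] s by (cases "s = b") auto
      have "g (v s) + \<gamma> * (v s - V) * (a (v s) - \<gamma>) \<ge> 0"
        using barrier[of "v s"] Vv by (simp add: g_def a_def)
      hence "(\<gamma> - a (v s)) * E s \<le> g (v s) - a (v s) * dv s + \<gamma> * dv s"
        by (simp add: E_def algebra_simps)
      moreover have "(\<gamma> - K) * E s \<le> (\<gamma> - a (v s)) * E s"
        using K[OF s] Es by (intro mult_right_mono) auto
      ultimately have "0 \<le> (K - \<gamma>) * E s + (g (v s) - a (v s) * dv s + \<gamma> * dv s)"
        by (simp add: algebra_simps)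
      moreover have "((\<lambda>s. exp ((K - \<gamma>) * s) * E s) has_real_derivative
          exp ((K - \<gamma>) * s) * ((K - \<gamma>) * E s + (g (v s) - a (v s) * dv s + \<gamma> * dv s))) (at s)"
        by (rule derivative_eq_intros E_deriv refl)+ (simp add: algebra_simps)
      ultimately show "\<exists>y. ((\<lambda>s. exp ((K - \<gamma>) * s) * E s) has_real_derivative y) (at s) \<and> 0 \<le> y"
        by (meson exp_ge_zero mult_nonneg_nonneg)
    qed (use b in auto)
    moreover have "0 < exp ((K - \<gamma>) * s0) * E s0" using E0 by simp
    ultimately show False using b by simp
  qed
  show ?thesis using above[OF \<open>s0 \<le> s\<close>] Epos by simp
qed

text \<open>At the first zero \<open>s0\<close> of \<open>dv\<close> the value \<open>V\<close> has
  been passed: below \<open>V\<close> the force would make \<open>dv\<close> increase through 0, and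
  at \<open>V\<close> the identity \<open>dv_eq_h\<close> contradicts \<open>h_pos\<close>. From
  then on \<open>v\<close> stays above \<open>V\<close>, where the force is negative, so every zero
  of \<open>dv\<close> is crossed downwards.\<close>

theorem unimodal: "\<exists>s0. (\<forall>s<s0. 0 < dv s) \<and> (\<forall>s>s0. dv s < 0)"
proof -
  obtain b where b: "\<And>s. s \<le> b \<Longrightarrow> 0 < dv s"
    using v_inc_at_bot by (auto simp: dv_def eventually_at_bot_linorder)
  obtain t where t: "dv t \<le> 0" using not_increasing by blast
  have bt: "b \<le> t" using b[of t] t by (cases "t \<le> b") auto
  have "continuous_on {b..t} dv"
    by (intro continuous_at_imp_continuous_on ballI isCont_dv)
  then obtain s0 where s0: "b < s0" "dv s0 = 0" "\<And>y. b \<le> y \<Longrightarrow> y < s0 \<Longrightarrow> 0 < dv y"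
    by (rule first_zero) (use b bt t in auto)
  have pos: "0 < dv s" if "s < s0" for s using b[of s] s0(3)[of s] that by linarith
  have mono: "v x < v y" if "x < y" "y \<le> s0" for x y
    by (rule DERIV_pos_imp_increasing_open[OF that(1)])
       (use v_has_deriv pos that isCont_v in \<open>auto intro!: continuous_at_imp_continuous_on exI\<close>)
  have "V < v s0"
  proof (rule ccontr)
    assume "\<not> V < v s0"
    then consider "v s0 < V" | "v s0 = V" by linarith
    thus False
    proof cases
      case 1
      hence "0 < g (v s0)" using v_pos g_pos by blast
      then obtain d where d: "d > 0" "\<And>x. 0 < x \<Longrightarrow> x < d \<Longrightarrow> dv (s0 - x) < dv s0"
        using DERIV_pos_inc_left[OF dv_has_deriv[of s0]] s0 by auto
      have "dv (s0 - d/2) < dv s0" by (rule d(2)) (use d(1) in auto)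
      moreover have "0 < dv (s0 - d/2)" by (rule pos) (use d(1) in auto)
      ultimately show False using s0(2) by simp
    next
      case 2
      have "0 < h s0" by (rule h_pos) (use mono 2 in force)
      thus False using dv_eq_h[of s0] 2 s0(2) by simp
    qed
  qed
  hence "V < v s" if "s0 \<le> s" for s using stays_above s0 that by blast
  hence "dv s < 0" if "s0 < s" for s
    by (intro neg_after_zero[OF dv_has_deriv s0(2) _ that]) (simp add: g_neg)
  thus ?thesis using pos by blast
qed

end

section \<open>Scaling and self-similar solutions\<close>

text \<open>The radial equation is singular at 0, so the standard uniqueness theorem does not apply.
  Multiplying the difference of the fluxes by \<open>r^(n - 1)\<close> removes the singular term,
  and a maximum norm with weight \<open>exp (- L * r)\<close> turns the resulting estimate into a
  contraction on every interval \<open>{0..R}\<close>.\<close>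

lemma profile_unique:
  fixes f g :: "'a::euclidean_space \<Rightarrow> real"
  assumes f: "is_profile m \<alpha> \<beta> l f" and g: "is_profile m \<alpha> \<beta> l g"
    and dim: "2 \<le> DIM('a)" and m: "0 < m" "m < 1"
  shows "f = g"
proof -
  obtain e :: 'a where e: "e \<in> Basis" using nonempty_Basis by blast
  define F where "F = (\<lambda>r. f (r *\<^sub>R e))"
  define F1 where "F1 = (\<lambda>r. partial_deriv e f (r *\<^sub>R e))"
  define G where "G = (\<lambda>r. g (r *\<^sub>R e))"
  define G1 where "G1 = (\<lambda>r. partial_deriv e g (r *\<^sub>R e))"
  note Fode = profile_radial_ode[OF f e F_def F1_def]
  note Gode = profile_radial_ode[OF g e G_def G1_def]
  define n where "n = DIM('a)"
  \<comment> \<open>\<open>Suc j\<close> is \<open>n - 1\<close>; this form avoids truncated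
    subtraction in the exponent.\<close>
  define j where "j = n - 2"
  have j: "n = Suc (Suc j)" using dim by (simp add: j_def n_def)
  define D1 where "D1 r = m * F r powr (m - 1) * F1 r - m * G r powr (m - 1) * G1 r" for r
  define d where "d r = F r powr m - G r powr m" for r
  define p where "p = 1 / m"
  have p: "1 < p" "m * p = 1" using m by (auto simp: p_def)
  have d_deriv: "(d has_real_derivative D1 r) (at r)" for r
    unfolding d_def[abs_def] D1_def using Fode(2)[of r] Gode(2)[of r]
    by (auto intro!: derivative_eq_intros Fode(4) Gode(4))
  have cF: "isCont F r" and cG: "isCont G r" for r
    using Fode(4) Gode(4) DERIV_isCont by blast+
  have cF1: "isCont F1 r" and cG1: "isCont G1 r" for r
    using Fode(5)[of UNIV] Gode(5)[of UNIV] by (auto simp: continuous_on_eq_continuous_at)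
  have cD1: "isCont D1 r" for r
    unfolding D1_def[abs_def] using Fode(2)[of r] Gode(2)[of r]
    by (intro continuous_intros cF cG cF1 cG1) auto
  have D1_deriv: "(D1 has_real_derivative
      (- ((real n - 1) / r * D1 r) - \<alpha> * (F r - G r) - \<beta> * r * (F1 r - G1 r))) (at r)" if "0 < r" for r
    unfolding D1_def[abs_def] n_def
    by (rule DERIV_cong[OF DERIV_diff[OF Fode(7)[OF that] Gode(7)[OF that]]]) (simp add: algebra_simps)
  \<comment> \<open>The term \<open>\<beta> * s * (F s - G s)\<close> absorbs the transport terms of
    the equation, so that the derivative of \<phi> contains \<open>F - G\<close> but neither
    \<open>F1\<close> nor \<open>G1\<close>.\<close>
  define \<phi> where "\<phi> s = s ^ Suc j * (D1 s + \<beta> * s * (F s - G s))" for s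
  define c where "c = \<alpha> - real n * \<beta>"
  have \<phi>_deriv: "(\<phi> has_real_derivative - c * s ^ Suc j * (F s - G s)) (at s)" if s: "0 < s" for s
  proof -
    have "(\<phi> has_real_derivative (real (Suc j) * s ^ j) * (D1 s + \<beta> * s * (F s - G s)) +
       s ^ Suc j * ((- ((real n - 1) / s * D1 s) - \<alpha> * (F s - G s) - \<beta> * s * (F1 s - G1 s))
         + (\<beta> * (F s - G s) + \<beta> * s * (F1 s - G1 s)))) (at s)"
      unfolding \<phi>_def[abs_def]
      by (auto intro!: derivative_eq_intros D1_deriv s Fode(4) Gode(4) simp del: power_Suc)
    thus ?thesis
      by (rule DERIV_cong) (use s in \<open>simp add: j c_def field_simps\<close>)
  qed
  have c\<phi>: "isCont \<phi> s" for s
    unfolding \<phi>_def[abs_def] by (intro continuous_intros cD1 cF cG)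
  have zero: "d R = 0" if "0 \<le> R" for R
  proof -
    have "continuous_on {0..R} (\<lambda>r. F r powr m + G r powr m)"
      by (intro continuous_intros continuous_at_imp_continuous_on ballI cF cG)
         (simp_all add: less_imp_neq[OF Fode(2), THEN not_sym] less_imp_neq[OF Gode(2), THEN not_sym])
    hence "bdd_above ((\<lambda>r. F r powr m + G r powr m) ` {0..R})"
      by (intro bounded_imp_bdd_above compact_imp_bounded compact_continuous_image) auto
    then obtain B where B: "\<And>r. 0 \<le> r \<Longrightarrow> r \<le> R \<Longrightarrow> F r powr m + G r powr m \<le> B"
      unfolding bdd_above_def by (metis atLeastAtMost_iff imageI)
    define K where "K = p * B powr (p - 1)"
    have K0: "0 \<le> K" using p by (simp add: K_def)
    \<comment> \<open>\<open>F\<close> and \<open>G\<close> are recovered from their powers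
      \<open>F powr m\<close> and \<open>G powr m\<close> by the exponent \<open>p > 1\<close>,
      which is Lipschitz on bounded sets of positive numbers.\<close>
    have lip: "\<bar>x powr p - y powr p\<bar> \<le> K * \<bar>x - y\<bar>" if "0 < x" "0 < y" "x \<le> B" "y \<le> B" for x y
    proof -
      have *: "\<bar>x powr p - y powr p\<bar> \<le> K * \<bar>x - y\<bar>" if "0 < y" "y \<le> x" "x \<le> B" for x y
      proof -
        have "p * x powr (p - 1) * (y - x) \<le> y powr p - x powr p"
          using p that by (intro powr_above_tangent) auto
        hence "x powr p - y powr p \<le> p * x powr (p - 1) * (x - y)" by (simp add: algebra_simps)
        also have "\<dots> \<le> K * (x - y)"
          unfolding K_def using p that by (intro mult_right_mono mult_left_mono powr_mono2) auto
        finally show ?thesis using that p by (simp add: powr_mono2)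
      qed
      show ?thesis using *[of y x] *[of x y] that by (cases "y \<le> x") (auto simp: abs_minus_commute)
    qed
    have e: "\<bar>F r - G r\<bar> \<le> K * \<bar>d r\<bar>" if "0 \<le> r" "r \<le> R" for r
    proof -
      have "F r = (F r powr m) powr p" "G r = (G r powr m) powr p"
        using Fode(2)[of r] Gode(2)[of r] by (simp_all add: powr_powr p)
      moreover have "\<bar>(F r powr m) powr p - (G r powr m) powr p\<bar> \<le> K * \<bar>F r powr m - G r powr m\<bar>"
        by (rule lip) (use B[OF that] Fode(2)[of r] Gode(2)[of r] in \<open>auto intro: order_trans[rotated]\<close>)
      ultimately show ?thesis by (simp add: d_def)
    qed
    \<comment> \<open>The product before the summand 1 is the constant in the bound for
      \<open>D1\<close> that the mean value theorem for \<phi> yields; adding 1 makes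
      \<open>L\<close> positive.\<close>
    define L where "L = (\<bar>c\<bar> + \<bar>\<beta>\<bar>) * R * K + 1"
    have L: "0 < L" using K0 \<open>0 \<le> R\<close> by (simp add: L_def add_nonneg_pos)
    have "continuous_on {0..R} (\<lambda>r. \<bar>d r\<bar> * exp (- L * r))"
      by (intro continuous_intros continuous_at_imp_continuous_on ballI DERIV_isCont[OF d_deriv])
    then obtain r0 where r0: "0 \<le> r0" "r0 \<le> R"
      and max: "\<And>r. 0 \<le> r \<Longrightarrow> r \<le> R \<Longrightarrow> \<bar>d r\<bar> * exp (- L * r) \<le> \<bar>d r0\<bar> * exp (- L * r0)"
      using continuous_attains_sup[of "{0..R}" "\<lambda>r. \<bar>d r\<bar> * exp (- L * r)"] \<open>0 \<le> R\<close> by auto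
    define S where "S = \<bar>d r0\<bar> * exp (- L * r0)"
    have S0: "0 \<le> S" by (simp add: S_def)
    have dS: "\<bar>d r\<bar> \<le> S * exp (L * r)" if "0 \<le> r" "r \<le> R" for r
      using max[OF that] by (simp add: S_def exp_minus field_simps)
    have D1S: "\<bar>D1 r\<bar> \<le> L * S * exp (L * r)" if r: "0 < r" "r \<le> R" for r
    proof -
      have eS: "\<bar>F s - G s\<bar> \<le> K * S * exp (L * r)" if "0 \<le> s" "s \<le> r" for s
      proof -
        have "\<bar>F s - G s\<bar> \<le> K * \<bar>d s\<bar>" by (rule e) (use that r in auto)
        also have "\<dots> \<le> K * (S * exp (L * s))"
          using dS[of s] that r K0 by (intro mult_left_mono) auto
        also have "\<dots> \<le> K * (S * exp (L * r))"
          using that K0 S0 L by (intro mult_left_mono) auto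
        finally show ?thesis by (simp add: mult.assoc)
      qed
      have "continuous_on {0..r} \<phi>"
        by (intro continuous_at_imp_continuous_on ballI c\<phi>)
      moreover have "\<phi> differentiable (at x)" if "0 < x" for x
        using \<phi>_deriv[OF that] real_differentiable_def by blast
      ultimately obtain l z where z': "0 < z" "z < r" "(\<phi> has_real_derivative l) (at z)"
          "\<phi> r - \<phi> 0 = (r - 0) * l"
        using MVT[of 0 r \<phi>] r by blast
      moreover have "l = - c * z ^ Suc j * (F z - G z)"
        using DERIV_unique[OF z'(3) \<phi>_deriv[OF z'(1)]] .
      ultimately have z: "0 < z" "z < r" "\<phi> r = r * (- c * z ^ Suc j * (F z - G z))"
        by (auto simp: \<phi>_def)
      have "r ^ Suc j * \<bar>D1 r + \<beta> * r * (F r - G r)\<bar> = \<bar>\<phi> r\<bar>"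
        using r by (simp add: \<phi>_def abs_mult)
      also have "\<dots> = z ^ Suc j * (r * \<bar>c\<bar> * \<bar>F z - G z\<bar>)"
        unfolding z(3) using z r by (simp add: abs_mult power_abs)
      also have "\<dots> \<le> r ^ Suc j * (R * \<bar>c\<bar> * (K * S * exp (L * r)))"
        using z r eS[of z] by (intro mult_mono power_mono) auto
      finally have "\<bar>D1 r + \<beta> * r * (F r - G r)\<bar> \<le> R * \<bar>c\<bar> * (K * S * exp (L * r))"
        using r by (simp add: mult_le_cancel_left del: power_Suc)
      moreover have "\<bar>\<beta> * r * (F r - G r)\<bar> \<le> \<bar>\<beta>\<bar> * R * (K * S * exp (L * r))"
        unfolding abs_mult using r eS[of r] by (intro mult_mono) auto
      ultimately have "\<bar>D1 r\<bar> \<le> R * \<bar>c\<bar> * (K * S * exp (L * r)) + \<bar>\<beta>\<bar> * R * (K * S * exp (L * r))"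
        by linarith
      also have "\<dots> = (L - 1) * S * exp (L * r)" by (simp add: L_def algebra_simps)
      also have "\<dots> \<le> L * S * exp (L * r)" using S0 by (intro mult_right_mono) auto
      finally show ?thesis .
    qed
    have d0: "d 0 = 0" using Fode(3) Gode(3) by (simp add: d_def)
    \<comment> \<open>Integrating the bound for \<open>D1\<close> from 0 loses exactly the term
      \<open>S\<close>. Since \<open>\<bar>d r0\<bar>\<close> equals
      \<open>S * exp (L * r0)\<close>, only \<open>S = 0\<close> is possible.\<close>
    have "\<bar>d r0\<bar> \<le> S * exp (L * r0) - S"
    proof -
      have "S * exp (L * 0) + t * d 0 \<le> S * exp (L * r0) + t * d r0" if t: "\<bar>t\<bar> = 1" for t
      proof (rule DERIV_nonneg_imp_increasing_open[OF r0(1), where f = "\<lambda>r. S * exp (L * r) + t * d r"])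
        fix r assume r: "0 < r" "r < r0"
        have "((\<lambda>r. S * exp (L * r) + t * d r) has_real_derivative (L * S * exp (L * r) + t * D1 r)) (at r)"
          by (auto intro!: derivative_eq_intros d_deriv)
        moreover have "\<bar>t * D1 r\<bar> \<le> L * S * exp (L * r)"
          using D1S[of r] r r0 t by (simp add: abs_mult)
        ultimately show "\<exists>y. ((\<lambda>r. S * exp (L * r) + t * d r) has_real_derivative y) (at r) \<and> 0 \<le> y"
          by (intro exI[of _ "L * S * exp (L * r) + t * D1 r"]) auto
      qed (intro continuous_intros continuous_at_imp_continuous_on ballI DERIV_isCont[OF d_deriv])
      from this[of 1] this[of "-1"] show ?thesis using d0 by auto
    qed
    moreover have "\<bar>d r0\<bar> = S * exp (L * r0)" by (simp add: S_def exp_minus)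
    ultimately have "S = 0" using S0 by simp
    thus "d R = 0" using dS[of R] \<open>0 \<le> R\<close> by simp
  qed
  have "F r = G r" if "0 \<le> r" for r
  proof -
    have "(F r powr m) powr p = (G r powr m) powr p" using zero[OF that] by (simp add: d_def)
    thus ?thesis using Fode(2)[of r] Gode(2)[of r] by (simp add: powr_powr p)
  qed
  thus "f = g" using Fode(1) Gode(1) by (intro ext) simp
qed

text \<open>This balance of the powers of \<open>T - t\<close> is what makes
  \<open>self_similar\<close> solve the equation.\<close>

lemma exponent_identity:
  fixes m \<alpha> \<beta> :: real
  assumes "\<alpha> = (2 * \<beta> + 1) / (1 - m)" "m < 1"
  shows "\<alpha> * m + 2 * \<beta> = \<alpha> - 1"
proof -
  have "\<alpha> * (1 - m) = 2 * \<beta> + 1" using assms by simp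
  thus ?thesis by (simp add: algebra_simps)
qed

lemma is_profile_scale:
  fixes f :: "'a::euclidean_space \<Rightarrow> real"
  assumes f: "is_profile m \<alpha> \<beta> l f" and \<kappa>: "0 < \<kappa>" and l: "0 < l" and m: "0 < m" "m < 1"
  shows "is_profile m \<alpha> \<beta> (\<kappa> * l) (\<lambda>z. \<kappa> powr (2 / (1 - m)) * f (\<kappa> *\<^sub>R z))"
proof -
  define a where "a = \<kappa> powr (2 / (1 - m))"
  have a: "0 < a" using \<kappa> by (simp add: a_def)
  have C2: "C2 f" and pos: "\<And>y. 0 < f y" and rad: "\<And>x y. norm x = norm y \<Longrightarrow> f x = f y"
    and pde: "\<And>y. laplacian (\<lambda>z. f z powr m) y + \<alpha> * f y + \<beta> * (y \<bullet> grad f y) = 0"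
    and f0: "f 0 = l powr (2 / (1 - m))"
    using f unfolding is_profile_def by blast+
  \<comment> \<open>The exponent \<open>2 / (1 - m)\<close> is the one for which the amplitude
    satisfies this identity; it makes the diffusion term scale like the other two.\<close>
  have am: "a powr m * \<kappa>\<^sup>2 = a"
  proof -
    have "a powr m * \<kappa>\<^sup>2 = \<kappa> powr (2 / (1 - m) * m + 2)"
      using \<kappa> by (simp add: a_def powr_powr powr_add powr_realpow)
    also have "2 / (1 - m) * m + 2 = 2 / (1 - m)" using m by (simp add: field_simps)
    finally show ?thesis by (simp add: a_def)
  qed
  have lap: "laplacian (\<lambda>z. (a * f (\<kappa> *\<^sub>R z)) powr m) y = a * laplacian (\<lambda>z. f z powr m) (\<kappa> *\<^sub>R y)" for y
  proof -
    have "(\<lambda>z. (a * f (\<kappa> *\<^sub>R z)) powr m) = (\<lambda>z. a powr m * (\<lambda>z. f z powr m) (\<kappa> *\<^sub>R z))"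
      using a pos by (auto simp: powr_mult less_imp_le)
    hence "laplacian (\<lambda>z. (a * f (\<kappa> *\<^sub>R z)) powr m) y
        = a powr m * \<kappa>\<^sup>2 * laplacian (\<lambda>z. f z powr m) (\<kappa> *\<^sub>R y)"
      using laplacian_scale[OF C2_powr[OF C2 pos], where a = "a powr m" and b = \<kappa> and x = y] by simp
    thus ?thesis using am by simp
  qed
  have gr: "y \<bullet> grad (\<lambda>z. a * f (\<kappa> *\<^sub>R z)) y = a * ((\<kappa> *\<^sub>R y) \<bullet> grad f (\<kappa> *\<^sub>R y))" for y
    by (simp add: grad_def C2_scale(2)[OF C2] inner_sum_right sum_distrib_left mult.assoc mult.left_commute
        del: inner_scaleR_left inner_scaleR_right)
       (simp add: mult.assoc mult.left_commute)
  show ?thesis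
    unfolding is_profile_def a_def[symmetric]
  proof (intro conjI allI impI)
    show "C2 (\<lambda>z. a * f (\<kappa> *\<^sub>R z))" by (rule C2_scale(1)[OF C2])
    show "0 < a * f (\<kappa> *\<^sub>R y)" for y using a pos by simp
    show "a * f (\<kappa> *\<^sub>R x) = a * f (\<kappa> *\<^sub>R y)" if "norm x = norm y" for x y
      using rad[of "\<kappa> *\<^sub>R x" "\<kappa> *\<^sub>R y"] that by simp
    show "laplacian (\<lambda>z. (a * f (\<kappa> *\<^sub>R z)) powr m) y + \<alpha> * (a * f (\<kappa> *\<^sub>R y)) +
         \<beta> * (y \<bullet> grad (\<lambda>z. a * f (\<kappa> *\<^sub>R z)) y) = 0" for y
    proof -
      have "laplacian (\<lambda>z. (a * f (\<kappa> *\<^sub>R z)) powr m) y + \<alpha> * (a * f (\<kappa> *\<^sub>R y)) +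
         \<beta> * (y \<bullet> grad (\<lambda>z. a * f (\<kappa> *\<^sub>R z)) y)
        = a * (laplacian (\<lambda>z. f z powr m) (\<kappa> *\<^sub>R y) + \<alpha> * f (\<kappa> *\<^sub>R y) + \<beta> * ((\<kappa> *\<^sub>R y) \<bullet> grad f (\<kappa> *\<^sub>R y)))"
        unfolding lap gr by (simp only: distrib_left mult.left_commute)
      thus ?thesis using pde[of "\<kappa> *\<^sub>R y"] by simp
    qed
    show "a * f (\<kappa> *\<^sub>R 0) = (\<kappa> * l) powr (2 / (1 - m))"
      using \<kappa> l by (simp add: f0 a_def powr_mult)
  qed
qed

text \<open>The rescaled \<open>f 1\<close> is a profile with the same value at 0 as
  \<open>f l\<close>, and profiles are unique.\<close>

lemma profile_scaling:
  fixes f :: "real \<Rightarrow> 'a::euclidean_space \<Rightarrow> real"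
  assumes "\<And>l. 0 < l \<Longrightarrow> is_profile m \<alpha> \<beta> l (f l)" "0 < l" "2 \<le> DIM('a)" "0 < m" "m < 1"
  shows "f l z = l powr (2 / (1 - m)) * f 1 (l *\<^sub>R z)"
  using profile_unique[OF assms(1)[OF assms(2)] _ assms(3-5)]
    is_profile_scale[OF assms(1)[of 1] assms(2) _ assms(4,5)] by (auto simp: fun_eq_iff)

text \<open>The last claim covers all \<open>t < T\<close>, not only the open interval of
  \<open>C21_on\<close>: the comparison with the initial trace needs continuity across
  \<open>t = 0\<close>.\<close>

lemma self_similar_solution:
  fixes f :: "'a::euclidean_space \<Rightarrow> real"
  assumes f: "is_profile m \<alpha> \<beta> l f" and m: "0 < m" "m < 1" and \<alpha>: "\<alpha> = (2 * \<beta> + 1) / (1 - m)"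
  shows "C21_on T (self_similar \<alpha> \<beta> T f)"
    and "t < T \<Longrightarrow> 0 < self_similar \<alpha> \<beta> T f x t"
    and "t < T \<Longrightarrow> deriv (self_similar \<alpha> \<beta> T f x) t = laplacian (\<lambda>z. self_similar \<alpha> \<beta> T f z t powr m) x"
    and "continuous_on (UNIV \<times> {..<T}) (\<lambda>(x, t). self_similar \<alpha> \<beta> T f x t)"
proof -
  obtain e :: 'a where e: "e \<in> Basis" using nonempty_Basis by blast
  define F where "F = (\<lambda>r. f (r *\<^sub>R e))"
  define F1 where "F1 = (\<lambda>r. partial_deriv e f (r *\<^sub>R e))"
  note ode = profile_radial_ode[OF f e F_def F1_def]
  have C2: "C2 f" and pos: "\<And>y. 0 < f y"
    and pde: "\<And>y. laplacian (\<lambda>z. f z powr m) y + \<alpha> * f y + \<beta> * (y \<bullet> grad f y) = 0"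
    using f unfolding is_profile_def by blast+
  show "0 < self_similar \<alpha> \<beta> T f x t" if "t < T" for x t
    using that pos by (simp add: self_similar_def)
  have cS: "continuous_on (UNIV \<times> {..<T}) (\<lambda>(x, t). g ((T - t) powr \<beta> *\<^sub>R x))"
    if "continuous_on UNIV g" for g :: "'a \<Rightarrow> real"
    unfolding case_prod_unfold
    by (rule continuous_on_compose2[OF that])
       (auto intro!: continuous_on_scaleR continuous_on_powr continuous_on_diff continuous_on_const continuous_on_snd continuous_on_fst continuous_on_id)
  have cP: "continuous_on (UNIV \<times> {..<T}) (\<lambda>(x::'a, t). (T - t) powr c)" for c
    unfolding case_prod_unfold
    by (auto intro!: continuous_on_powr continuous_on_diff continuous_on_const continuous_on_snd continuous_on_id)
  have cM: "continuous_on (UNIV \<times> {..<T}) (\<lambda>(x::'a, t). a x t * b x t)"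
    if "continuous_on (UNIV \<times> {..<T}) (\<lambda>(x, t). a x t)" "continuous_on (UNIV \<times> {..<T}) (\<lambda>(x, t). b x t)"
    for a b :: "'a \<Rightarrow> real \<Rightarrow> real"
    using continuous_on_mult[OF that] by (simp add: case_prod_unfold)
  have cf: "continuous_on UNIV f" using C2 by (simp add: C2_def)
  show cU: "continuous_on (UNIV \<times> {..<T}) (\<lambda>(x, t). self_similar \<alpha> \<beta> T f x t)"
    unfolding self_similar_def by (intro cM cP cS cf)
  have sl: "(\<lambda>z. self_similar \<alpha> \<beta> T f z t) = (\<lambda>z. (T - t) powr \<alpha> * f ((T - t) powr \<beta> *\<^sub>R z))" for t
    by (simp add: self_similar_def)
  note sc = C2_scale[OF C2, where a = "(T - t) powr \<alpha>" and b = "(T - t) powr \<beta>" for t, folded sl]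
  \<comment> \<open>The time derivative is found by differentiating through the radial function
    \<open>F\<close>, which avoids a chain rule in several variables;
    \<open>norm y * F1 (norm y)\<close> is \<open>y \<bullet> grad f y\<close> and visibly
    continuous at the origin.\<close>
  define D where "D x t = - ((T - t) powr (\<alpha> - 1) * (\<alpha> * f ((T - t) powr \<beta> *\<^sub>R x)
     + \<beta> * (norm ((T - t) powr \<beta> *\<^sub>R x) * F1 (norm ((T - t) powr \<beta> *\<^sub>R x)))))" for x t
  have der: "(self_similar \<alpha> \<beta> T f x has_real_derivative D x t) (at t)" if t: "t < T" for x t
  proof -
    have eq: "self_similar \<alpha> \<beta> T f x = (\<lambda>t. (T - t) powr \<alpha> * F ((T - t) powr \<beta> * norm x))"
      by (auto simp: self_similar_def ode(1) fun_eq_iff)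
    have "((\<lambda>t. F ((T - t) powr \<beta> * norm x)) has_real_derivative
        F1 ((T - t) powr \<beta> * norm x) * (\<beta> * (T - t) powr (\<beta> - 1) * (- 1) * norm x)) (at t)"
      by (rule DERIV_chain2[OF ode(4)]) (use t in \<open>auto intro!: derivative_eq_intros\<close>)
    moreover have "((\<lambda>t. (T - t) powr \<alpha>) has_real_derivative \<alpha> * (T - t) powr (\<alpha> - 1) * (- 1)) (at t)"
      using t by (auto intro!: derivative_eq_intros)
    ultimately have "((\<lambda>t. (T - t) powr \<alpha> * F ((T - t) powr \<beta> * norm x)) has_real_derivative
        \<alpha> * (T - t) powr (\<alpha> - 1) * (- 1) * F ((T - t) powr \<beta> * norm x) +
        F1 ((T - t) powr \<beta> * norm x) * (\<beta> * (T - t) powr (\<beta> - 1) * (- 1) * norm x) * (T - t) powr \<alpha>) (at t)"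
      by (rule DERIV_mult[rotated])
    moreover have "(T - t) powr \<beta> * (T - t) powr (\<alpha> - 1) = (T - t) powr \<alpha> * (T - t) powr (\<beta> - 1)"
      by (simp add: algebra_simps flip: powr_add)
    ultimately show ?thesis
      unfolding eq by (elim DERIV_cong) (simp add: D_def ode(1) algebra_simps)
  qed
  have cD: "continuous_on (UNIV \<times> {..<T}) (\<lambda>(x, t). D x t)"
  proof -
    have g: "continuous_on UNIV (\<lambda>y. - (\<alpha> * f y + \<beta> * (norm y * F1 (norm y))))"
      by (intro continuous_intros cf continuous_on_compose2[OF ode(5)[of UNIV]]) auto
    show ?thesis
      using cM[OF cP[of "\<alpha> - 1"] cS[OF g]] by (simp only: D_def minus_mult_right)
  qed
  have sub: "continuous_on (UNIV \<times> {0<..<T}) h" if "continuous_on (UNIV \<times> {..<T}) h" for h :: "'a \<times> real \<Rightarrow> real"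
    using that by (rule continuous_on_subset) auto
  have cong: "continuous_on (UNIV \<times> {0<..<T}) (\<lambda>(x, t). a x t)"
    if "continuous_on (UNIV \<times> {..<T}) (\<lambda>(x, t). b x t)" "\<And>x t. t < T \<Longrightarrow> a x t = b x t"
    for a b :: "'a \<Rightarrow> real \<Rightarrow> real"
    by (rule continuous_on_eq[OF sub[OF that(1)]]) (auto simp: that(2))
  show "C21_on T (self_similar \<alpha> \<beta> T f)"
    unfolding C21_on_def
  proof (intro conjI ballI allI)
    show "continuous_on (UNIV \<times> {0<..<T}) (\<lambda>(x, t). self_similar \<alpha> \<beta> T f x t)" by (rule sub[OF cU])
    show "self_similar \<alpha> \<beta> T f x field_differentiable at t" if "t \<in> {0<..<T}" for x t
      using der[of t x] that by (auto simp: field_differentiable_def)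
    show "continuous_on (UNIV \<times> {0<..<T}) (\<lambda>(x, t). deriv (self_similar \<alpha> \<beta> T f x) t)"
      by (rule cong[OF cD]) (rule DERIV_imp_deriv[OF der])
    show "has_partial i (\<lambda>z. self_similar \<alpha> \<beta> T f z t) x" if "i \<in> Basis" for i x t
      using sc(1)[of t] that by (simp add: C2_def)
    show "continuous_on (UNIV \<times> {0<..<T}) (\<lambda>(x, t). partial_deriv i (\<lambda>z. self_similar \<alpha> \<beta> T f z t) x)"
      if i: "i \<in> Basis" for i
    proof (rule cong)
      show "continuous_on (UNIV \<times> {..<T}) (\<lambda>(x, t). (T - t) powr \<alpha> * (T - t) powr \<beta> * partial_deriv i f ((T - t) powr \<beta> *\<^sub>R x))"
        by (intro cM cP cS C2D(2)[OF C2 i])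
    qed (rule sc(2)[OF i])
    show "has_partial j (partial_deriv i (\<lambda>z. self_similar \<alpha> \<beta> T f z t)) x"
      if "i \<in> Basis" "j \<in> Basis" for i j x t
      using sc(1)[of t] that by (simp add: C2_def)
    show "continuous_on (UNIV \<times> {0<..<T}) (\<lambda>(x, t). partial_deriv j (partial_deriv i (\<lambda>z. self_similar \<alpha> \<beta> T f z t)) x)"
      if i: "i \<in> Basis" "j \<in> Basis" for i j
    proof (rule cong)
      show "continuous_on (UNIV \<times> {..<T}) (\<lambda>(x, t). (T - t) powr \<alpha> * ((T - t) powr \<beta> * (T - t) powr \<beta>) * partial_deriv j (partial_deriv i f) ((T - t) powr \<beta> *\<^sub>R x))"
        by (intro cM cP cS C2D(4)[OF C2 i])
    qed (simp add: sc(3)[OF i] power2_eq_square)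
  qed
  show "deriv (self_similar \<alpha> \<beta> T f x) t = laplacian (\<lambda>z. self_similar \<alpha> \<beta> T f z t powr m) x" if t: "t < T" for x t
  proof -
    define a where "a = (T - t) powr \<alpha>"
    define b where "b = (T - t) powr \<beta>"
    have a: "0 < a" using t by (simp add: a_def)
    have "(\<lambda>z. self_similar \<alpha> \<beta> T f z t powr m) = (\<lambda>z. a powr m * (\<lambda>z. f z powr m) (b *\<^sub>R z))"
      using a pos by (auto simp: self_similar_def a_def b_def powr_mult less_imp_le)
    hence "laplacian (\<lambda>z. self_similar \<alpha> \<beta> T f z t powr m) x
        = a powr m * b\<^sup>2 * laplacian (\<lambda>z. f z powr m) (b *\<^sub>R x)"
      using laplacian_scale[OF C2_powr[OF C2 pos], where a = "a powr m" and b = b and x = x] by simp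
    also have "a powr m * b\<^sup>2 = (T - t) powr (\<alpha> * m + 2 * \<beta>)"
      using t by (simp add: a_def b_def powr_powr powr_add power2_eq_square algebra_simps flip: powr_add)
    also have "\<alpha> * m + 2 * \<beta> = \<alpha> - 1" by (rule exponent_identity[OF \<alpha> m(2)])
    also have "laplacian (\<lambda>z. f z powr m) (b *\<^sub>R x) = - (\<alpha> * f (b *\<^sub>R x) + \<beta> * ((b *\<^sub>R x) \<bullet> grad f (b *\<^sub>R x)))"
      using pde[of "b *\<^sub>R x"] by linarith
    finally have "laplacian (\<lambda>z. self_similar \<alpha> \<beta> T f z t powr m) x = D x t"
      unfolding ode(6) by (simp only: D_def b_def minus_mult_right)
    thus ?thesis using DERIV_imp_deriv[OF der[OF t]] by simp
  qed
qed

section \<open>Unimodality of the scaled profile\<close>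

text \<open>\<open>overdamped\<close> compares the damping \<open>2 * N * \<beta> + N - k\<close> at
  the equilibrium with \<open>2 * sqrt (2 * N)\<close>: it says that the characteristic roots there
  are real and distinct. \<open>c\<close> is the coefficient left when the transport term is written
  as a divergence.\<close>

locale parameter_range =
  fixes n :: nat and m \<alpha> \<beta> N k c :: real
  assumes n: "3 \<le> n" and m: "0 < m" "m < 1" and \<alpha>: "\<alpha> = (2 * \<beta> + 1) / (1 - m)"
    and N_def: "N = real n - 2 / (1 - m)" and k_def: "k = 2 * m / (1 - m)"
    and c_def: "c = \<alpha> - real n * \<beta>"
    and N: "0 < N" "N < 2" and c: "0 < c" and \<beta>: "0 < \<beta>"
    and overdamped: "2 * sqrt (2 * N) < 2 * N * \<beta> + N - k"

text \<open>All bounds for \<beta> have the denominator \<open>n - 2 - n * m = N * (1 - m)\<close>.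
  After clearing it, \<open>\<beta> < beta_1 n m\<close> becomes \<open>0 < c\<close> and
  \<open>beta_2 n m < \<beta>\<close> becomes \<open>overdamped\<close>, while \<open>N < 2\<close>
  is equivalent to \<open>(n - 2) * (1 - m) < 2\<close>, which for \<open>n \<le> 4\<close> needs
  only \<open>0 < m\<close>.\<close>

lemma parameter_range_intro:
  fixes n :: nat
  assumes range:
      "(3 \<le> n \<and> n \<le> 4 \<and> 0 < m \<and> m < (real n - 2) / real n
          \<and> beta_0 n m < \<beta> \<and> \<beta> < beta_1 n m)
       \<or> (4 < n \<and> (real n - 4) / (real n - 2) < m \<and> m < (real n - 2) / real n
          \<and> beta_0 n m < \<beta> \<and> \<beta> < beta_1 n m)"
    and \<alpha>: "\<alpha> = (2 * \<beta> + 1) / (1 - m)"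
  shows "parameter_range n m \<alpha> \<beta> (real n - 2 / (1 - m)) (2 * m / (1 - m)) (\<alpha> - real n * \<beta>)"
proof
  define D where "D = real n - 2 - real n * m"
  define N where "N = real n - 2 / (1 - m)"
  define k where "k = 2 * m / (1 - m)"
  show n: "3 \<le> n" using range by auto
  have mn: "m < (real n - 2) / real n" and b0: "beta_0 n m < \<beta>" and b1: "\<beta> < beta_1 n m"
    using range by auto
  show m0: "0 < m"
  proof (cases "n \<le> 4")
    case False
    hence "0 < (real n - 4) / (real n - 2)" by simp
    thus ?thesis using range False by linarith
  qed (use range in auto)
  have D: "0 < D" using mn n by (simp add: D_def field_simps)
  have "real n * m < real n * 1" using D unfolding D_def by linarith
  thus m1: "m < 1" using n by simp
  have ND: "D = N * (1 - m)" using m1 by (simp add: D_def N_def field_simps)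
  show "0 < real n - 2 / (1 - m)" using D ND m1 by (simp add: N_def[symmetric] zero_less_mult_iff)
  hence N0: "0 < N" by (simp add: N_def)
  have "(real n - 2) * (1 - m) < 2"
  proof (cases "n \<le> 4")
    case True
    have "(real n - 2) * (1 - m) \<le> 2 * (1 - m)" using True m1 by (intro mult_right_mono) auto
    thus ?thesis using m0 by simp
  next
    case False
    hence "real n - 4 < m * (real n - 2)" using range by (simp add: field_simps)
    thus ?thesis by (simp add: algebra_simps)
  qed
  hence "N * (1 - m) < 2 * (1 - m)" unfolding ND[symmetric] D_def by (simp add: algebra_simps)
  hence "N < 2" by (rule mult_right_less_imp_less) (use m1 in simp)
  thus "real n - 2 / (1 - m) < 2" by (simp add: N_def)
  have "0 < beta_e n m" using D m0 by (simp add: beta_e_def D_def)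
  thus "0 < \<beta>" using b0 by (simp add: beta_0_def)
  have "\<alpha> - real n * \<beta> = (1 - \<beta> * D) / (1 - m)"
    using m1 by (simp add: \<alpha> D_def field_simps)
  moreover have "\<beta> < 1 / D" using b1 by (simp only: beta_1_def D_def)
  hence "\<beta> * D < 1" using D by (simp add: pos_less_divide_eq)
  ultimately show "0 < \<alpha> - real n * \<beta>" using m1 by simp
  have "beta_2 n m < \<beta>" using b0 by (simp add: beta_0_def)
  hence "2 * N * beta_2 n m < 2 * N * \<beta>" using N0 by simp
  moreover have "2 * N * beta_2 n m = 2 * sqrt (2 * N) + (k - N)"
  proof -
    have "1 - m \<noteq> 0" using m1 by simp
    hence "2 * (1 - m) / D = 2 / N" unfolding ND by (rule nonzero_mult_divide_mult_cancel_right)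
    hence "N * sqrt (2 * (1 - m) / D) = sqrt (N\<^sup>2) * sqrt (2 / N)" using N0 by simp
    also have "\<dots> = sqrt (N\<^sup>2 * (2 / N))" by (rule real_sqrt_mult[symmetric])
    also have "N\<^sup>2 * (2 / N) = 2 * N" using N0 by (simp add: power2_eq_square)
    finally have "N * sqrt (2 * (1 - m) / D) = sqrt (2 * N)" .
    moreover have "2 * N * (((real n + 2) * m - (real n - 2)) / (2 * D)) = k - N"
    proof -
      have "2 * N * (((real n + 2) * m - (real n - 2)) / (2 * D)) = (2 * m - D) / (1 - m)"
        using N0 m1 by (simp add: ND) (simp add: D_def[symmetric] ND[symmetric], simp add: D_def algebra_simps)
      also have "\<dots> = k - N" using m1 by (simp add: ND k_def diff_divide_distrib)
      finally show ?thesis .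
    qed
    moreover have "beta_2 n m = sqrt (2 * (1 - m) / D) + ((real n + 2) * m - (real n - 2)) / (2 * D)"
      by (simp add: beta_2_def D_def)
    ultimately show ?thesis by (simp add: distrib_left mult.assoc)
  qed
  ultimately show "2 * sqrt (2 * (real n - 2 / (1 - m))) <
     2 * (real n - 2 / (1 - m)) * \<beta> + (real n - 2 / (1 - m)) - 2 * m / (1 - m)"
    unfolding N_def[symmetric] k_def[symmetric] by linarith
qed (use \<alpha> in simp_all)

context parameter_range begin

lemma parameter_identities:
  "0 < k" "real n = N + k + 2" "1 / (1 - m) = (k + 2) / 2" "2 / (1 - m) = k + 2" "c + \<beta> * N = (k + 2) / 2"
  "k / m = k + 2" "k * (1 / m - 1) = 2"
proof -
  show "0 < k" using m by (simp add: k_def)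
  show i2: "2 / (1 - m) = k + 2" using m by (simp add: k_def field_simps)
  thus i1: "1 / (1 - m) = (k + 2) / 2" by (simp add: field_simps)
  show "real n = N + k + 2" using i2 by (simp add: N_def)
  have "\<alpha> = (2 * \<beta> + 1) * ((k + 2) / 2)" unfolding \<alpha> i1[symmetric] by simp
  thus "c + \<beta> * N = (k + 2) / 2" using i2 by (simp add: c_def N_def algebra_simps)
  show "k / m = k + 2" "k * (1 / m - 1) = 2" using m by (simp_all add: k_def field_simps)
qed

text \<open>In terms of \<open>P = (x / V) powr (p - 1)\<close> the tangent inequality bounds the
  force by a multiple of \<open>x - V\<close>, so the claim reduces to a coefficient that is affine
  in \<open>P \<ge> 1\<close>. At \<open>P = 1\<close> it equals
  \<open>\<gamma> * (2 * N * \<beta> + N - k - 2 * \<gamma>)\<close>, positive by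
  \<open>overdamped\<close>; its slope is nonnegative by \<open>overdamped\<close> and
  \<open>N < 2\<close>. The rate \<open>\<gamma> = sqrt (2 * N)\<close> is the geometric mean of the
  two decay rates at the equilibrium.\<close>

lemma barrier_inequality:
  fixes V x :: real
  defines "\<gamma> \<equiv> sqrt (2 * N)" and "p \<equiv> 1 / m"
  assumes V: "0 < V" "V powr (p - 1) = 2 * m * N" and x: "V \<le> x"
  shows "0 \<le> k * N * x - (c + \<beta> * N) * x powr p + \<gamma> * (x - V) * (\<beta> * p * x powr (p - 1) + N - k - \<gamma>)"
proof -
  note id = parameter_identities
  have p: "1 < p" "m * p = 1" using m by (auto simp: p_def)
  have \<gamma>: "0 < \<gamma>" "\<gamma> * \<gamma> = 2 * N" using N by (auto simp: \<gamma>_def)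
  have "sqrt (2 * N) < sqrt 4" using N by (intro real_sqrt_less_mono) simp
  hence \<gamma>2: "\<gamma> < 2" by (simp add: \<gamma>_def)
  have od: "2 * \<gamma> < 2 * N * \<beta> + N - k" using overdamped by (simp add: \<gamma>_def)
  have x0: "0 < x" using V x by simp
  define P where "P = x powr (p - 1) / (2 * m * N)"
  have xP: "x powr (p - 1) = 2 * m * N * P" using m N by (simp add: P_def)
  have "V powr (p - 1) \<le> x powr (p - 1)" using V x p by (intro powr_mono2) auto
  hence P: "1 \<le> P" using V(2) m N by (simp add: P_def)
  have pw: "y powr p = y * y powr (p - 1)" if "0 < y" for y
    using that by (simp add: powr_mult_base)
  have "p * x powr (p - 1) * (V - x) \<le> V powr p - x powr p"
    using p x0 V by (intro powr_above_tangent) auto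
  hence "2 * m * N * (x * P - V) \<le> 2 * m * N * (p * P * (x - V))"
    unfolding pw[OF V(1)] pw[OF x0] V(2) xP by (simp add: algebra_simps)
  hence "x * P - V \<le> p * P * (x - V)" using m N by (simp add: mult_le_cancel_left)
  hence tangent: "x * (P - 1) \<le> (x - V) * (p * P - 1)" by (simp add: algebra_simps)
  have coef: "0 \<le> - k * N * (p * P - 1) + \<gamma> * (2 * N * \<beta> * P + N - k - \<gamma>)"
  proof -
    have kp: "k * p = k + 2" using id(6) by (simp add: p_def)
    have "\<gamma> * \<gamma> < \<gamma> * (2 * N * \<beta> + N - k - \<gamma>)" using od \<gamma> by (intro mult_strict_left_mono) auto
    hence at1: "0 < - k * N * (p - 1) + \<gamma> * (2 * N * \<beta> + N - k - \<gamma>)"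
      using \<gamma>(2) kp by (simp add: algebra_simps)
    \<comment> \<open>Doubling \<open>overdamped\<close> and dividing by \<gamma> gives the lower
      bound \<open>4 + 2 * k / \<gamma> - \<gamma>\<close> for
      \<open>2 * (\<gamma> * \<beta>)\<close>, and \<open>\<gamma> < 2\<close> makes this at least
      \<open>k + 2\<close>.\<close>
    have slope: "k + 2 \<le> 2 * (\<gamma> * \<beta>)"
    proof -
      have "\<gamma> * (\<gamma> * \<beta>) = 2 * N * \<beta>" unfolding \<gamma>(2)[symmetric] by (simp only: mult.assoc)
      hence "2 * \<gamma> + k - N < \<gamma> * (\<gamma> * \<beta>)" using od by linarith
      moreover have "\<gamma> * (4 + 2 * k / \<gamma> - \<gamma>) = 4 * \<gamma> + 2 * k - 2 * N"
        using \<gamma> by (simp add: right_diff_distrib distrib_left)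
      moreover have "\<gamma> * (2 * (\<gamma> * \<beta>)) = 2 * (\<gamma> * (\<gamma> * \<beta>))" by simp
      ultimately have "\<gamma> * (4 + 2 * k / \<gamma> - \<gamma>) < \<gamma> * (2 * (\<gamma> * \<beta>))" by linarith
      hence "4 + 2 * k / \<gamma> - \<gamma> < 2 * (\<gamma> * \<beta>)" using \<gamma>(1) by (simp add: mult_less_cancel_left_pos)
      moreover have "k \<le> 2 * k / \<gamma>" using \<gamma>(1) \<gamma>2 id(1) by (simp add: le_divide_eq)
      ultimately show ?thesis using \<gamma>2 by linarith
    qed
    have "0 \<le> N * (2 * (\<gamma> * \<beta>) - (k + 2)) * (P - 1)" using N slope P by (intro mult_nonneg_nonneg) auto
    moreover have "- k * N * (p * P - 1) + \<gamma> * (2 * N * \<beta> * P + N - k - \<gamma>)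
      = (- k * N * (p - 1) + \<gamma> * (2 * N * \<beta> + N - k - \<gamma>)) + N * (2 * (\<gamma> * \<beta>) - k * p) * (P - 1)"
      by (simp add: algebra_simps)
    ultimately show ?thesis using at1 kp by simp
  qed
  have "- (k * N * ((x - V) * (p * P - 1))) \<le> - (k * N * (x * (P - 1)))"
    using tangent id(1) N by simp
  moreover have E1: "k * N * x - (c + \<beta> * N) * x powr p = - (k * N * (x * (P - 1)))"
  proof -
    have "(c + \<beta> * N) * x powr p = (k + 2) * m * (N * x * P)"
      unfolding pw[OF x0] xP id(5) by simp
    also have "(k + 2) * m = k" using id(6) m by (simp add: field_simps)
    finally show ?thesis by (simp add: algebra_simps)
  qed
  moreover have E2: "\<beta> * p * x powr (p - 1) = 2 * N * \<beta> * P"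
    unfolding xP using m by (simp add: p_def)
  moreover have "0 \<le> (x - V) * (- k * N * (p * P - 1) + \<gamma> * (2 * N * \<beta> * P + N - k - \<gamma>))"
    using x coef by (intro mult_nonneg_nonneg) auto
  moreover have "(x - V) * (- k * N * (p * P - 1) + \<gamma> * (2 * N * \<beta> * P + N - k - \<gamma>))
      = - (k * N * ((x - V) * (p * P - 1))) + \<gamma> * (x - V) * (2 * N * \<beta> * P + N - k - \<gamma>)"
    by (simp add: algebra_simps)
  ultimately show ?thesis unfolding E1 E2 by linarith
qed

text \<open>After the substitution \<open>s = ln r\<close> the function \<omega> is
  \<open>v powr p\<close> with a solution \<open>v\<close> of the abstract phase plane, so its
  monotonicity is that of \<open>v\<close>.\<close>

lemma profile_unimodal:
  fixes f :: "'a::euclidean_space \<Rightarrow> real"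
  assumes f: "is_profile m \<alpha> \<beta> l f" and dim: "DIM('a) = n" and e: "e \<in> Basis"
  defines "\<omega> \<equiv> \<lambda>r. r powr (2 / (1 - m)) * f (r *\<^sub>R e)"
  shows "\<exists>r0>0. (\<forall>r s. 0 < r \<longrightarrow> r < s \<longrightarrow> s \<le> r0 \<longrightarrow> \<omega> r < \<omega> s) \<and>
    (\<forall>r s. r0 \<le> r \<longrightarrow> r < s \<longrightarrow> \<omega> s < \<omega> r)"
proof -
  note id = parameter_identities
  define F where "F = (\<lambda>r. f (r *\<^sub>R e))"
  define F1 where "F1 = (\<lambda>r. partial_deriv e f (r *\<^sub>R e))"
  note ode = profile_radial_ode[OF f e F_def F1_def]
  define G1 where "G1 r = m * F r powr (m - 1) * F1 r" for r
  define p where "p = 1 / m"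
  have p: "1 < p" "m * p = 1" "k * p = k + 2" using m id(6) by (auto simp: p_def)
  \<comment> \<open>The constant solution of the equation for \<open>v\<close>, which belongs to the
    singular profile.\<close>
  define V where "V = (2 * m * N) powr (m / (1 - m))"
  define \<gamma> where "\<gamma> = sqrt (2 * N)"
  have V: "0 < V" using m N by (simp add: V_def)
  have Vp: "V powr (p - 1) = 2 * m * N"
  proof -
    have "m / (1 - m) * (p - 1) = 1" using m by (simp add: p_def field_simps)
    hence "V powr (p - 1) = (2 * m * N) powr 1" by (simp only: V_def powr_powr)
    thus ?thesis using m N by simp
  qed
  have VVp: "V powr p = V * (2 * m * N)" using V Vp by (metis add.commute diff_add_cancel less_imp_le powr_mult_base)
  define v where "v s = exp (k * s) * F (exp s) powr m" for s
  define H where "H s = exp ((k + 1) * s) * (G1 (exp s) + \<beta> * exp s * F (exp s))" for s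
  have vp: "v s powr p = exp ((k + 2) * s) * F (exp s)" for s
  proof -
    have "v s powr p = exp (k * s) powr p * (F (exp s) powr m) powr p"
      unfolding v_def by (rule powr_mult)
    also have "exp (k * s) powr p = exp (k * p * s)" by (simp add: powr_def)
    also have "(F (exp s) powr m) powr p = F (exp s)" using ode(2)[of "exp s"] p by (simp add: powr_powr)
    finally show ?thesis by (simp add: p)
  qed
  have GF: "((\<lambda>r. F r powr m) has_real_derivative G1 r) (at r)" for r
    unfolding G1_def using ode(2)[of r] by (auto intro!: derivative_eq_intros ode(4))
  have cG1: "isCont G1 r" and cF: "isCont F r" for r
  proof -
    show cF: "isCont F r" using ode(4) DERIV_isCont by blast
    have "isCont F1 r" using ode(5)[of UNIV] by (simp add: continuous_on_eq_continuous_at)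
    thus "isCont G1 r" unfolding G1_def[abs_def] using ode(2)[of r]
      by (intro continuous_intros cF) auto
  qed
  have ev: "exp (k * s) * exp s = exp ((k + 1) * s)" "exp ((k + 1) * s) * exp s = exp ((k + 2) * s)" for s
    by (simp_all add: algebra_simps flip: exp_add)
  have v_deriv: "(v has_real_derivative H s + k * v s - \<beta> * v s powr p) (at s)" for s
  proof -
    have "((\<lambda>s. F (exp s) powr m) has_real_derivative G1 (exp s) * exp s) (at s)"
      by (rule DERIV_chain2[OF GF DERIV_exp])
    hence "(v has_real_derivative (exp (k * s) * k) * F (exp s) powr m + (G1 (exp s) * exp s) * exp (k * s)) (at s)"
      unfolding v_def[abs_def] by (intro DERIV_mult) (auto intro!: derivative_eq_intros)
    moreover have "(exp (k * s) * k) * F (exp s) powr m + (G1 (exp s) * exp s) * exp (k * s)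
        = k * v s + exp ((k + 1) * s) * G1 (exp s)"
      unfolding ev(1)[symmetric] by (simp add: v_def)
    moreover have "H s - \<beta> * v s powr p = exp ((k + 1) * s) * G1 (exp s)"
      unfolding vp H_def ev(2)[symmetric] by (simp add: algebra_simps)
    ultimately show ?thesis by (simp add: algebra_simps)
  qed
  have H_deriv: "(H has_real_derivative - N * H s - c * v s powr p) (at s)" for s
  proof -
    define r where "r = exp s"
    have r: "0 < r" by (simp add: r_def)
    have G1': "(G1 has_real_derivative - ((real n - 1) / r * G1 r) - \<alpha> * F r - \<beta> * r * F1 r) (at r)"
      using ode(7)[OF r] unfolding dim G1_def[abs_def] .
    have "((\<lambda>r. G1 r + \<beta> * r * F r) has_real_derivative
        (- ((real n - 1) / r * G1 r) - \<alpha> * F r - \<beta> * r * F1 r) + (\<beta> * F r + F1 r * (\<beta> * r))) (at r)"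
      by (intro DERIV_add G1' DERIV_mult ode(4)) (auto intro!: derivative_eq_intros)
    from DERIV_chain2[OF this[unfolded r_def] DERIV_exp]
    have "((\<lambda>s. G1 (exp s) + \<beta> * exp s * F (exp s)) has_real_derivative
        (- ((real n - 1) / r * G1 r) - \<alpha> * F r + \<beta> * F r) * r) (at s)"
      by (simp add: r_def algebra_simps)
    hence "(H has_real_derivative (exp ((k + 1) * s) * (k + 1)) * (G1 (exp s) + \<beta> * exp s * F (exp s)) +
        ((- ((real n - 1) / r * G1 r) - \<alpha> * F r + \<beta> * F r) * r) * exp ((k + 1) * s)) (at s)"
      unfolding H_def[abs_def] by (intro DERIV_mult) (auto intro!: derivative_eq_intros)
    moreover have "(- ((real n - 1) / r * G1 r) - \<alpha> * F r + \<beta> * F r) * r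
        = - (real n - 1) * (G1 r + \<beta> * r * F r) - c * (r * F r)"
      using r by (simp add: c_def field_simps)
    moreover have "(exp ((k + 1) * s) * (k + 1)) * (G1 (exp s) + \<beta> * exp s * F (exp s)) +
        (- (real n - 1) * (G1 r + \<beta> * r * F r) - c * (r * F r)) * exp ((k + 1) * s) = - N * H s - c * v s powr p"
      unfolding id(2) vp H_def ev(2)[symmetric] r_def by (simp add: algebra_simps)
    ultimately show ?thesis by simp
  qed
  have exp0: "((\<lambda>s. exp (a * s)) \<longlongrightarrow> 0) at_bot" if "0 < a" for a :: real
    by (rule filterlim_compose[OF exp_at_bot])
       (use that in \<open>simp add: filterlim_tendsto_pos_mult_at_bot[OF tendsto_const] filterlim_ident\<close>)
  have compose: "((\<lambda>s. h (exp s)) \<longlongrightarrow> h 0) at_bot" if "isCont h 0" for h :: "real \<Rightarrow> real"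
    by (rule isCont_tendsto_compose[OF that exp_at_bot])
  interpret emden_fowler_orbit v H k N c \<beta> p V \<gamma>
  proof
    show "1 < p" "0 < k" "0 < N" "0 < c" "0 < \<beta>" "0 < V" "0 < \<gamma>"
      using p id(1) N c \<beta> V by (auto simp: \<gamma>_def)
    show "(v has_real_derivative H s + k * v s - \<beta> * v s powr p) (at s)" for s by (rule v_deriv)
    show "(H has_real_derivative - N * H s - c * v s powr p) (at s)" for s by (rule H_deriv)
    show "0 < v s" for s using ode(2)[of "exp s"] by (simp add: v_def)
    show "k * N * V = (c + \<beta> * N) * V powr p"
    proof -
      have km: "(k + 2) * m = k" using id(6) m by (simp add: field_simps)
      have "(c + \<beta> * N) * V powr p = ((k + 2) * m) * N * V" unfolding VVp id(5) by simp
      thus ?thesis unfolding km by simp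
    qed
    show "((\<lambda>s. exp (N * s) * H s) \<longlongrightarrow> 0) at_bot"
    proof -
      have "isCont (\<lambda>r. G1 r + \<beta> * r * F r) 0" by (intro continuous_intros cG1 cF)
      from compose[OF this] have
        "((\<lambda>s. exp ((N + (k + 1)) * s) * (G1 (exp s) + \<beta> * exp s * F (exp s))) \<longlongrightarrow> 0 * (G1 0 + \<beta> * 0 * F 0)) at_bot"
        by (intro tendsto_mult exp0) (use N id(1) in simp_all)
      moreover have "exp ((N + (k + 1)) * s) = exp (N * s) * exp ((k + 1) * s)" for s
        by (simp add: distrib_right flip: exp_add)
      ultimately show ?thesis by (simp add: H_def mult.assoc)
    qed
    show "\<forall>\<^sub>F s in at_bot. 0 < H s + k * v s - \<beta> * v s powr p"
    proof -
      \<comment> \<open>Up to the factor \<open>exp (k * s)\<close> the derivative of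
        \<open>v\<close> is this function at \<open>r = exp s\<close>, and at \<open>r = 0\<close>
        it has the positive value \<open>k * F 0 powr m\<close>.\<close>
      have "isCont (\<lambda>r. k * F r powr m + r * G1 r) 0"
        using ode(2)[of 0] by (intro continuous_intros cG1 cF) auto
      from compose[OF this] have "((\<lambda>s. k * F (exp s) powr m + exp s * G1 (exp s)) \<longlongrightarrow> k * F 0 powr m) at_bot"
        by simp
      hence "\<forall>\<^sub>F s in at_bot. 0 < k * F (exp s) powr m + exp s * G1 (exp s)"
        by (rule order_tendstoD) (use ode(2)[of 0] id(1) in simp)
      thus ?thesis
      proof eventually_elim
        case (elim s)
        have "H s + k * v s - \<beta> * v s powr p = exp (k * s) * (k * F (exp s) powr m + exp s * G1 (exp s))"
          unfolding vp unfolding H_def v_def ev(2)[symmetric] ev(1)[symmetric] by (simp add: algebra_simps)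
        thus ?case using elim by simp
      qed
    qed
    show "N + k < \<beta> * p * V powr (p - 1)"
    proof -
      have "\<beta> * p * V powr (p - 1) = 2 * N * \<beta>" unfolding Vp using p(2) m by (simp add: p_def)
      moreover have "N \<le> sqrt (2 * N)"
      proof -
        have "sqrt (N * N) \<le> sqrt (2 * N)" using N by (intro real_sqrt_le_mono mult_right_mono) auto
        thus ?thesis using N by simp
      qed
      ultimately show ?thesis using overdamped by linarith
    qed
    show "0 \<le> k * N * x - (c + \<beta> * N) * x powr p + \<gamma> * (x - V) * (\<beta> * p * x powr (p - 1) + N - k - \<gamma>)"
      if "V \<le> x" for x
      using barrier_inequality[of V x] V Vp that by (simp add: \<gamma>_def p_def)
  qed
  obtain s0 where s0: "\<And>s. s < s0 \<Longrightarrow> 0 < dv s" "\<And>s. s0 < s \<Longrightarrow> dv s < 0"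
    using unimodal by blast
  have cv: "continuous_on S v" for S
    by (intro continuous_at_imp_continuous_on ballI isCont_v)
  have inc: "v s < v t" if "s < t" "t \<le> s0" for s t
    by (rule DERIV_pos_imp_increasing_open[OF that(1) _ cv]) (use v_has_deriv s0(1) that in force)
  have dec: "v t < v s" if "s < t" "s0 \<le> s" for s t
    by (rule DERIV_neg_imp_decreasing_open[OF that(1) _ cv]) (use v_has_deriv s0(2) that in force)
  have \<omega>: "\<omega> r = v (ln r) powr p" if "0 < r" for r
    using that unfolding vp by (simp add: \<omega>_def F_def powr_def id(4))
  have mono: "v s powr p < v t powr p" if "v s < v t" for s t
    using that v_pos[of s] p(1) by (intro powr_less_mono2) auto
  show ?thesis
  proof (intro exI[of _ "exp s0"] conjI allI impI)
    fix r s :: real assume rs: "0 < r" "r < s" "s \<le> exp s0"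
    hence "0 < s" by linarith
    have "ln s \<le> ln (exp s0)" using \<open>0 < s\<close> rs(3) by (subst ln_le_cancel_iff) auto
    hence "ln s \<le> s0" by simp
    moreover have "ln r < ln s" using rs \<open>0 < s\<close> by simp
    ultimately have "0 < s" "ln r < ln s" "ln s \<le> s0" using \<open>0 < s\<close> by auto
    thus "\<omega> r < \<omega> s" using \<omega> rs(1) mono[OF inc] by simp
  next
    fix r s :: real assume rs: "exp s0 \<le> r" "r < s"
    hence r: "0 < r" using exp_gt_zero[of s0] by linarith
    moreover have "ln (exp s0) \<le> ln r" using r rs(1) by (subst ln_le_cancel_iff) auto
    ultimately have "0 < s" "ln r < ln s" "s0 \<le> ln r" using rs by auto
    thus "\<omega> s < \<omega> r" using \<omega> r mono[OF dec] by simp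
  qed simp
qed

end

section \<open>Comparison on moving balls\<close>

lemma C21_slice:
  fixes u :: "'a::euclidean_space \<Rightarrow> real \<Rightarrow> real"
  assumes "C21_on T u" "0 < t" "t < T"
  shows "C2 (\<lambda>z. u z t)"
proof -
  have slice: "continuous_on UNIV (\<lambda>z. g z t)" if "continuous_on (UNIV \<times> {0<..<T}) (\<lambda>(x, t). g x t)"
    for g :: "'a \<Rightarrow> real \<Rightarrow> real"
  proof -
    have "range (\<lambda>z::'a. (z, t)) \<subseteq> UNIV \<times> {0<..<T}" using assms(2,3) by auto
    from continuous_on_compose2[OF that continuous_on_Pair[OF continuous_on_id continuous_on_const[of UNIV t]] this]
    show ?thesis by simp
  qed
  show ?thesis
    unfolding C2_def
    using assms unfolding C21_on_def by (intro conjI ballI allI slice) auto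
qed

lemma C2_powr_continuous:
  assumes C2: "C2 f" and pos: "\<And>x. 0 < f x" and i: "i \<in> Basis"
  shows "continuous_on S (\<lambda>z. f z powr m)"
    and "continuous_on S (partial_deriv i (\<lambda>z. f z powr m))"
    and "continuous_on S (partial_deriv i (partial_deriv i (\<lambda>z. f z powr m)))"
proof -
  have d1: "has_pd i f x (partial_deriv i f x)"
    and d2: "has_pd i (partial_deriv i f) x (partial_deriv i (partial_deriv i f) x)"
    if "i \<in> Basis" for i x
    using C2D(1,3)[OF C2 that] that by blast+
  note lp = laplacian_powr[OF pos d1 d2 i]
  have cf: "continuous_on S f" using C2 continuous_on_subset[OF _ subset_UNIV] by (auto simp: C2_def)
  have c0: "continuous_on S (\<lambda>z. f z powr a)" for a
    using pos by (intro continuous_intros cf) (auto simp: less_imp_neq[THEN not_sym])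
  note c1 = C2D(2)[OF C2 i, of S] and c2 = C2D(4)[OF C2 i i, of S]
  have e1: "partial_deriv i (\<lambda>z. f z powr m) = (\<lambda>x. m * f x powr (m - 1) * partial_deriv i f x)"
    using partial_deriv_eqI[OF lp(1)] by (simp add: fun_eq_iff)
  have e2: "partial_deriv i (partial_deriv i (\<lambda>z. f z powr m)) =
     (\<lambda>x. m * (m - 1) * f x powr (m - 2) * (partial_deriv i f x)\<^sup>2
        + m * f x powr (m - 1) * partial_deriv i (partial_deriv i f) x)"
    unfolding e1 using partial_deriv_eqI[OF lp(2)] by (simp add: fun_eq_iff)
  show "continuous_on S (\<lambda>z. f z powr m)" by (rule c0)
  show "continuous_on S (partial_deriv i (\<lambda>z. f z powr m))"
    unfolding e1 by (intro continuous_intros c0 c1)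
  show "continuous_on S (partial_deriv i (partial_deriv i (\<lambda>z. f z powr m)))"
    unfolding e2 by (intro continuous_intros c0 c1 c2)
qed

lemma second_derivative_local_max:
  fixes h h' :: "real \<Rightarrow> real"
  assumes h: "\<And>s. (h has_real_derivative h' s) (at s)" and h2: "(h' has_real_derivative d) (at 0)"
    and max: "0 < \<epsilon>" "\<And>s. \<bar>s\<bar> < \<epsilon> \<Longrightarrow> h s \<le> h 0"
  shows "d \<le> 0"
proof (rule ccontr)
  assume "\<not> d \<le> 0"
  have h0: "h' 0 = 0"
    by (rule DERIV_local_max[OF h max(1)]) (use max in auto)
  obtain \<eta> where \<eta>: "0 < \<eta>" "\<And>s. 0 < s \<Longrightarrow> s < \<eta> \<Longrightarrow> h' 0 < h' (0 + s)"
    using DERIV_pos_inc_right[OF h2] \<open>\<not> d \<le> 0\<close> by auto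
  define s where "s = min \<eta> \<epsilon> / 2"
  have s: "0 < s" "s < \<eta>" "s < \<epsilon>" using \<eta>(1) max(1) by (auto simp: s_def min_def)
  have "h 0 < h s"
  proof (rule DERIV_pos_imp_increasing_open[OF s(1)])
    show "\<exists>y. (h has_real_derivative y) (at x) \<and> 0 < y" if "0 < x" "x < s" for x
      using h[of x] \<eta>(2)[of x] that s h0 by auto
  qed (intro continuous_at_imp_continuous_on ballI DERIV_isCont[OF h])
  with max(2)[of s] s show False by simp
qed

text \<open>The part of \<open>cauchy_solution\<close> without the initial trace; \<open>u\<close>
  and the self-similar solutions share it, so that both can enter the comparison results.\<close>

definition fde_solution :: "real \<Rightarrow> real \<Rightarrow> ('a::euclidean_space \<Rightarrow> real \<Rightarrow> real) \<Rightarrow> bool" where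
  "fde_solution m T u \<longleftrightarrow> C21_on T u \<and> (\<forall>x. \<forall>t\<in>{0<..<T}. 0 < u x t) \<and>
     (\<forall>x. \<forall>t\<in>{0<..<T}. deriv (u x) t = laplacian (\<lambda>z. u z t powr m) x)"

lemma fde_solutionD:
  assumes "fde_solution m T u" "0 < t" "t < T"
  shows "0 < u x t" "deriv (u x) t = laplacian (\<lambda>z. u z t powr m) x"
    "(u x has_real_derivative deriv (u x) t) (at t)" "C2 (\<lambda>z. u z t)"
proof -
  have "u x field_differentiable (at t)"
    using assms by (auto simp: fde_solution_def C21_on_def)
  thus "(u x has_real_derivative deriv (u x) t) (at t)"
    by (simp add: DERIV_deriv_iff_field_differentiable)
qed (use assms C21_slice[of T u t] in \<open>auto simp: fde_solution_def\<close>)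

lemma fde_solution_continuous:
  assumes "fde_solution m T u" "S \<subseteq> UNIV \<times> {0<..<T}"
  shows "continuous_on S (\<lambda>(x, t). u x t)" "continuous_on S (\<lambda>(x, t). deriv (u x) t)"
  using assms continuous_on_subset[OF _ assms(2)] unfolding fde_solution_def C21_on_def by blast+

lemma fde_solution_mono:
  assumes "fde_solution m T u" "T' \<le> T"
  shows "fde_solution m T' u"
proof -
  have sub: "UNIV \<times> {0<..<T'} \<subseteq> UNIV \<times> {0<..<T}" using assms by auto
  have "C21_on T' u"
    unfolding C21_on_def using assms continuous_on_subset[OF _ sub]
    by (auto simp: fde_solution_def C21_on_def)
  thus ?thesis using assms by (auto simp: fde_solution_def)
qed

text \<open>A maximum principle for \<open>u\<close> against \<open>\<mu> t * V\<close> with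
  \<open>\<mu> t = 1 + \<delta> * exp (2 * K * (t - t1))\<close>. The perturbation is multiplicative
  because the diffusion is homogeneous: at a first contact the Laplacian of \<open>u powr m\<close>
  is at most \<open>\<mu> powr m\<close> times that of \<open>V powr m\<close>, and with
  \<open>K\<close> bounding the quotient of the time derivative of \<open>V\<close> and
  \<open>V\<close> itself, the growth rate \<open>2 * K\<close> gives a contradiction. The radius
  depends on time because fixed balls in similarity variables move in \<open>x\<close>.\<close>

lemma moving_ball_comparison:
  fixes u V :: "'a::euclidean_space \<Rightarrow> real \<Rightarrow> real"
  assumes u: "fde_solution m T u" and V: "fde_solution m T V" and m: "0 < m" "m < 1"
    and t12: "0 < t1" "t2 < T" and \<rho>: "continuous_on {t1..t2} \<rho>"
    and init: "\<And>x. norm x \<le> \<rho> t1 \<Longrightarrow> u x t1 \<le> V x t1"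
    and lateral: "\<And>x t. t1 \<le> t \<Longrightarrow> t \<le> t2 \<Longrightarrow> norm x = \<rho> t \<Longrightarrow> u x t \<le> V x t"
    and t: "t1 \<le> t" "t \<le> t2" and x: "norm x \<le> \<rho> t"
  shows "u x t \<le> V x t"
proof -
  define Q where "Q = {(x::'a, t). t1 \<le> t \<and> t \<le> t2 \<and> norm x \<le> \<rho> t}"
  have Qsub: "Q \<subseteq> UNIV \<times> {0<..<T}" using t12 by (auto simp: Q_def)
  have "compact Q"
  proof -
    have "bdd_above (\<rho> ` {t1..t2})"
      by (intro bounded_imp_bdd_above compact_imp_bounded compact_continuous_image \<rho>) auto
    then obtain R where R: "\<And>t. t1 \<le> t \<Longrightarrow> t \<le> t2 \<Longrightarrow> \<rho> t \<le> R"
      unfolding bdd_above_def by (metis atLeastAtMost_iff imageI)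
    define B where "B = cball (0::'a) R \<times> {t1..t2}"
    have "compact B" by (auto simp: B_def intro: compact_Times)
    have "continuous_on B (\<lambda>z. \<rho> (snd z) - norm (fst z))"
      by (intro continuous_intros continuous_on_compose2[OF \<rho>]) (auto simp: B_def)
    hence "closed (B \<inter> (\<lambda>z. \<rho> (snd z) - norm (fst z)) -` {0..})"
      by (rule continuous_closed_preimage) (use \<open>compact B\<close> compact_imp_closed in auto)
    moreover have "Q = B \<inter> (\<lambda>z. \<rho> (snd z) - norm (fst z)) -` {0..}"
    proof -
      have "z \<in> B" if "z \<in> Q" for z
        using that R[of "snd z"] by (auto simp: Q_def B_def)
      thus ?thesis by (auto simp: Q_def B_def)
    qed
    ultimately show ?thesis
      using \<open>compact B\<close> by (metis Int_lower1 bounded_subset compact_eq_bounded_closed)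
  qed
  note cu = fde_solution_continuous[OF u Qsub] and cV = fde_solution_continuous[OF V Qsub]
  have Vpos: "0 < V x t" and upos: "0 < u x t" if "(x, t) \<in> Q" for x t
    using that Qsub fde_solutionD(1)[OF V] fde_solutionD(1)[OF u] by auto
  have "continuous_on Q (\<lambda>z. \<bar>deriv (V (fst z)) (snd z)\<bar> / V (fst z) (snd z))"
    using cV Vpos by (intro continuous_intros) (auto simp: case_prod_unfold less_imp_neq[THEN not_sym])
  hence "bdd_above ((\<lambda>z. \<bar>deriv (V (fst z)) (snd z)\<bar> / V (fst z) (snd z)) ` Q)"
    using \<open>compact Q\<close> by (intro bounded_imp_bdd_above compact_imp_bounded compact_continuous_image)
  then obtain K0 where K0: "\<And>x t. (x, t) \<in> Q \<Longrightarrow> \<bar>deriv (V x) t\<bar> / V x t \<le> K0"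
    unfolding bdd_above_def by (metis (no_types, lifting) fst_conv image_eqI snd_conv)
  define K where "K = max K0 1"
  have K: "0 < K" "\<bar>deriv (V x) t\<bar> \<le> K * V x t" if "(x, t) \<in> Q" for x t
    using K0[OF that] Vpos[OF that] by (auto simp: K_def field_simps max_def intro: order_trans)
  have less: "u x t < (1 + \<delta> * exp (2 * K * (t - t1))) * V x t" if \<delta>: "0 < \<delta>" and xt: "(x, t) \<in> Q" for \<delta> x t
  proof (rule ccontr)
    assume contr: "\<not> ?thesis"
    have K_pos: "0 < K" using K(1)[OF xt] .
    define \<mu> where "\<mu> t = 1 + \<delta> * exp (2 * K * (t - t1))" for t
    have \<mu>: "1 < \<mu> t" for t using \<delta> by (simp add: \<mu>_def)
    have \<mu>_deriv: "(\<mu> has_real_derivative 2 * K * (\<mu> t - 1)) (at t)" for t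
      unfolding \<mu>_def[abs_def] by (auto intro!: derivative_eq_intros)
    define w where "w z = u (fst z) (snd z) - \<mu> (snd z) * V (fst z) (snd z)" for z
    have cw: "continuous_on Q w"
      unfolding w_def \<mu>_def using cu cV by (intro continuous_intros) (auto simp: case_prod_unfold)
    define S where "S = Q \<inter> w -` {0..}"
    have "compact S"
      using continuous_closed_preimage[OF cw compact_imp_closed[OF \<open>compact Q\<close>], of "{0..}"] \<open>compact Q\<close>
      unfolding S_def by (metis Int_lower1 bounded_subset compact_eq_bounded_closed closed_atLeast)
    moreover have "S \<noteq> {}" using contr xt by (auto simp: S_def w_def \<mu>_def not_less intro!: exI[of _ x] exI[of _ t])
    \<comment> \<open>The first contact: a point of the compact set \<open>S\<close> with the
      smallest time.\<close>
    ultimately obtain z where z: "z \<in> S" "\<And>y. y \<in> S \<Longrightarrow> snd z \<le> snd y"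
      using continuous_attains_inf[OF _ _ continuous_on_snd[OF continuous_on_id], of S] by blast
    obtain x0 t0 where z0: "z = (x0, t0)" by (cases z)
    have Q0: "(x0, t0) \<in> Q" and w0: "0 \<le> w (x0, t0)" using z(1) by (auto simp: S_def z0)
    have before: "w (y, s) < 0" if "(y, s) \<in> Q" "s < t0" for y s
      using z(2)[of "(y, s)"] that by (force simp: S_def z0)
    have t00: "0 < t0" "t0 < T" and Q0': "t1 \<le> t0" "t0 \<le> t2" "norm x0 \<le> \<rho> t0"
      using Q0 t12 by (auto simp: Q_def)
    have strict: "V y s < \<mu> s * V y s" if "(y, s) \<in> Q" for y s
      using Vpos[OF that] \<mu>[of s] by simp
    have "t1 \<noteq> t0" using init[of x0] strict[OF Q0] w0 Q0' by (auto simp: w_def)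
    hence t10: "t1 < t0" using Q0' by simp
    have "norm x0 \<noteq> \<rho> t0" using lateral[of t0 x0] strict[OF Q0] w0 Q0' by (auto simp: w_def)
    hence x0: "norm x0 < \<rho> t0" using Q0' by simp
    \<comment> \<open>By continuity of \<rho>, a point inside the ball at time \<open>t0\<close> was
      inside shortly before, where \<open>w\<close> is negative. Hence \<open>w \<le> 0\<close> on
      the open ball at \<open>t0\<close>, and \<open>x0\<close> is an interior spatial
      maximum.\<close>
    have nonpos: "w (y, t0) \<le> 0 \<and> (\<forall>\<^sub>F s in at_left t0. w (y, s) < 0)" if y: "norm y < \<rho> t0" for y
    proof -
      have "(\<rho> \<longlongrightarrow> \<rho> t0) (at t0 within {t1..t2})"
        using \<rho> Q0' by (auto simp: continuous_on_def)
      hence "(\<rho> \<longlongrightarrow> \<rho> t0) (at t0 within {t1..t0})"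
        by (rule tendsto_within_subset) (use Q0' in auto)
      hence "(\<rho> \<longlongrightarrow> \<rho> t0) (at_left t0)"
        using t10 by (simp add: at_within_Icc_at_left)
      hence "\<forall>\<^sub>F s in at_left t0. norm y < \<rho> s" using y by (rule order_tendstoD)
      moreover have "\<forall>\<^sub>F s in at_left t0. s \<in> {t1<..<t0}"
        by (rule eventually_at_left_real[OF t10])
      ultimately have inQ: "\<forall>\<^sub>F s in at_left t0. (y, s) \<in> Q \<and> s < t0"
        by eventually_elim (use Q0' in \<open>auto simp: Q_def\<close>)
      hence ev: "\<forall>\<^sub>F s in at_left t0. w (y, s) < 0"
        by (rule eventually_mono) (use before in auto)
      have "isCont (\<lambda>s. u y s - \<mu> s * V y s) t0"
        by (intro continuous_intros DERIV_isCont[OF fde_solutionD(3)[OF u t00]]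
            DERIV_isCont[OF fde_solutionD(3)[OF V t00]] DERIV_isCont[OF \<mu>_deriv])
      hence "continuous (at_left t0) (\<lambda>s. u y s - \<mu> s * V y s)"
        by (rule continuous_at_imp_continuous_at_within)
      hence "((\<lambda>s. u y s - \<mu> s * V y s) \<longlongrightarrow> u y t0 - \<mu> t0 * V y t0) (at_left t0)"
        by (simp add: continuous_within)
      hence "((\<lambda>s. w (y, s)) \<longlongrightarrow> w (y, t0)) (at_left t0)" by (simp add: w_def)
      hence "w (y, t0) \<le> 0"
        by (rule tendsto_upperbound) (use ev in \<open>auto elim: eventually_mono\<close>)
      thus ?thesis using ev by simp
    qed
    have w00: "w (x0, t0) = 0" using nonpos[OF x0] w0 by simp
    define d where "d = deriv (u x0) t0 - (2 * K * (\<mu> t0 - 1) * V x0 t0 + deriv (V x0) t0 * \<mu> t0)"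
    have "((\<lambda>s. w (x0, s)) has_real_derivative d) (at t0)"
      unfolding w_def d_def fst_conv snd_conv
      by (intro DERIV_diff DERIV_mult fde_solutionD(3)[OF u t00] fde_solutionD(3)[OF V t00] \<mu>_deriv)
    have "0 \<le> d"
    proof (rule ccontr)
      assume "\<not> 0 \<le> d"
      then obtain \<eta> where \<eta>: "0 < \<eta>" "\<And>h. 0 < h \<Longrightarrow> h < \<eta> \<Longrightarrow> w (x0, t0) < w (x0, t0 - h)"
        using DERIV_neg_dec_left[OF \<open>((\<lambda>s. w (x0, s)) has_real_derivative d) (at t0)\<close>] by auto
      have "\<forall>\<^sub>F s in at_left t0. s \<in> {t0 - \<eta><..<t0}"
        by (rule eventually_at_left_real) (use \<eta> in auto)
      hence "\<forall>\<^sub>F s in at_left t0. False"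
        using nonpos[OF x0, THEN conjunct2]
      proof eventually_elim
        case (elim s)
        thus False using \<eta>(2)[of "t0 - s"] w00 by auto
      qed
      thus False by (simp add: trivial_limit_at_left_real)
    qed
    define A where "A = (\<lambda>z. u z t0 powr m)"
    define B where "B = (\<lambda>z. V z t0 powr m)"
    define M where "M = \<mu> t0 powr m"
    have Au: "has_partial i A y" "has_partial i (partial_deriv i A) y"
      and BV: "has_partial i B y" "has_partial i (partial_deriv i B) y" if "i \<in> Basis" for i y
      unfolding A_def B_def using that fde_solutionD(1)[OF u t00] fde_solutionD(1)[OF V t00]
      by (auto intro!: C2_powr fde_solutionD(4)[OF u t00] fde_solutionD(4)[OF V t00])
    have le: "partial_deriv i (partial_deriv i A) x0 - M * partial_deriv i (partial_deriv i B) x0 \<le> 0"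
      if i: "i \<in> Basis" for i
    proof (rule second_derivative_local_max)
      show "((\<lambda>s. A (x0 + s *\<^sub>R i) - M * B (x0 + s *\<^sub>R i)) has_real_derivative
          partial_deriv i A (x0 + s *\<^sub>R i) - M * partial_deriv i B (x0 + s *\<^sub>R i)) (at s)" for s
        using has_pd_line[of i A x0 s, THEN iffD1, OF has_pd_partial_deriv[OF Au(1)[OF i]]]
          has_pd_line[of i B x0 s, THEN iffD1, OF has_pd_partial_deriv[OF BV(1)[OF i]]]
        by (intro DERIV_diff DERIV_cmult)
      show "((\<lambda>s. partial_deriv i A (x0 + s *\<^sub>R i) - M * partial_deriv i B (x0 + s *\<^sub>R i)) has_real_derivative
          partial_deriv i (partial_deriv i A) x0 - M * partial_deriv i (partial_deriv i B) x0) (at 0)"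
        using has_pd_partial_deriv[OF Au(2)[OF i], of x0] has_pd_partial_deriv[OF BV(2)[OF i], of x0]
        unfolding has_pd_def by (intro DERIV_diff DERIV_cmult)
      show "0 < \<rho> t0 - norm x0" using x0 by simp
      show "A (x0 + s *\<^sub>R i) - M * B (x0 + s *\<^sub>R i) \<le> A (x0 + 0 *\<^sub>R i) - M * B (x0 + 0 *\<^sub>R i)"
        if s: "\<bar>s\<bar> < \<rho> t0 - norm x0" for s
      proof -
        have "norm (x0 + s *\<^sub>R i) < \<rho> t0"
          using norm_triangle_ineq[of x0 "s *\<^sub>R i"] s i by simp
        hence "u (x0 + s *\<^sub>R i) t0 \<le> \<mu> t0 * V (x0 + s *\<^sub>R i) t0"
          using nonpos by (force simp: w_def)
        hence "A (x0 + s *\<^sub>R i) \<le> (\<mu> t0 * V (x0 + s *\<^sub>R i) t0) powr m"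
          unfolding A_def using m fde_solutionD(1)[OF u t00] by (intro powr_mono2) (auto simp: less_imp_le)
        also have "\<dots> = M * B (x0 + s *\<^sub>R i)"
          unfolding M_def B_def using \<mu>[of t0] fde_solutionD(1)[OF V t00] by (simp add: powr_mult less_imp_le)
        finally have "A (x0 + s *\<^sub>R i) - M * B (x0 + s *\<^sub>R i) \<le> 0" by simp
        moreover have "A x0 = M * B x0"
          unfolding A_def M_def B_def using w00 \<mu>[of t0] fde_solutionD(1)[OF V t00]
          by (simp add: w_def powr_mult less_imp_le)
        ultimately show ?thesis by simp
      qed
    qed
    have "laplacian A x0 - M * laplacian B x0 \<le> 0"
      unfolding laplacian_def sum_distrib_left sum_subtractf[symmetric] by (rule sum_nonpos) (rule le)
    hence ut: "deriv (u x0) t0 \<le> M * deriv (V x0) t0"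
      using fde_solutionD(2)[OF u t00] fde_solutionD(2)[OF V t00] by (simp add: A_def B_def)
    \<comment> \<open>Here \<open>m < 1\<close> enters: the spatial factor \<open>M\<close> lies
      between 1 and \<open>\<mu> t0\<close>, so it differs from \<open>\<mu> t0\<close> by at most
      \<open>\<mu> t0 - 1\<close>, and the rate \<open>2 * K\<close> outweighs this.\<close>
    have M: "1 \<le> M" "M \<le> \<mu> t0"
      unfolding M_def using \<mu>[of t0] m powr_mono[of m 1 "\<mu> t0"] by (auto simp: ge_one_powr_ge_zero)
    have "2 * K * (\<mu> t0 - 1) * V x0 t0 \<le> (M - \<mu> t0) * deriv (V x0) t0"
      using \<open>0 \<le> d\<close> ut by (simp add: d_def algebra_simps)
    also have "\<dots> \<le> \<bar>M - \<mu> t0\<bar> * \<bar>deriv (V x0) t0\<bar>"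
      by (metis abs_ge_self abs_mult)
    also have "\<dots> \<le> (\<mu> t0 - 1) * (K * V x0 t0)"
      using M K(2)[OF Q0] by (intro mult_mono) auto
    finally have "2 * (K * (\<mu> t0 - 1) * V x0 t0) \<le> K * (\<mu> t0 - 1) * V x0 t0"
      by (simp add: algebra_simps)
    moreover have "0 < K * (\<mu> t0 - 1) * V x0 t0"
      using K_pos \<mu>[of t0] Vpos[OF Q0] by simp
    ultimately show False by linarith
  qed
  have xt: "(x, t) \<in> Q" using t x by (simp add: Q_def)
  show ?thesis
  proof (rule field_le_epsilon)
    fix e :: real assume e: "0 < e"
    define E where "E = exp (2 * K * (t - t1)) * V x t"
    have E: "0 < E" using Vpos[OF xt] by (simp add: E_def)
    have "u x t < (1 + e / E * exp (2 * K * (t - t1))) * V x t"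
      using less[OF _ xt, of "e / E"] e E by simp
    also have "\<dots> = V x t + e / E * E" by (simp add: E_def algebra_simps)
    finally show "u x t \<le> V x t + e" using E by simp
  qed
qed

section \<open>Kato's inequality\<close>

lemma integrable_continuous_compact_support:
  fixes g :: "'a::euclidean_space \<Rightarrow> real"
  assumes "continuous_on UNIV g" "\<And>x. R < norm x \<Longrightarrow> g x = 0"
  shows "integrable lborel g"
proof -
  have "integrable lborel (\<lambda>x. indicator (cball 0 R) x *\<^sub>R g x)"
    by (rule borel_integrable_compact) (auto intro: continuous_on_subset[OF assms(1)])
  also have "(\<lambda>x. indicator (cball 0 R) x *\<^sub>R g x) = g"
    using assms(2) by (auto simp: fun_eq_iff indicator_def not_le)
  finally show ?thesis .
qed

text \<open>Difference quotients have integral 0 by translation invariance of the measure; they are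
  dominated through the mean value theorem and converge to \<open>g'\<close>. This is the only
  integration by parts that Kato's inequality needs.\<close>

lemma integral_pd_eq_0:
  fixes g :: "'a::euclidean_space \<Rightarrow> real"
  assumes g: "\<And>x. has_pd e g x (g' x)" and e: "e \<in> Basis"
    and cont: "continuous_on UNIV g" "continuous_on UNIV g'"
    and supp: "\<And>x. R < norm x \<Longrightarrow> g x = 0" "\<And>x. R < norm x \<Longrightarrow> g' x = 0"
  shows "integral\<^sup>L lborel g' = 0"
proof -
  have ne: "norm e = 1" using e by simp
  define h where "h n = 1 / real (Suc n)" for n
  have h: "0 < h n" "h n \<le> 1" for n by (auto simp: h_def)
  have h0: "filterlim h (at 0) sequentially"
    unfolding filterlim_at h_def[abs_def]
    using LIMSEQ_inverse_real_of_nat by (auto simp: inverse_eq_divide)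
  define q where "q n x = (g (x + h n *\<^sub>R e) - g x) / h n" for n x
  have intg: "integrable lborel g"
    by (rule integrable_continuous_compact_support[OF cont(1) supp(1)])
  have shift: "integrable lborel (\<lambda>x. g (x + c))" "integral\<^sup>L lborel (\<lambda>x. g (x + c)) = integral\<^sup>L lborel g" for c
  proof -
    have gm: "g \<in> borel_measurable borel" using cont(1) by (rule borel_measurable_continuous_onI)
    have d: "distr lborel borel ((+) c) = (lborel :: 'a measure)" by (rule lborel_distr_plus)
    show "integrable lborel (\<lambda>x. g (x + c))"
      using integrable_distr_eq[of "(+) c" lborel borel g] gm intg d by (simp add: add.commute)
    show "integral\<^sup>L lborel (\<lambda>x. g (x + c)) = integral\<^sup>L lborel g"
      using integral_distr[of "(+) c" lborel borel g] gm d by (simp add: add.commute)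
  qed
  have q0: "integral\<^sup>L lborel (q n) = 0" for n
    unfolding q_def[abs_def] using shift[of "h n *\<^sub>R e"] intg by simp
  obtain B where B: "\<And>x. \<bar>g' x\<bar> \<le> B" "0 \<le> B"
  proof -
    have "bdd_above ((\<lambda>x. \<bar>g' x\<bar>) ` cball 0 R)"
      by (intro bounded_imp_bdd_above compact_imp_bounded compact_continuous_image continuous_intros
          continuous_on_subset[OF cont(2)]) auto
    then obtain B where B: "\<And>x. norm x \<le> R \<Longrightarrow> \<bar>g' x\<bar> \<le> B"
      unfolding bdd_above_def by (metis image_eqI mem_cball_0)
    have "\<bar>g' x\<bar> \<le> max 0 B" for x
      using B[of x] supp(2)[of x] by (cases "norm x \<le> R") auto
    thus ?thesis using that[of "max 0 B"] by simp
  qed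
  \<comment> \<open>The step sizes are at most 1, so all quotients vanish outside the ball of radius
    \<open>R + 1\<close>.\<close>
  have qb: "norm (q n x) \<le> B * indicator (cball 0 (R + 1)) x" for n x
  proof (cases "norm x \<le> R + 1")
    case True
    have "\<exists>l z. 0 < z \<and> z < h n \<and> ((\<lambda>s. g (x + s *\<^sub>R e)) has_real_derivative l) (at z) \<and>
        g (x + h n *\<^sub>R e) - g (x + 0 *\<^sub>R e) = (h n - 0) * l"
    proof (rule MVT[OF h(1)])
      have "((\<lambda>s. g (x + s *\<^sub>R e)) has_real_derivative g' (x + s *\<^sub>R e)) (at s)" for s
        using has_pd_line g by blast
      thus "continuous_on {0..h n} (\<lambda>s. g (x + s *\<^sub>R e))"
        "(\<lambda>s. g (x + s *\<^sub>R e)) differentiable at s" for s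
        by (auto intro!: continuous_at_imp_continuous_on DERIV_isCont simp: real_differentiable_def)
    qed
    then obtain l z where z: "((\<lambda>s. g (x + s *\<^sub>R e)) has_real_derivative l) (at z)"
      "g (x + h n *\<^sub>R e) - g x = h n * l" by auto
    have "l = g' (x + z *\<^sub>R e)"
      using DERIV_unique[OF z(1)] has_pd_line g by blast
    hence "norm (q n x) \<le> B" using z(2) B(1) h(1)[of n] by (simp add: q_def)
    thus ?thesis using True by simp
  next
    case False
    have "norm x \<le> norm (x + h n *\<^sub>R e) + norm (h n *\<^sub>R e)"
      by (metis add_diff_cancel norm_triangle_ineq4)
    hence "R < norm (x + h n *\<^sub>R e)" using False h[of n] ne by simp
    thus ?thesis using False supp(1) by (simp add: q_def)
  qed
  have "(\<lambda>n. integral\<^sup>L lborel (q n)) \<longlonglongrightarrow> integral\<^sup>L lborel g'"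
  proof (rule integral_dominated_convergence[where w = "\<lambda>x. B * indicator (cball 0 (R + 1)) x"])
    show "g' \<in> borel_measurable lborel"
      using borel_measurable_continuous_onI[OF cont(2)] by simp
    show "q n \<in> borel_measurable lborel" for n
    proof -
      have "continuous_on UNIV (q n)"
        unfolding q_def using h(1)[of n]
        by (intro continuous_intros cont continuous_on_compose2[OF cont(1)]) auto
      thus ?thesis using borel_measurable_continuous_onI by simp
    qed
    show "integrable lborel (\<lambda>x::'a. B * indicator (cball 0 (R + 1)) x :: real)"
      using emeasure_bounded_finite[OF bounded_cball, of "0::'a" "R + 1"]
      by (intro integrable_mult_right integrable_real_indicator) auto
    show "AE x in lborel. norm (q n x) \<le> B * indicator (cball 0 (R + 1)) x" for n
      using qb by simp
    show "AE x in lborel. (\<lambda>n. q n x) \<longlonglongrightarrow> g' x"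
    proof (rule AE_I2)
      fix x
      have "((\<lambda>s. (g (x + s *\<^sub>R e) - g x) / s) \<longlongrightarrow> g' x) (at 0)"
        using g[of x] by (simp add: has_pd_def has_field_derivative_iff)
      from filterlim_compose[OF this h0] show "(\<lambda>n. q n x) \<longlonglongrightarrow> g' x"
        by (simp add: q_def)
    qed
  qed
  thus ?thesis by (simp add: q0 LIMSEQ_const_iff)
qed

text \<open>The field with components \<open>\<eta> p * \<Psi> * p1 i - X p * \<Psi>1 i\<close> has
  compact support, so its divergence has integral 0. Since \<eta> is the derivative of
  \<open>X\<close>, the mixed terms cancel, and the term
  \<open>\<eta>' p * (p1 i)^2 * \<Psi>\<close> has a sign by convexity of \<open>X\<close>.\<close>

lemma kato_inequality:
  fixes p \<Psi> :: "'a::euclidean_space \<Rightarrow> real" and p1 p2 \<Psi>1 \<Psi>2 :: "'a \<Rightarrow> 'a \<Rightarrow> real"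
  assumes p: "\<And>i x. i \<in> Basis \<Longrightarrow> has_pd i p x (p1 i x)" "\<And>i x. i \<in> Basis \<Longrightarrow> has_pd i (p1 i) x (p2 i x)"
    and pc: "continuous_on UNIV p" "\<And>i. i \<in> Basis \<Longrightarrow> continuous_on UNIV (p1 i)"
      "\<And>i. i \<in> Basis \<Longrightarrow> continuous_on UNIV (p2 i)"
    and \<Psi>: "\<And>i x. i \<in> Basis \<Longrightarrow> has_pd i \<Psi> x (\<Psi>1 i x)" "\<And>i x. i \<in> Basis \<Longrightarrow> has_pd i (\<Psi>1 i) x (\<Psi>2 i x)"
    and \<Psi>c: "continuous_on UNIV \<Psi>" "\<And>i. i \<in> Basis \<Longrightarrow> continuous_on UNIV (\<Psi>1 i)"
      "\<And>i. i \<in> Basis \<Longrightarrow> continuous_on UNIV (\<Psi>2 i)"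
    and \<Psi>0: "\<And>x. 0 \<le> \<Psi> x" "\<And>x. R < norm x \<Longrightarrow> \<Psi> x = 0"
      "\<And>i x. i \<in> Basis \<Longrightarrow> R < norm x \<Longrightarrow> \<Psi>1 i x = 0" "\<And>i x. i \<in> Basis \<Longrightarrow> R < norm x \<Longrightarrow> \<Psi>2 i x = 0"
    and X: "\<And>s. (X has_real_derivative \<eta> s) (at s)" "\<And>s. (\<eta> has_real_derivative \<eta>' s) (at s)"
      "continuous_on UNIV \<eta>'" "\<And>s. 0 \<le> \<eta>' s"
  shows "integral\<^sup>L lborel (\<lambda>x. \<eta> (p x) * \<Psi> x * (\<Sum>i\<in>Basis. p2 i x))
    \<le> integral\<^sup>L lborel (\<lambda>x. X (p x) * (\<Sum>i\<in>Basis. \<Psi>2 i x))"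
proof -
  define G where "G i x = p1 i x * (\<eta> (p x) * \<Psi> x) - X (p x) * \<Psi>1 i x" for i x
  define G' where "G' i x = (\<eta> (p x) * \<Psi> x) * p2 i x + \<eta>' (p x) * (p1 i x)\<^sup>2 * \<Psi> x - X (p x) * \<Psi>2 i x" for i x
  have cc: "continuous_on UNIV (\<lambda>x. f (p x))" if "continuous_on UNIV f" for f :: "real \<Rightarrow> real"
    using continuous_on_compose2[OF that pc(1)] by simp
  have cX: "continuous_on UNIV (\<lambda>x. X (p x))" "continuous_on UNIV (\<lambda>x. \<eta> (p x))" "continuous_on UNIV (\<lambda>x. \<eta>' (p x))"
    by (intro cc X(3) continuous_at_imp_continuous_on ballI DERIV_isCont[OF X(1)] DERIV_isCont[OF X(2)])+
  have i: "integral\<^sup>L lborel (G' i) = 0 \<and> integrable lborel (G' i)" if i: "i \<in> Basis" for i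
  proof
    have G: "has_pd i (G i) x (G' i x)" for x
    proof -
      have "has_pd i (G i) x (p2 i x * (\<eta> (p x) * \<Psi> x) +
          ((\<eta>' (p x) * p1 i x) * \<Psi> x + \<Psi>1 i x * \<eta> (p x)) * p1 i x -
          ((\<eta> (p x) * p1 i x) * \<Psi>1 i x + \<Psi>2 i x * X (p x)))"
        unfolding G_def[abs_def]
        by (intro has_pd_diff has_pd_mult p \<Psi> i has_pd_chain[OF X(1)] has_pd_chain[OF X(2)])
      thus ?thesis by (simp add: G'_def power2_eq_square algebra_simps)
    qed
    have c: "continuous_on UNIV (G i)" "continuous_on UNIV (G' i)"
      unfolding G_def[abs_def] G'_def[abs_def] by (intro continuous_intros cX pc \<Psi>c i)+
    have s: "G i x = 0" "G' i x = 0" if "R < norm x" for x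
      using \<Psi>0(2)[OF that] \<Psi>0(3)[OF i that] \<Psi>0(4)[OF i that] by (simp_all add: G_def G'_def)
    show "integral\<^sup>L lborel (G' i) = 0" by (rule integral_pd_eq_0[OF G i c s])
    show "integrable lborel (G' i)" by (rule integrable_continuous_compact_support[OF c(2) s(2)])
  qed
  have int1: "integrable lborel (\<lambda>x. \<eta> (p x) * \<Psi> x * (\<Sum>i\<in>Basis. p2 i x))"
    by (rule integrable_continuous_compact_support[of _ R]) (use \<Psi>0 in \<open>auto intro!: continuous_intros cX pc \<Psi>c\<close>)
  have int2: "integrable lborel (\<lambda>x. X (p x) * (\<Sum>i\<in>Basis. \<Psi>2 i x))"
    by (rule integrable_continuous_compact_support[of _ R]) (use \<Psi>0 in \<open>auto intro!: continuous_intros cX pc \<Psi>c\<close>)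
  have "0 = (\<Sum>i\<in>Basis. integral\<^sup>L lborel (G' i))" using i by simp
  also have "\<dots> = integral\<^sup>L lborel (\<lambda>x. \<Sum>i\<in>Basis. G' i x)"
    using i by (subst Bochner_Integration.integral_sum) auto
  also have "\<dots> \<ge> integral\<^sup>L lborel (\<lambda>x. \<eta> (p x) * \<Psi> x * (\<Sum>i\<in>Basis. p2 i x) - X (p x) * (\<Sum>i\<in>Basis. \<Psi>2 i x))"
  proof (rule integral_mono)
    show "integrable lborel (\<lambda>x. \<Sum>i\<in>Basis. G' i x)" using i by auto
    show "\<eta> (p x) * \<Psi> x * (\<Sum>i\<in>Basis. p2 i x) - X (p x) * (\<Sum>i\<in>Basis. \<Psi>2 i x) \<le> (\<Sum>i\<in>Basis. G' i x)" for x
      unfolding sum_distrib_left sum_subtractf[symmetric] G'_def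
      by (intro sum_mono) (use X(4) \<Psi>0(1) in simp)
  qed (use int1 int2 in auto)
  finally show ?thesis using int1 int2 by simp
qed

section \<open>Smooth approximations of the positive part and of its derivative\<close>

lemma has_real_derivative_max_0:
  fixes G G' :: "real \<Rightarrow> real"
  assumes G: "\<And>s. (G has_real_derivative G' s) (at s)" and 0: "G 0 = 0" "G' 0 = 0"
  shows "((\<lambda>s. G (max 0 s)) has_real_derivative G' (max 0 s)) (at s)"
proof -
  consider "s < 0" | "s = 0" | "0 < s" by linarith
  thus ?thesis
  proof cases
    case 1
    have "\<forall>\<^sub>F x in nhds s. x \<in> {..<0}" by (rule eventually_nhds_in_open) (use 1 in auto)
    hence "\<forall>\<^sub>F x in nhds s. G (max 0 x) = 0" by eventually_elim (simp add: 0)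
    from DERIV_cong_ev[OF refl this refl] show ?thesis using 1 0 by simp
  next
    case 3
    have "\<forall>\<^sub>F x in nhds s. x \<in> {0<..}" by (rule eventually_nhds_in_open) (use 3 in auto)
    hence "\<forall>\<^sub>F x in nhds s. G (max 0 x) = G x" by eventually_elim simp
    from DERIV_cong_ev[OF refl this refl] show ?thesis using 3 G by simp
  next
    case 2
    have "((\<lambda>h. \<bar>G h / h\<bar>) \<longlongrightarrow> \<bar>0\<bar>) (at 0)"
      using G[of 0] 0 by (intro tendsto_rabs) (simp add: has_field_derivative_iff)
    hence lim: "((\<lambda>h. \<bar>G h / h\<bar>) \<longlongrightarrow> 0) (at 0)" by simp
    have "norm (G (max 0 h) / h) \<le> \<bar>G h / h\<bar>" for h
      by (cases "0 \<le> h") (simp_all add: 0 divide_le_0_iff)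
    hence "((\<lambda>h. G (max 0 h) / h) \<longlongrightarrow> 0) (at 0)"
      by (intro Lim_null_comparison[OF _ lim] always_eventually allI)
    thus ?thesis using 2 0 by (simp add: has_field_derivative_iff)
  qed
qed

text \<open>A convex C^2 approximation of the positive part with derivative
  \<open>smooth_step\<close>. The rational step vanishes to second order at 0, so cutting it off
  there keeps it differentiable, and it has an explicit primitive, whence the arctangent.\<close>

definition smooth_pos :: "real \<Rightarrow> real \<Rightarrow> real" where
  "smooth_pos \<delta> s = (let r = max 0 s in r - \<delta> * arctan (r / \<delta>))"

definition smooth_step :: "real \<Rightarrow> real \<Rightarrow> real" where
  "smooth_step \<delta> s = (let r = max 0 s in r\<^sup>2 / (\<delta>\<^sup>2 + r\<^sup>2))"

lemma smooth_pos_deriv: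
  assumes "0 < \<delta>"
  shows "(smooth_pos \<delta> has_real_derivative smooth_step \<delta> s) (at s)"
proof -
  have "((\<lambda>r. r - \<delta> * arctan (r / \<delta>)) has_real_derivative r\<^sup>2 / (\<delta>\<^sup>2 + r\<^sup>2)) (at r)" for r
  proof -
    have "((\<lambda>r. r - \<delta> * arctan (r / \<delta>)) has_real_derivative 1 - \<delta> * ((1 / \<delta>) / (1 + (r / \<delta>)\<^sup>2))) (at r)"
      by (auto intro!: derivative_eq_intros simp: inverse_eq_divide)
    moreover have "1 - \<delta> * ((1 / \<delta>) / (1 + (r / \<delta>)\<^sup>2)) = r\<^sup>2 / (\<delta>\<^sup>2 + r\<^sup>2)"
    proof -
      define D where "D = \<delta>\<^sup>2 + r\<^sup>2"
      have D: "0 < D" using assms by (simp add: D_def add_pos_nonneg)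
      have "1 + (r / \<delta>)\<^sup>2 = D / \<delta>\<^sup>2" using assms by (simp add: D_def field_simps)
      hence "1 - \<delta> * ((1 / \<delta>) / (1 + (r / \<delta>)\<^sup>2)) = 1 - \<delta>\<^sup>2 / D" using assms by simp
      also have "\<dots> = (D - \<delta>\<^sup>2) / D" using D by (simp add: diff_divide_distrib)
      finally show ?thesis by (simp add: D_def)
    qed
    ultimately show ?thesis by simp
  qed
  from has_real_derivative_max_0[OF this] show ?thesis
    by (simp add: smooth_pos_def[abs_def] smooth_step_def Let_def)
qed

lemma smooth_step_deriv:
  assumes "0 < \<delta>"
  defines "d \<equiv> \<lambda>s. 2 * \<delta>\<^sup>2 * max 0 s / (\<delta>\<^sup>2 + (max 0 s)\<^sup>2)\<^sup>2"
  shows "(smooth_step \<delta> has_real_derivative d s) (at s)" "continuous_on S d" "0 \<le> d s"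
proof -
  have nz: "\<delta>\<^sup>2 + r\<^sup>2 \<noteq> 0" for r using assms by (simp add: add_nonneg_eq_0_iff)
  have "((\<lambda>r. r\<^sup>2 / (\<delta>\<^sup>2 + r\<^sup>2)) has_real_derivative 2 * \<delta>\<^sup>2 * r / (\<delta>\<^sup>2 + r\<^sup>2)\<^sup>2) (at r)" for r
    using nz by (auto intro!: derivative_eq_intros simp: power2_eq_square algebra_simps)
  from has_real_derivative_max_0[OF this] show "(smooth_step \<delta> has_real_derivative d s) (at s)"
    by (simp add: smooth_step_def[abs_def] d_def Let_def)
  show "continuous_on S d" unfolding d_def by (intro continuous_intros) (use nz in simp)
  show "0 \<le> d s" by (simp add: d_def)
qed

lemma smooth_step_bounds:
  assumes "0 < \<delta>"
  shows "0 \<le> smooth_step \<delta> s" "smooth_step \<delta> s \<le> 1"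
proof -
  have "0 < \<delta>\<^sup>2 + (max 0 s)\<^sup>2" using assms by (simp add: add_pos_nonneg)
  thus "smooth_step \<delta> s \<le> 1" unfolding smooth_step_def Let_def by (subst divide_le_eq_1_pos) auto
qed (simp add: smooth_step_def Let_def)

lemma smooth_pos_bounds:
  assumes "0 < \<delta>"
  shows "0 \<le> smooth_pos \<delta> s" "smooth_pos \<delta> s \<le> max 0 s"
proof -
  have 0: "smooth_pos \<delta> 0 = 0" by (simp add: smooth_pos_def)
  have eq: "smooth_pos \<delta> s = smooth_pos \<delta> (max 0 s)" by (simp add: smooth_pos_def)
  have "smooth_pos \<delta> 0 \<le> smooth_pos \<delta> (max 0 s)"
    by (rule DERIV_nonneg_imp_nondecreasing) (use smooth_pos_deriv[OF assms] smooth_step_bounds[OF assms] in auto)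
  thus "0 \<le> smooth_pos \<delta> s" using 0 eq by simp
  show "smooth_pos \<delta> s \<le> max 0 s"
    using assms by (simp add: smooth_pos_def Let_def)
qed

lemma smooth_step_LIMSEQ:
  "(\<lambda>j. smooth_step (1 / real (Suc j)) s) \<longlonglongrightarrow> (if 0 < s then 1 else 0)"
proof (cases "0 < s")
  case True
  have "(\<lambda>j. s\<^sup>2 / ((1 / real (Suc j))\<^sup>2 + s\<^sup>2)) \<longlonglongrightarrow> s\<^sup>2 / (0\<^sup>2 + s\<^sup>2)"
    using True LIMSEQ_inverse_real_of_nat
    by (intro tendsto_intros) (auto simp: inverse_eq_divide)
  thus ?thesis using True by (simp add: smooth_step_def max_def)
qed (simp add: smooth_step_def max_def)

lemma smooth_pos_LIMSEQ: "(\<lambda>j. smooth_pos (1 / real (Suc j)) s) \<longlonglongrightarrow> max 0 s"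
proof -
  have "(\<lambda>j. smooth_pos (1 / real (Suc j)) s - max 0 s) \<longlonglongrightarrow> 0"
  proof (rule Lim_null_comparison)
    show "\<forall>\<^sub>F j in sequentially. norm (smooth_pos (1 / real (Suc j)) s - max 0 s) \<le> inverse (real (Suc j)) * (pi / 2)"
    proof (rule always_eventually, rule allI)
      fix j
      have at: "\<bar>arctan y\<bar> \<le> pi / 2" for y :: real
        using arctan_lbound[of y] arctan_ubound[of y] by (simp add: abs_le_iff less_imp_le)
      have "inverse (real (Suc j)) * \<bar>arctan (max 0 s / (1 / real (Suc j)))\<bar> \<le> inverse (real (Suc j)) * (pi / 2)"
        by (rule mult_left_mono[OF at]) simp
      moreover have "smooth_pos (1 / real (Suc j)) s - max 0 s
          = - (inverse (real (Suc j)) * arctan (max 0 s / (1 / real (Suc j))))"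
        by (simp add: smooth_pos_def Let_def inverse_eq_divide)
      ultimately show "norm (smooth_pos (1 / real (Suc j)) s - max 0 s) \<le> inverse (real (Suc j)) * (pi / 2)"
        by (simp only: abs_minus_cancel real_norm_def abs_mult abs_inverse abs_of_nat)
    qed
    show "(\<lambda>j. inverse (real (Suc j)) * (pi / 2)) \<longlonglongrightarrow> 0"
      by (rule tendsto_mult_left_zero[OF LIMSEQ_inverse_real_of_nat])
  qed
  thus ?thesis by (rule LIM_zero_cancel)
qed

text \<open>Kato's inequality tests the equation with the sign of
  \<open>u powr m - V powr m\<close>, while the time derivative acts on \<open>u - V\<close>, so the
  smoothed integrand is not an exact derivative. But \<open>P\<close> and \<open>e\<close> are
  positive at the same times, so for both the smoothed steps tend to the same indicator, and the
  limit can be computed with \<open>e\<close> in place of \<open>P\<close>.\<close>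

lemma positive_part_FTC:
  fixes e e' P :: "real \<Rightarrow> real"
  assumes t: "a < t1" "t1 \<le> t2" "t2 < b"
    and e: "\<And>t. a < t \<Longrightarrow> t < b \<Longrightarrow> (e has_real_derivative e' t) (at t)"
    and e': "continuous_on {a<..<b} e'" and P: "continuous_on {a<..<b} P"
    and sgn: "\<And>t. a < t \<Longrightarrow> t < b \<Longrightarrow> 0 < P t \<longleftrightarrow> 0 < e t"
  shows "(\<lambda>j. integral\<^sup>L lborel (\<lambda>t. indicator {t1..t2} t * (smooth_step (1 / real (Suc j)) (P t) * e' t)))
    \<longlonglongrightarrow> max 0 (e t2) - max 0 (e t1)"
proof -
  have sub: "{t1..t2} \<subseteq> {a<..<b}" using t by auto
  have ce: "continuous_on {a<..<b} e"
    using e by (intro continuous_at_imp_continuous_on ballI) (auto intro: DERIV_isCont)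
  have cs: "continuous_on UNIV (smooth_step (1 / real (Suc j)))" for j
    using smooth_step_deriv(1)[of "1 / real (Suc j)"]
    by (intro continuous_at_imp_continuous_on ballI DERIV_isCont) auto
  have cont: "continuous_on {a<..<b} (\<lambda>t. smooth_step (1 / real (Suc j)) (Q t) * e' t)"
    if "continuous_on {a<..<b} Q" for Q j
    by (intro continuous_intros e' continuous_on_compose2[OF cs that]) auto
  have int: "integrable lborel (\<lambda>t. indicator {t1..t2} t * f t)" if "continuous_on {a<..<b} f" for f :: "real \<Rightarrow> real"
    using borel_integrable_compact[of "{t1..t2}" f] continuous_on_subset[OF that sub] by simp
  \<comment> \<open>The common limit: taking \<open>Q = e\<close> below identifies its value, taking
    \<open>Q = P\<close> gives the claim.\<close>
  define L where "L = integral\<^sup>L lborel (\<lambda>t. indicator {t1..t2} t * ((if 0 < e t then 1 else 0) * e' t))"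
  have lim: "(\<lambda>j. integral\<^sup>L lborel (\<lambda>t. indicator {t1..t2} t * (smooth_step (1 / real (Suc j)) (Q t) * e' t))) \<longlonglongrightarrow> L"
    if Q: "continuous_on {a<..<b} Q" and sQ: "\<And>t. a < t \<Longrightarrow> t < b \<Longrightarrow> 0 < Q t \<longleftrightarrow> 0 < e t" for Q
    unfolding L_def
  proof (rule integral_dominated_convergence[where w = "\<lambda>t. indicator {t1..t2} t * \<bar>e' t\<bar>"])
    have lim: "(\<lambda>j. indicator {t1..t2} t * (smooth_step (1 / real (Suc j)) (Q t) * e' t))
        \<longlonglongrightarrow> indicator {t1..t2} t * ((if 0 < e t then 1 else 0) * e' t)" for t
    proof (cases "t \<in> {t1..t2}")
      case True
      hence "(if 0 < Q t then 1 else 0 :: real) = (if 0 < e t then 1 else 0)" using sQ[of t] t by auto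
      thus ?thesis
        using tendsto_mult_left[OF tendsto_mult_right[OF smooth_step_LIMSEQ[of "Q t"], of "e' t"], of "indicator {t1..t2} t"] by simp
    qed simp
    show m: "(\<lambda>t. indicator {t1..t2} t * (smooth_step (1 / real (Suc j)) (Q t) * e' t)) \<in> borel_measurable lborel" for j
      using int[OF cont[OF Q]] by (rule borel_measurable_integrable)
    show "(\<lambda>t. indicator {t1..t2} t * ((if 0 < e t then 1 else 0) * e' t)) \<in> borel_measurable lborel"
      by (rule borel_measurable_LIMSEQ_real[OF lim m])
    show "integrable lborel (\<lambda>t. indicator {t1..t2} t * \<bar>e' t\<bar>)"
      by (rule int) (intro continuous_intros e')
    show "AE t in lborel. (\<lambda>j. indicator {t1..t2} t * (smooth_step (1 / real (Suc j)) (Q t) * e' t))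
        \<longlonglongrightarrow> indicator {t1..t2} t * ((if 0 < e t then 1 else 0) * e' t)"
      using lim by simp
    show "AE t in lborel. norm (indicator {t1..t2} t * (smooth_step (1 / real (Suc j)) (Q t) * e' t))
        \<le> indicator {t1..t2} t * \<bar>e' t\<bar>" for j
      using smooth_step_bounds[of "1 / real (Suc j)"]
      by (auto intro!: AE_I2 mult_left_mono mult_left_le_one_le simp: abs_mult)
  qed
  have "integral\<^sup>L lborel (\<lambda>t. indicator {t1..t2} t * (smooth_step (1 / real (Suc j)) (e t) * e' t))
      = smooth_pos (1 / real (Suc j)) (e t2) - smooth_pos (1 / real (Suc j)) (e t1)" for j
  proof -
    have "has_bochner_integral lborel (\<lambda>t. (smooth_step (1 / real (Suc j)) (e t) * e' t) * indicator {t1..t2} t)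
      (smooth_pos (1 / real (Suc j)) (e t2) - smooth_pos (1 / real (Suc j)) (e t1))"
    proof (rule has_bochner_integral_FTC_Icc_real[OF t(2)])
      fix s assume s: "t1 \<le> s" "s \<le> t2"
      show "((\<lambda>s. smooth_pos (1 / real (Suc j)) (e s)) has_real_derivative smooth_step (1 / real (Suc j)) (e s) * e' s) (at s)"
        by (rule DERIV_chain2[OF smooth_pos_deriv e]) (use s t in auto)
      show "isCont (\<lambda>s. smooth_step (1 / real (Suc j)) (e s) * e' s) s"
        using cont[OF ce, of j] s t by (simp add: continuous_on_eq_continuous_at)
    qed
    thus ?thesis by (simp add: has_bochner_integral_integral_eq mult.commute)
  qed
  hence "(\<lambda>j. integral\<^sup>L lborel (\<lambda>t. indicator {t1..t2} t * (smooth_step (1 / real (Suc j)) (e t) * e' t)))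
     \<longlonglongrightarrow> max 0 (e t2) - max 0 (e t1)"
    by (simp only:) (intro tendsto_diff smooth_pos_LIMSEQ)
  with lim[OF ce] have "L = max 0 (e t2) - max 0 (e t1)" using LIMSEQ_unique by blast
  thus ?thesis using lim[OF P sgn] by simp
qed

text \<open>Kato's inequality at each time is integrated over \<open>{t1..t2}\<close> with Fubini,
  and then the smoothing is removed by \<open>positive_part_FTC\<close>. The bound \<kappa> is
  uniform in the smoothing parameter so that it survives the limit.\<close>

lemma kato_in_time:
  fixes u V :: "'a::euclidean_space \<Rightarrow> real \<Rightarrow> real" and \<Psi> :: "'a \<Rightarrow> real"
  assumes u: "fde_solution m T u" and V: "fde_solution m T V" and m: "0 < m" "m < 1"
    and \<Psi>: "\<And>i x. i \<in> Basis \<Longrightarrow> has_pd i \<Psi> x (\<Psi>1 i x)" "\<And>i x. i \<in> Basis \<Longrightarrow> has_pd i (\<Psi>1 i) x (\<Psi>2 i x)"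
    and \<Psi>c: "continuous_on UNIV \<Psi>" "\<And>i. i \<in> Basis \<Longrightarrow> continuous_on UNIV (\<Psi>1 i)"
      "\<And>i. i \<in> Basis \<Longrightarrow> continuous_on UNIV (\<Psi>2 i)"
    and \<Psi>0: "\<And>x. 0 \<le> \<Psi> x" "\<And>x. R < norm x \<Longrightarrow> \<Psi> x = 0"
      "\<And>i x. i \<in> Basis \<Longrightarrow> R < norm x \<Longrightarrow> \<Psi>1 i x = 0" "\<And>i x. i \<in> Basis \<Longrightarrow> R < norm x \<Longrightarrow> \<Psi>2 i x = 0"
    and t: "0 < t1" "t1 \<le> t2" "t2 < T"
    and \<kappa>: "\<And>t \<delta>. t1 \<le> t \<Longrightarrow> t \<le> t2 \<Longrightarrow> 0 < \<delta> \<Longrightarrow>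
      integral\<^sup>L lborel (\<lambda>x. smooth_pos \<delta> (u x t powr m - V x t powr m) * (\<Sum>i\<in>Basis. \<Psi>2 i x)) \<le> \<kappa>"
  shows "integral\<^sup>L lborel (\<lambda>x. max 0 (u x t2 - V x t2) * \<Psi> x)
    \<le> integral\<^sup>L lborel (\<lambda>x. max 0 (u x t1 - V x t1) * \<Psi> x) + \<kappa> * (t2 - t1)"
proof -
  define P where "P x t = u x t powr m - V x t powr m" for x t
  define D where "D x t = deriv (u x) t - deriv (V x) t" for x t
  define \<delta> where "\<delta> j = 1 / real (Suc j)" for j
  have \<delta>: "0 < \<delta> j" for j by (simp add: \<delta>_def)
  have cs: "continuous_on UNIV (smooth_step (\<delta> j))" for j
    using smooth_step_deriv(1)[OF \<delta>] by (intro continuous_at_imp_continuous_on ballI DERIV_isCont) auto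
  have space: "integral\<^sup>L lborel (\<lambda>x. smooth_step (\<delta> j) (P x t) * \<Psi> x * D x t) \<le> \<kappa>" if tt: "t1 \<le> t" "t \<le> t2" for j t
  proof -
    have tT: "0 < t" "t < T" using t tt by auto
    define A where "A = (\<lambda>z. u z t powr m)"
    define B where "B = (\<lambda>z. V z t powr m)"
    note C2u = C2_powr[OF fde_solutionD(4)[OF u tT] fde_solutionD(1)[OF u tT], of _ m, folded A_def]
    note C2V = C2_powr[OF fde_solutionD(4)[OF V tT] fde_solutionD(1)[OF V tT], of _ m, folded B_def]
    note cu = C2_powr_continuous[OF fde_solutionD(4)[OF u tT] fde_solutionD(1)[OF u tT], of _ UNIV m, folded A_def]
    note cV = C2_powr_continuous[OF fde_solutionD(4)[OF V tT] fde_solutionD(1)[OF V tT], of _ UNIV m, folded B_def]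
    obtain b :: 'a where b: "b \<in> Basis" using nonempty_Basis by blast
    have "integral\<^sup>L lborel (\<lambda>x. smooth_step (\<delta> j) (A x - B x) * \<Psi> x *
          (\<Sum>i\<in>Basis. partial_deriv i (partial_deriv i A) x - partial_deriv i (partial_deriv i B) x))
        \<le> integral\<^sup>L lborel (\<lambda>x. smooth_pos (\<delta> j) (A x - B x) * (\<Sum>i\<in>Basis. \<Psi>2 i x))"
    proof (rule kato_inequality[OF _ _ _ _ _ \<Psi> \<Psi>c \<Psi>0 smooth_pos_deriv[OF \<delta>] smooth_step_deriv[OF \<delta>]])
      show "has_pd i (\<lambda>x. A x - B x) x (partial_deriv i A x - partial_deriv i B x)" if "i \<in> Basis" for i x
        by (intro has_pd_diff has_pd_partial_deriv C2u(1) C2V(1) that)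
      show "has_pd i (\<lambda>x. partial_deriv i A x - partial_deriv i B x) x
          (partial_deriv i (partial_deriv i A) x - partial_deriv i (partial_deriv i B) x)" if "i \<in> Basis" for i x
        by (intro has_pd_diff has_pd_partial_deriv C2u(2) C2V(2) that)
      show "continuous_on UNIV (\<lambda>x. A x - B x)"
        by (intro continuous_intros cu(1)[OF b] cV(1)[OF b])
      show "continuous_on UNIV (\<lambda>x. partial_deriv i A x - partial_deriv i B x)" if "i \<in> Basis" for i
        by (intro continuous_intros cu(2)[OF that] cV(2)[OF that])
      show "continuous_on UNIV (\<lambda>x. partial_deriv i (partial_deriv i A) x - partial_deriv i (partial_deriv i B) x)" if "i \<in> Basis" for i
        by (intro continuous_intros cu(3)[OF that] cV(3)[OF that])
    qed
    also have "\<dots> \<le> \<kappa>" using \<kappa>[OF tt \<delta>] by (simp add: A_def B_def)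
    finally show ?thesis
      using fde_solutionD(2)[OF u tT] fde_solutionD(2)[OF V tT]
      by (simp add: sum_subtractf laplacian_def[symmetric] P_def D_def A_def B_def)
  qed
  define Q where "Q = cball (0::'a) R \<times> {t1..t2}"
  have Q: "compact Q" "Q \<subseteq> UNIV \<times> {0<..<T}" using t by (auto simp: Q_def intro: compact_Times)
  note cu = fde_solution_continuous[OF u Q(2)] and cV = fde_solution_continuous[OF V Q(2)]
  have pos: "0 < u (fst z) (snd z)" "0 < V (fst z) (snd z)" if "z \<in> Q" for z
    using that Q(2) fde_solutionD(1)[OF u] fde_solutionD(1)[OF V] by auto
  have cP: "continuous_on Q (\<lambda>z. P (fst z) (snd z))"
    unfolding P_def using cu cV pos by (intro continuous_intros) (auto simp: case_prod_unfold less_imp_neq[THEN not_sym])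
  have cD: "continuous_on Q (\<lambda>z. D (fst z) (snd z))"
    unfolding D_def using cu cV by (intro continuous_intros) (auto simp: case_prod_unfold)
  \<comment> \<open>The indicator of the time interval is part of the integrand so that Fubini
    applies on the whole space; in \<open>x\<close> the support of \<Psi> does the same.\<close>
  define h where "h j x t = indicator {t1..t2} t * (smooth_step (\<delta> j) (P x t) * \<Psi> x * D x t)" for j x t
  have int2: "integrable (lborel \<Otimes>\<^sub>M lborel) (\<lambda>(x, t). h j x t)" for j
  proof -
    have "continuous_on Q (\<lambda>z. smooth_step (\<delta> j) (P (fst z) (snd z)) * \<Psi> (fst z) * D (fst z) (snd z))"
      by (intro continuous_intros cD continuous_on_compose2[OF cs cP] continuous_on_compose2[OF \<Psi>c(1)]) auto
    from borel_integrable_compact[OF Q(1) this]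
    have "integrable lborel (\<lambda>z. indicator Q z * (smooth_step (\<delta> j) (P (fst z) (snd z)) * \<Psi> (fst z) * D (fst z) (snd z)))"
      by simp
    also have "(\<lambda>z. indicator Q z * (smooth_step (\<delta> j) (P (fst z) (snd z)) * \<Psi> (fst z) * D (fst z) (snd z))) = (\<lambda>(x, t). h j x t)"
      using \<Psi>0(2) by (auto simp: fun_eq_iff h_def Q_def indicator_def not_le)
    finally show ?thesis by (simp add: lborel_prod)
  qed
  have le: "integral\<^sup>L lborel (\<lambda>x. integral\<^sup>L lborel (h j x)) \<le> \<kappa> * (t2 - t1)" for j
  proof -
    have "integral\<^sup>L lborel (\<lambda>x. integral\<^sup>L lborel (h j x)) = integral\<^sup>L lborel (\<lambda>t. integral\<^sup>L lborel (\<lambda>x. h j x t))"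
      using lborel_pair.Fubini_integral[OF int2] by simp
    also have "\<dots> \<le> integral\<^sup>L lborel (\<lambda>t. \<kappa> * indicator {t1..t2} t)"
    proof (rule integral_mono)
      show "integrable lborel (\<lambda>t. integral\<^sup>L lborel (\<lambda>x. h j x t))"
        using lborel_pair.integrable_snd[OF int2] by simp
      show "integrable lborel (\<lambda>t. \<kappa> * indicator {t1..t2} t)"
        by (intro integrable_mult_right integrable_real_indicator) (use t in auto)
      show "integral\<^sup>L lborel (\<lambda>x. h j x t) \<le> \<kappa> * indicator {t1..t2} t" for t
        using space[of t j] by (cases "t \<in> {t1..t2}") (simp_all add: h_def)
    qed
    also have "\<dots> = \<kappa> * (t2 - t1)" using t by simp
    finally show ?thesis .
  qed
  define E where "E x = (max 0 (u x t2 - V x t2) - max 0 (u x t1 - V x t1)) * \<Psi> x" for x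
  obtain M where M: "\<And>x t. norm x \<le> R \<Longrightarrow> t1 \<le> t \<Longrightarrow> t \<le> t2 \<Longrightarrow> \<bar>D x t\<bar> \<le> M"
  proof -
    have "bdd_above ((\<lambda>z. \<bar>D (fst z) (snd z)\<bar>) ` Q)"
      by (intro bounded_imp_bdd_above compact_imp_bounded compact_continuous_image Q(1) continuous_intros cD)
    then obtain M where "\<And>z. z \<in> Q \<Longrightarrow> \<bar>D (fst z) (snd z)\<bar> \<le> M"
      unfolding bdd_above_def by blast
    thus ?thesis using that[of M] by (force simp: Q_def)
  qed
  have lim: "(\<lambda>j. integral\<^sup>L lborel (\<lambda>x. integral\<^sup>L lborel (h j x))) \<longlonglongrightarrow> integral\<^sup>L lborel E"
  proof (rule integral_dominated_convergence[where w = "\<lambda>x. (M * (t2 - t1)) * \<Psi> x"])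
    have lim: "(\<lambda>j. integral\<^sup>L lborel (h j x)) \<longlonglongrightarrow> E x" for x
    proof -
      have "(\<lambda>j. integral\<^sup>L lborel (\<lambda>t. indicator {t1..t2} t * (smooth_step (1 / real (Suc j)) (P x t) * D x t)))
          \<longlonglongrightarrow> max 0 (u x t2 - V x t2) - max 0 (u x t1 - V x t1)"
      proof (rule positive_part_FTC[OF t, where e = "\<lambda>t. u x t - V x t"])
        have slice: "continuous_on {0<..<T} (\<lambda>t. f x t)" if "continuous_on (UNIV \<times> {0<..<T}) (\<lambda>(x, t). f x t)"
          for f :: "'a \<Rightarrow> real \<Rightarrow> real"
        proof -
          have "(\<lambda>t. (x, t)) ` {0<..<T} \<subseteq> UNIV \<times> {0<..<T}" by auto
          from continuous_on_compose2[OF that continuous_on_Pair[OF continuous_on_const continuous_on_id] this]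
          show ?thesis by simp
        qed
        note cu = fde_solution_continuous[OF u order_refl] and cV = fde_solution_continuous[OF V order_refl]
        show "continuous_on {0<..<T} (D x)"
          unfolding D_def[abs_def] by (intro continuous_intros slice[OF cu(2)] slice[OF cV(2)])
        show "continuous_on {0<..<T} (P x)"
          unfolding P_def[abs_def] using fde_solutionD(1)[OF u] fde_solutionD(1)[OF V]
          by (intro continuous_intros slice[OF cu(1)] slice[OF cV(1)]) (auto simp: less_imp_neq[THEN not_sym])
        fix s assume s: "0 < s" "s < T"
        show "((\<lambda>t. u x t - V x t) has_real_derivative D x s) (at s)"
          unfolding D_def by (intro DERIV_diff fde_solutionD(3)[OF u s] fde_solutionD(3)[OF V s])
        show "0 < P x s \<longleftrightarrow> 0 < u x s - V x s"
          using powr_less_mono2[of m "V x s" "u x s"] powr_mono2[of m "u x s" "V x s"] m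
            fde_solutionD(1)[OF u s, of x] fde_solutionD(1)[OF V s, of x]
          by (cases "V x s < u x s") (auto simp: P_def)
      qed
      from tendsto_mult_right[OF this, of "\<Psi> x"] show ?thesis
        unfolding E_def h_def[abs_def] \<delta>_def
        by (simp add: mult.assoc mult.left_commute mult.commute flip: integral_mult_left_zero integral_mult_right_zero)
    qed
    show m': "(\<lambda>x. integral\<^sup>L lborel (h j x)) \<in> borel_measurable lborel" for j
      using lborel_pair.integrable_fst[OF int2] by (simp add: borel_measurable_integrable)
    show "E \<in> borel_measurable lborel" by (rule borel_measurable_LIMSEQ_real[OF lim m'])
    show "integrable lborel (\<lambda>x. (M * (t2 - t1)) * \<Psi> x)"
      by (intro integrable_mult_right integrable_continuous_compact_support[OF \<Psi>c(1) \<Psi>0(2)])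
    show "AE x in lborel. (\<lambda>j. integral\<^sup>L lborel (h j x)) \<longlonglongrightarrow> E x" using lim by simp
    show "AE x in lborel. norm (integral\<^sup>L lborel (h j x)) \<le> (M * (t2 - t1)) * \<Psi> x" for j
    proof (rule AE_I2)
      fix x
      show "norm (integral\<^sup>L lborel (h j x)) \<le> (M * (t2 - t1)) * \<Psi> x"
      proof (cases "norm x \<le> R")
        case True
        have "norm (integral\<^sup>L lborel (h j x)) \<le> integral\<^sup>L lborel (\<lambda>t. (M * \<Psi> x) * indicator {t1..t2} t)"
        proof (cases "integrable lborel (h j x)")
          \<comment> \<open>The Bochner integral of a non-integrable slice is 0 by convention, so
            the bound holds there too.\<close>
          case False
          thus ?thesis using True M[OF True, of t1] \<Psi>0(1)[of x] t
            by (simp add: not_integrable_integral_eq mult_nonneg_nonneg order_trans[OF abs_ge_zero])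
        next
          case int: True
          show ?thesis
          proof (rule Bochner_Integration.integral_norm_bound_integral[OF int])
            show "integrable lborel (\<lambda>t. (M * \<Psi> x) * indicator {t1..t2} t)"
              by (intro integrable_mult_right integrable_real_indicator) (use t in auto)
            fix t
            show "norm (h j x t) \<le> (M * \<Psi> x) * indicator {t1..t2} t"
              proof (cases "t \<in> {t1..t2}")
                case t: True
                have "smooth_step (\<delta> j) (P x t) * \<Psi> x * \<bar>D x t\<bar> \<le> 1 * \<Psi> x * M"
                  using M[OF True, of t] t smooth_step_bounds[OF \<delta>] \<Psi>0(1)[of x] by (intro mult_mono) auto
                thus ?thesis using t smooth_step_bounds[OF \<delta>] \<Psi>0(1)[of x] by (simp add: h_def abs_mult mult.commute)
              qed (simp add: h_def)
          qed
        qed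
        also have "\<dots> = (M * (t2 - t1)) * \<Psi> x" using t by simp
        finally show ?thesis .
      next
        case False
        thus ?thesis using \<Psi>0(2)[of x] by (simp add: h_def[abs_def])
      qed
    qed
  qed
  have intE: "integrable lborel (\<lambda>x. max 0 (u x s - V x s) * \<Psi> x)" if "t1 \<le> s" "s \<le> t2" for s
  proof -
    have s: "0 < s" "s < T" using t that by auto
    have "continuous_on UNIV (\<lambda>x. u x s)" "continuous_on UNIV (\<lambda>x. V x s)"
      using fde_solutionD(4)[OF u s] fde_solutionD(4)[OF V s] by (auto simp: C2_def)
    thus ?thesis
      by (intro integrable_continuous_compact_support[of _ R]) (auto intro!: continuous_intros \<Psi>c(1) simp: \<Psi>0(2))
  qed
  have "integral\<^sup>L lborel E \<le> \<kappa> * (t2 - t1)"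
    by (rule LIMSEQ_le_const2[OF lim]) (use le in blast)
  thus ?thesis
    using intE[of t1] intE[of t2] t by (simp add: E_def[abs_def] left_diff_distrib)
qed

section \<open>Comparison from the initial trace\<close>

lemma has_pd_inner_self:
  assumes "i \<in> Basis"
  shows "has_pd i (\<lambda>x::'a::euclidean_space. x \<bullet> x) x (2 * (x \<bullet> i))"
proof -
  have "(\<lambda>s. (x + s *\<^sub>R i) \<bullet> (x + s *\<^sub>R i)) = (\<lambda>s. x \<bullet> x + 2 * s * (x \<bullet> i) + s\<^sup>2)"
    using assms by (simp add: fun_eq_iff inner_add_left inner_add_right inner_commute[of i x] power2_eq_square algebra_simps)
  thus ?thesis unfolding has_pd_def by (auto intro!: derivative_eq_intros)
qed

lemma has_pd_inner_Basis:
  assumes "i \<in> Basis"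
  shows "has_pd i (\<lambda>x::'a::euclidean_space. x \<bullet> i) x 1"
  using assms unfolding has_pd_def by (auto intro!: derivative_eq_intros simp: inner_add_left)

text \<open>A power of a truncated quadratic, with \<open>\<sigma> = x \<bullet> x\<close> in mind.
  Two derivatives cost two powers, whence the exponent \<open>p - 2\<close> in later bounds; a large
  \<open>p\<close> lets Young's inequality win them back.\<close>

definition cutoff :: "real \<Rightarrow> nat \<Rightarrow> real \<Rightarrow> real" where
  "cutoff R p \<sigma> = (max 0 (1 - \<sigma> / R\<^sup>2)) ^ p"

lemma cutoff_deriv:
  assumes "2 \<le> p"
  shows "(cutoff R p has_real_derivative - (real p / R\<^sup>2) * cutoff R (p - 1) \<sigma>) (at \<sigma>)"
proof -
  have "((\<lambda>s. (max 0 s) ^ p) has_real_derivative real p * (max 0 s) ^ (p - 1)) (at s)" for s :: real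
    by (rule has_real_derivative_max_0[where G = "\<lambda>s. s ^ p" and G' = "\<lambda>s. real p * s ^ (p - 1)"])
       (use assms in \<open>auto intro!: derivative_eq_intros\<close>)
  moreover have "((\<lambda>\<sigma>. 1 - \<sigma> / R\<^sup>2) has_real_derivative - (1 / R\<^sup>2)) (at \<sigma>)"
    by (rule DERIV_cong[OF DERIV_diff[OF DERIV_const DERIV_cdivide[OF DERIV_ident]]]) simp
  ultimately have "((\<lambda>\<sigma>. (max 0 (1 - \<sigma> / R\<^sup>2)) ^ p) has_real_derivative
      real p * (max 0 (1 - \<sigma> / R\<^sup>2)) ^ (p - 1) * - (1 / R\<^sup>2)) (at \<sigma>)"
    by (rule DERIV_chain2)
  thus ?thesis by (simp add: cutoff_def[abs_def])
qed

lemma cutoff_bounds: "0 \<le> cutoff R p \<sigma>" "0 \<le> \<sigma> \<Longrightarrow> cutoff R p \<sigma> \<le> 1"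
  by (auto simp: cutoff_def intro!: power_le_one)

lemma cutoff_antimono: "p \<le> p' \<Longrightarrow> 0 \<le> \<sigma> \<Longrightarrow> cutoff R p' \<sigma> \<le> cutoff R p \<sigma>"
  unfolding cutoff_def by (intro power_decreasing) auto

lemma cutoff_eq_0: "0 < R \<Longrightarrow> R < norm x \<Longrightarrow> 0 < p \<Longrightarrow> cutoff R p (x \<bullet> x) = 0"
  by (simp add: cutoff_def dot_square_norm max_def field_simps not_less power_mono)

lemma continuous_on_cutoff: "continuous_on S (cutoff R p)"
  unfolding cutoff_def[abs_def] by (cases "R = 0") (auto intro!: continuous_intros)

text \<open>For \<open>c = (DIM('a) - 2) / 2\<close> this is a smooth superharmonic function
  decaying like the fundamental solution of the Laplacian. Its integral over a ball of radius
  \<open>R\<close> grows like \<open>R^2\<close>, which cancels the factor \<open>1 / R^2\<close>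
  from differentiating the cutoff.\<close>

definition weight :: "real \<Rightarrow> 'a::euclidean_space \<Rightarrow> real" where
  "weight c x = (1 + x \<bullet> x) powr (- c)"

definition test_fun :: "real \<Rightarrow> real \<Rightarrow> nat \<Rightarrow> 'a::euclidean_space \<Rightarrow> real" where
  "test_fun c R p x = weight c x * cutoff R p (x \<bullet> x)"

lemma weight_pos: "0 < weight c x"
proof -
  have "1 + x \<bullet> x \<noteq> 0" by (smt (verit) inner_ge_zero)
  thus ?thesis by (simp add: weight_def)
qed

lemma continuous_on_weight: "continuous_on S (weight c :: 'a::euclidean_space \<Rightarrow> real)"
proof -
  have nz: "1 + x \<bullet> x \<noteq> 0" for x :: 'a by (smt (verit) inner_ge_zero)
  show ?thesis unfolding weight_def[abs_def] by (intro continuous_intros) (use nz in auto)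
qed

lemma continuous_on_test_fun: "continuous_on S (test_fun c R p :: 'a::euclidean_space \<Rightarrow> real)"
  unfolding test_fun_def[abs_def]
  by (intro continuous_intros continuous_on_weight continuous_on_compose2[OF continuous_on_cutoff[of UNIV]]) auto

text \<open>Superharmonicity of the weight disposes of the term without derivatives of the cutoff;
  every other term carries a factor \<open>1 / R^2\<close> and at least \<open>p - 2\<close> powers
  of the cutoff.\<close>

lemma test_fun_laplacian:
  fixes R :: real and p :: nat
  defines "c \<equiv> (real DIM('a::euclidean_space) - 2) / 2"
  assumes R: "1 \<le> R" and p: "3 \<le> p" and dim: "3 \<le> DIM('a::euclidean_space)"
  obtains \<Psi>1 \<Psi>2 :: "'a::euclidean_space \<Rightarrow> 'a \<Rightarrow> real" where
    "\<And>i x. i \<in> Basis \<Longrightarrow> has_pd i (test_fun c R p) x (\<Psi>1 i x)"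
    "\<And>i x. i \<in> Basis \<Longrightarrow> has_pd i (\<Psi>1 i) x (\<Psi>2 i x)"
    "continuous_on UNIV (test_fun c R p :: 'a::euclidean_space \<Rightarrow> real)"
    "\<And>i. i \<in> Basis \<Longrightarrow> continuous_on UNIV (\<Psi>1 i)"
    "\<And>i. i \<in> Basis \<Longrightarrow> continuous_on UNIV (\<Psi>2 i)"
    "\<And>i x. i \<in> Basis \<Longrightarrow> R < norm x \<Longrightarrow> \<Psi>1 i x = 0"
    "\<And>i x. i \<in> Basis \<Longrightarrow> R < norm x \<Longrightarrow> \<Psi>2 i x = 0"
    "\<And>x. (\<Sum>i\<in>Basis. \<Psi>2 i x) \<le> (8 * c * p + 4 * p\<^sup>2) / R\<^sup>2 * (weight c x * cutoff R (p - 2) (x \<bullet> x))"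
proof -
  define n where "n = real DIM('a)"
  \<comment> \<open>The second identity is what makes the weight superharmonic: it cancels the terms
    in \<sigma> of the coefficient of the undifferentiated cutoff.\<close>
  have c: "0 < c" "4 * (c + 1) = 2 * n" using dim by (auto simp: c_def n_def field_simps)
  define w where "w b \<sigma> = (1 + \<sigma>) powr (- b)" for b \<sigma> :: real
  define P where "P = real p"
  define \<rho> where "\<rho> = 1 / R\<^sup>2"
  have \<rho>: "0 < \<rho>" using R by (simp add: \<rho>_def)
  define \<Theta>1 where "\<Theta>1 \<sigma> = - c * w (c + 1) \<sigma> * cutoff R p \<sigma> - P * \<rho> * (w c \<sigma> * cutoff R (p - 1) \<sigma>)" for \<sigma>
  define \<Theta>2 where "\<Theta>2 \<sigma> = c * (c + 1) * w (c + 2) \<sigma> * cutoff R p \<sigma>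
     + 2 * c * (P * \<rho>) * (w (c + 1) \<sigma> * cutoff R (p - 1) \<sigma>)
     + P * (P - 1) * (\<rho> * \<rho>) * (w c \<sigma> * cutoff R (p - 2) \<sigma>)" for \<sigma>
  have wd: "(w b has_real_derivative - b * w (b + 1) \<sigma>) (at \<sigma>)" if "0 \<le> \<sigma>" for b \<sigma>
  proof -
    have e: "- (b + 1) = - b - 1" by simp
    show ?thesis unfolding w_def[abs_def] e using that by (auto intro!: derivative_eq_intros)
  qed
  have cd1: "(cutoff R p has_real_derivative - (P * \<rho>) * cutoff R (p - 1) \<sigma>) (at \<sigma>)" for \<sigma>
    using cutoff_deriv[of p R \<sigma>] p by (simp add: P_def \<rho>_def)
  have cd2: "(cutoff R (p - 1) has_real_derivative - ((P - 1) * \<rho>) * cutoff R (p - 2) \<sigma>) (at \<sigma>)" for \<sigma>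
    using cutoff_deriv[of "p - 1" R \<sigma>] p by (simp add: P_def \<rho>_def of_nat_diff numeral_2_eq_2)
  have d1: "((\<lambda>\<sigma>. w c \<sigma> * cutoff R p \<sigma>) has_real_derivative \<Theta>1 \<sigma>) (at \<sigma>)" if "0 \<le> \<sigma>" for \<sigma>
    by (rule DERIV_cong[OF DERIV_mult[OF wd[OF that] cd1]]) (simp add: \<Theta>1_def algebra_simps)
  have d2: "(\<Theta>1 has_real_derivative \<Theta>2 \<sigma>) (at \<sigma>)" if "0 \<le> \<sigma>" for \<sigma>
  proof -
    have "((\<lambda>\<sigma>. - c * (w (c + 1) \<sigma> * cutoff R p \<sigma>) - P * \<rho> * (w c \<sigma> * cutoff R (p - 1) \<sigma>)) has_real_derivative
       - c * (- (c + 1) * w (c + 1 + 1) \<sigma> * cutoff R p \<sigma> + - (P * \<rho>) * cutoff R (p - 1) \<sigma> * w (c + 1) \<sigma>)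
       - P * \<rho> * (- c * w (c + 1) \<sigma> * cutoff R (p - 1) \<sigma> + - ((P - 1) * \<rho>) * cutoff R (p - 2) \<sigma> * w c \<sigma>)) (at \<sigma>)"
      by (intro DERIV_diff DERIV_cmult DERIV_mult wd that cd1 cd2)
    moreover have "\<Theta>1 = (\<lambda>\<sigma>. - c * (w (c + 1) \<sigma> * cutoff R p \<sigma>) - P * \<rho> * (w c \<sigma> * cutoff R (p - 1) \<sigma>))"
      by (simp add: \<Theta>1_def fun_eq_iff)
    ultimately show ?thesis
      by (simp add: \<Theta>2_def algebra_simps)
  qed
  have eq: "test_fun c R p = (\<lambda>x::'a. w c (x \<bullet> x) * cutoff R p (x \<bullet> x))"
    by (simp add: fun_eq_iff test_fun_def weight_def w_def)
  have cw: "continuous_on UNIV (\<lambda>x::'a. w b (x \<bullet> x))" for b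
    using continuous_on_weight[of UNIV b] by (simp add: weight_def[abs_def] w_def)
  have cc: "continuous_on UNIV (\<lambda>x::'a. cutoff R q (x \<bullet> x))" for q
    by (rule continuous_on_compose2[OF continuous_on_cutoff[of UNIV]]) (auto intro!: continuous_intros)
  have c1: "continuous_on UNIV (\<lambda>x::'a. \<Theta>1 (x \<bullet> x))" and c2: "continuous_on UNIV (\<lambda>x::'a. \<Theta>2 (x \<bullet> x))"
    unfolding \<Theta>1_def \<Theta>2_def by (intro continuous_intros cw cc)+
  have z: "\<Theta>1 (x \<bullet> x) = 0" "\<Theta>2 (x \<bullet> x) = 0" if "R < norm x" for x :: 'a
    using cutoff_eq_0[of R x] that R p by (simp_all add: \<Theta>1_def \<Theta>2_def)
  define \<Psi>1 where "\<Psi>1 i x = \<Theta>1 (x \<bullet> x) * (2 * (x \<bullet> i))" for i x :: 'a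
  define \<Psi>2 where "\<Psi>2 i x = \<Theta>2 (x \<bullet> x) * (2 * (x \<bullet> i))\<^sup>2 + 2 * \<Theta>1 (x \<bullet> x)" for i x :: 'a
  show ?thesis
  proof (rule that)
    show "has_pd i (test_fun c R p) x (\<Psi>1 i x)" if i: "i \<in> Basis" for i x :: 'a
      unfolding eq \<Psi>1_def by (rule has_pd_chain[OF d1 has_pd_inner_self[OF i]]) simp
    show "has_pd i (\<Psi>1 i) x (\<Psi>2 i x)" if i: "i \<in> Basis" for i x :: 'a
    proof -
      have "has_pd i (\<lambda>x. \<Theta>1 (x \<bullet> x)) x (\<Theta>2 (x \<bullet> x) * (2 * (x \<bullet> i)))"
        by (rule has_pd_chain[OF d2 has_pd_inner_self[OF i]]) simp
      moreover have "has_pd i (\<lambda>x. 2 * (x \<bullet> i)) x (0 * (x \<bullet> i) + 1 * 2)"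
        by (intro has_pd_mult has_pd_const has_pd_inner_Basis i)
      ultimately show ?thesis
        unfolding \<Psi>1_def[abs_def] \<Psi>2_def using has_pd_mult by (fastforce simp: power2_eq_square mult.assoc)
    qed
    show "continuous_on UNIV (test_fun c R p :: 'a \<Rightarrow> real)"
      unfolding eq by (intro continuous_intros cw cc)
    show "continuous_on UNIV (\<Psi>1 i)" "continuous_on UNIV (\<Psi>2 i)" for i
      unfolding \<Psi>1_def[abs_def] \<Psi>2_def[abs_def] by (intro continuous_intros c1 c2)+
    show "\<Psi>1 i x = 0" "\<Psi>2 i x = 0" if "R < norm x" for i x
      using z[OF that] by (simp_all add: \<Psi>1_def \<Psi>2_def)
    show "(\<Sum>i\<in>Basis. \<Psi>2 i x) \<le> (8 * c * p + 4 * p\<^sup>2) / R\<^sup>2 * (weight c x * cutoff R (p - 2) (x \<bullet> x))" for x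
    proof -
      define \<sigma> where "\<sigma> = x \<bullet> x"
      have \<sigma>: "0 \<le> \<sigma>" by (simp add: \<sigma>_def)
      have wp: "0 < w b \<sigma>" for b using \<sigma> by (simp add: w_def)
      have w1: "w b \<sigma> = (1 + \<sigma>) * w (b + 1) \<sigma>" for b
        using \<sigma> by (simp add: w_def powr_mult_base)
      have P: "3 \<le> P" using p by (simp add: P_def)
      define k0 where "k0 = cutoff R p \<sigma>"
      define k1 where "k1 = cutoff R (p - 1) \<sigma>"
      define k2 where "k2 = cutoff R (p - 2) \<sigma>"
      have k: "0 \<le> k0" "0 \<le> k1" "0 \<le> k2" "k1 \<le> k2"
        unfolding k0_def k1_def k2_def using \<sigma> by (auto intro: cutoff_bounds cutoff_antimono)
      have "(\<Sum>i\<in>Basis. \<Psi>2 i x) = 2 * n * \<Theta>1 \<sigma> + 4 * \<sigma> * \<Theta>2 \<sigma>"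
      proof -
        have "(\<Sum>i\<in>Basis. \<Psi>2 i x) = \<Theta>2 \<sigma> * (\<Sum>i\<in>Basis. (2 * (x \<bullet> i))\<^sup>2) + n * (2 * \<Theta>1 \<sigma>)"
          by (simp add: \<Psi>2_def \<sigma>_def sum.distrib sum_distrib_left n_def)
        also have "(\<Sum>i\<in>Basis. (2 * (x \<bullet> i))\<^sup>2) = 4 * \<sigma>"
          unfolding \<sigma>_def by (subst euclidean_inner) (simp add: power2_eq_square sum_distrib_left algebra_simps)
        finally show ?thesis by simp
      qed
      also have "\<dots> = - 2 * n * c * w (c + 2) \<sigma> * k0
          + P * \<rho> * w (c + 1) \<sigma> * k1 * (8 * c * \<sigma> - 2 * n * (1 + \<sigma>))
          + 4 * P * (P - 1) * \<rho> * w c \<sigma> * (\<sigma> * \<rho> * k2)"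
      proof -
        have "2 * n * \<Theta>1 \<sigma> + 4 * \<sigma> * \<Theta>2 \<sigma> = c * w (c + 2) \<sigma> * k0 * (4 * (c + 1) * \<sigma> - 2 * n * (1 + \<sigma>))
          + P * \<rho> * w (c + 1) \<sigma> * k1 * (8 * c * \<sigma> - 2 * n * (1 + \<sigma>))
          + 4 * P * (P - 1) * \<rho> * w c \<sigma> * (\<sigma> * \<rho> * k2)"
          unfolding \<Theta>1_def \<Theta>2_def k0_def[symmetric] k1_def[symmetric] k2_def[symmetric]
            w1[of c] w1[of "c + 1"] by (simp add: algebra_simps)
        thus ?thesis unfolding c(2) by (simp add: algebra_simps)
      qed
      also have "\<dots> \<le> 0 + P * \<rho> * w c \<sigma> * k2 * (8 * c) + 4 * P * (P - 1) * \<rho> * w c \<sigma> * k2"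
      proof (intro add_mono)
        have n: "0 \<le> n" by (simp add: n_def)
        show "- 2 * n * c * w (c + 2) \<sigma> * k0 \<le> 0"
          using n c wp[of "c + 2"] k by (simp add: mult_nonneg_nonneg)
        have "P * \<rho> * w (c + 1) \<sigma> * k1 * (8 * c * \<sigma> - 2 * n * (1 + \<sigma>))
            \<le> P * \<rho> * w (c + 1) \<sigma> * k1 * (8 * c * (1 + \<sigma>))"
          using \<rho> P wp[of "c + 1"] k n \<sigma> c by (intro mult_left_mono) (auto simp: algebra_simps intro!: add_increasing2 mult_nonneg_nonneg)
        also have "\<dots> = P * \<rho> * w c \<sigma> * k1 * (8 * c)" unfolding w1[of c] by simp
        also have "\<dots> \<le> P * \<rho> * w c \<sigma> * k2 * (8 * c)"
          using \<rho> P wp[of c] k c by (intro mult_right_mono mult_left_mono) auto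
        finally show "P * \<rho> * w (c + 1) \<sigma> * k1 * (8 * c * \<sigma> - 2 * n * (1 + \<sigma>)) \<le> P * \<rho> * w c \<sigma> * k2 * (8 * c)" .
        \<comment> \<open>On the support of the cutoff \<open>\<sigma> * \<rho> \<le> 1\<close>, so
          the factor \<sigma> in front of the second derivative is paid for by the second factor
          \<rho>.\<close>
        have "\<sigma> * \<rho> * k2 \<le> k2"
        proof (cases "\<sigma> \<le> R\<^sup>2")
          case True
          hence "\<sigma> * \<rho> \<le> 1" using R by (simp add: \<rho>_def divide_le_eq_1_pos)
          thus ?thesis using k mult_right_mono[of "\<sigma> * \<rho>" 1 k2] by simp
        next
          case False
          hence "k2 = 0" using R p by (simp add: k2_def cutoff_def max_def field_simps)
          thus ?thesis by simp
        qed
        thus "4 * P * (P - 1) * \<rho> * w c \<sigma> * (\<sigma> * \<rho> * k2) \<le> 4 * P * (P - 1) * \<rho> * w c \<sigma> * k2"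
          using \<rho> P wp[of c] by (intro mult_left_mono) auto
      qed
      also have "\<dots> \<le> (8 * c * P + 4 * P\<^sup>2) * \<rho> * (w c \<sigma> * k2)"
      proof -
        have "0 \<le> P * \<rho> * (w c \<sigma> * k2)" using \<rho> P wp[of c] k by (intro mult_nonneg_nonneg) auto
        thus ?thesis by (simp add: algebra_simps power2_eq_square)
      qed
      finally show ?thesis by (simp add: P_def \<rho>_def w_def \<sigma>_def k2_def weight_def)
    qed
  qed
qed

text \<open>Dyadic shells: for \<open>b = 2 ^ J\<close> and \<open>b < norm x \<le> 2 * b\<close>
  the weight is at most \<open>b powr (- 2 * c)\<close>, and the volume is of order
  \<open>b ^ DIM('a)\<close>. As \<open>DIM('a) - 2 * c = 2\<close>, the shell contributes order
  \<open>4 ^ J\<close>, and these contributions sum geometrically.\<close>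

lemma weight_integral_bound:
  defines "c \<equiv> (real DIM('a::euclidean_space) - 2) / 2"
  assumes dim: "3 \<le> DIM('a::euclidean_space)"
  obtains C where "0 < C" "\<And>J. integral\<^sup>L lborel (\<lambda>x::'a::euclidean_space. indicator (cball 0 (2 ^ J)) x * weight c x) \<le> C * 4 ^ J"
proof -
  define I where "I J = integral\<^sup>L lborel (\<lambda>x::'a. indicator (cball 0 (2 ^ J)) x * weight c x)" for J :: nat
  define v where "v = unit_ball_vol (real DIM('a)) * 2 ^ DIM('a)"
  define C where "C = max (I 0) v + 1"
  have int: "integrable lborel (\<lambda>x::'a. indicator (cball 0 r) x * weight c x)" for r
    using borel_integrable_compact[OF compact_cball continuous_on_weight[of "cball 0 r"]] by simp
  have step: "I (Suc J) \<le> I J + v * 4 ^ J" for J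
  proof -
    define b :: real where "b = 2 ^ J"
    have b: "0 < b" by (simp add: b_def)
    define k where "k = b powr (- 2 * c)"
    have ind: "integrable lborel (indicator (cball 0 (2 * b)) :: 'a \<Rightarrow> real)"
      using emeasure_bounded_finite[OF bounded_cball, of "0::'a" "2 * b"]
      by (intro integrable_real_indicator) auto
    have "I (Suc J) \<le> integral\<^sup>L lborel (\<lambda>x::'a. indicator (cball 0 b) x * weight c x + k * indicator (cball 0 (2 * b)) x)"
      unfolding I_def
    proof (rule integral_mono)
      show "indicator (cball 0 (2 ^ Suc J)) x * weight c x
         \<le> indicator (cball 0 b) x * weight c x + k * indicator (cball 0 (2 * b)) x" for x :: 'a
      proof -
        have "weight c x \<le> k" if "b < norm x"
        proof -
          have "b\<^sup>2 \<le> (norm x)\<^sup>2" using that b by (intro power_mono) auto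
          also have "\<dots> \<le> 1 + x \<bullet> x" by (simp add: dot_square_norm)
          finally have "weight c x \<le> (b\<^sup>2) powr (- c)"
            unfolding weight_def using b dim
            by (intro powr_mono2') (auto simp: c_def)
          also have "(b\<^sup>2) powr (- c) = (b powr 2) powr (- c)" using b by simp
          also have "\<dots> = k" by (simp only: powr_powr k_def mult_minus_right mult_minus_left)
          finally show ?thesis .
        qed
        moreover have "0 \<le> k" by (simp add: k_def)
        ultimately show ?thesis using weight_pos[of c x] by (auto simp: indicator_def b_def not_le)
      qed
    qed (use int ind in auto)
    also have "\<dots> = I J + k * measure lborel (cball (0::'a) (2 * b))"
      using int ind by (simp add: I_def b_def)
    also have "measure lborel (cball (0::'a) (2 * b)) = v * b ^ DIM('a)"
      using content_cball[of "2 * b" "0::'a"] b by (simp add: v_def power_mult_distrib)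
    also have "k * (v * b ^ DIM('a)) = v * 4 ^ J"
    proof -
      have "k * b ^ DIM('a) = b powr (- 2 * c + real DIM('a))"
        by (simp only: k_def powr_add powr_realpow[OF b])
      also have "- 2 * c + real DIM('a) = 2" by (simp add: c_def field_simps)
      finally have "k * b ^ DIM('a) = b\<^sup>2" using b by simp
      also have "b\<^sup>2 = 4 ^ J" by (simp add: b_def power2_eq_square flip: power_mult_distrib)
      finally show ?thesis by (simp add: mult.left_commute)
    qed
    finally show ?thesis .
  qed
  have v0: "0 \<le> v" by (simp add: v_def)
  hence C: "0 < C" "v \<le> C" "I 0 \<le> C" by (auto simp: C_def)
  have "I J \<le> C * 4 ^ J" for J
  proof (induction J)
    case (Suc J)
    have "v * 4 ^ J \<le> C * 4 ^ J" by (rule mult_right_mono[OF C(2)]) simp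
    hence "I (Suc J) \<le> C * 4 ^ J + C * 4 ^ J" using step[of J] Suc by linarith
    also have "\<dots> \<le> C * 4 ^ Suc J" using C(1) by simp
    finally show ?case .
  qed (use C in simp)
  thus ?thesis using that C(1) by (simp add: I_def)
qed

text \<open>The two regimes meet where \<open>e powr m = \<theta> * e\<close>, that is at
  \<open>e = \<theta> powr (- 1 / (1 - m))\<close>; above it the first summand alone suffices, below
  it the second.\<close>

lemma young_powr:
  fixes e m \<theta> :: real
  assumes "0 < m" "m < 1" "0 \<le> e" "0 < \<theta>"
  shows "e powr m \<le> \<theta> * e + \<theta> powr (- m / (1 - m))"
proof (cases "\<theta> powr (- 1 / (1 - m)) \<le> e")
  case True
  have "0 < \<theta> powr (- 1 / (1 - m))" using assms by simp
  hence e: "0 < e" using True by linarith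
  have "e powr (m - 1) \<le> (\<theta> powr (- 1 / (1 - m))) powr (m - 1)"
    using True assms \<open>0 < \<theta> powr _\<close> by (intro powr_mono2') auto
  also have "\<dots> = \<theta> powr (- 1 / (1 - m) * (m - 1))" by (simp only: powr_powr)
  also have "- 1 / (1 - m) * (m - 1) = 1" using assms by (simp add: divide_simps)
  also have "\<theta> powr 1 = \<theta>" using assms by simp
  finally have "e * e powr (m - 1) \<le> e * \<theta>" using e by simp
  hence "e powr m \<le> \<theta> * e" using e by (simp add: powr_mult_base mult.commute)
  thus ?thesis by (simp add: add_increasing2)
next
  case False
  hence "e powr m \<le> (\<theta> powr (- 1 / (1 - m))) powr m"
    using assms by (intro powr_mono2) auto
  also have "\<dots> = \<theta> powr (- m / (1 - m))" using assms by (simp add: powr_powr field_simps)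
  finally show ?thesis using assms by (simp add: add_increasing)
qed

text \<open>Split \<open>u - V\<close> at time \<open>t\<close> into \<open>u - u0\<close>, the
  difference of \<open>u0\<close> and \<open>V\<close> at time 0, which is nonpositive, and the
  change of \<open>V\<close> since time 0, which is uniformly small on a compact ball. The first
  part tends to 0 in mean by assumption.\<close>

lemma integral_positive_part_tendsto_0:
  fixes u V :: "'a::euclidean_space \<Rightarrow> real \<Rightarrow> real" and \<Psi> :: "'a \<Rightarrow> real"
  assumes T: "0 < T" and ucont: "\<And>t. 0 < t \<Longrightarrow> t < T \<Longrightarrow> continuous_on UNIV (\<lambda>x. u x t)"
    and V: "continuous_on (UNIV \<times> {..<T}) (\<lambda>(x, t). V x t)"
    and u0: "L1_loc u0" "AE x in lebesgue. u0 x \<le> V x 0"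
    and lim: "\<And>K. compact K \<Longrightarrow> ((\<lambda>t. LINT x:K|lebesgue. \<bar>u x t - u0 x\<bar>) \<longlongrightarrow> 0) (at_right 0)"
    and \<Psi>: "continuous_on UNIV \<Psi>" "\<And>x. 0 \<le> \<Psi> x" "\<And>x. \<Psi> x \<le> 1" "\<And>x. R < norm x \<Longrightarrow> \<Psi> x = 0"
  shows "((\<lambda>t. integral\<^sup>L lborel (\<lambda>x. max 0 (u x t - V x t) * \<Psi> x)) \<longlongrightarrow> 0) (at_right 0)"
proof (rule tendstoI)
  fix \<epsilon> :: real assume \<epsilon>: "0 < \<epsilon>"
  define K where "K = cball (0::'a) R"
  define \<mu> where "\<mu> = measure lborel K"
  \<comment> \<open>Half of \<epsilon> is left for the integral of \<open>u - u0\<close>; the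
    summand 1 avoids dividing by a null volume.\<close>
  define \<eta> where "\<eta> = \<epsilon> / (2 * (\<mu> + 1))"
  have \<mu>: "0 \<le> \<mu>" by (simp add: \<mu>_def)
  have \<eta>: "0 < \<eta>" "\<eta> * \<mu> \<le> \<epsilon> / 2"
    using \<epsilon> \<mu> by (auto simp: \<eta>_def field_simps)
  have K: "compact K" by (simp add: K_def)
  have KL: "K \<in> sets lebesgue" using K by (simp add: lmeasurable_compact fmeasurableD)
  have "compact (K \<times> {0..T/2})" using K by (intro compact_Times) auto
  moreover have "continuous_on (K \<times> {0..T/2}) (\<lambda>(x, t). V x t)"
    using V by (rule continuous_on_subset) (use T in auto)
  ultimately have "uniformly_continuous_on (K \<times> {0..T/2}) (\<lambda>(x, t). V x t)"
    by (rule compact_uniformly_continuous[rotated])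
  then obtain d where d: "0 < d" "\<And>z z'. z \<in> K \<times> {0..T/2} \<Longrightarrow> z' \<in> K \<times> {0..T/2} \<Longrightarrow> dist z' z < d
      \<Longrightarrow> dist ((\<lambda>(x, t). V x t) z') ((\<lambda>(x, t). V x t) z) < \<eta>"
    using \<eta>(1) unfolding uniformly_continuous_on_def by metis
  have near: "\<bar>V x t - V x 0\<bar> < \<eta>" if "x \<in> K" "0 < t" "t < d" "t < T/2" for x t
    using d(2)[of "(x, 0)" "(x, t)"] that T by (simp add: dist_Pair_Pair dist_real_def)
  have "\<forall>\<^sub>F t in at_right 0. (LINT x:K|lebesgue. \<bar>u x t - u0 x\<bar>) < \<epsilon> / 2"
    using lim[OF K] \<epsilon> by (intro order_tendstoD) auto
  moreover have "\<forall>\<^sub>F t in at_right 0. t \<in> {0<..<min d (T/2)}"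
    by (rule eventually_at_right_real) (use d T in auto)
  ultimately show "\<forall>\<^sub>F t in at_right 0. dist (integral\<^sup>L lborel (\<lambda>x. max 0 (u x t - V x t) * \<Psi> x)) 0 < \<epsilon>"
  proof eventually_elim
    case (elim t)
    hence t: "0 < t" "t < d" "t < T / 2" "t < T" by auto
    define F where "F x = max 0 (u x t - V x t) * \<Psi> x" for x
    have cu: "continuous_on UNIV (\<lambda>x. u x t)" by (rule ucont[OF t(1,4)])
    have cV: "continuous_on UNIV (\<lambda>x. V x t)"
    proof -
      have "range (\<lambda>x. (x, t)) \<subseteq> UNIV \<times> {..<T}" using t by auto
      from continuous_on_compose2[OF V continuous_on_Pair[OF continuous_on_id continuous_on_const] this]
      show ?thesis by simp
    qed
    have cF: "continuous_on UNIV F" unfolding F_def by (intro continuous_intros cu cV \<Psi>(1))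
    have F0: "0 \<le> F x" for x by (simp add: F_def \<Psi>)
    have intF: "integrable lborel F"
      by (rule integrable_continuous_compact_support[OF cF, of R]) (simp add: F_def \<Psi>(4))
    have FL: "integrable lebesgue F" "integral\<^sup>L lebesgue F = integral\<^sup>L lborel F"
      using intF borel_measurable_continuous_onI[OF cF]
      by (simp_all add: integrable_completion integral_completion)
    have intu: "set_integrable lebesgue K (\<lambda>x. u x t - u0 x)"
    proof (rule set_integral_diff)
      show "set_integrable lebesgue K u0" using u0(1) K by (simp add: L1_loc_def)
      have "integrable lborel (\<lambda>x. indicator K x *\<^sub>R u x t)"
        by (rule borel_integrable_compact[OF K]) (rule continuous_on_subset[OF cu subset_UNIV])
      thus "set_integrable lebesgue K (\<lambda>x. u x t)"
        unfolding set_integrable_def by (simp add: integrable_completion borel_measurable_integrable)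
    qed
    have intabs: "integrable lebesgue (\<lambda>x. indicator K x * \<bar>u x t - u0 x\<bar>)"
      using set_integrable_abs[OF intu] by (simp add: set_integrable_def)
    have ind: "integrable lebesgue (indicator K :: 'a \<Rightarrow> real)"
      using lmeasurable_compact[OF K] by (simp add: lmeasurable_iff_integrable)
    have "integral\<^sup>L lebesgue F \<le> integral\<^sup>L lebesgue (\<lambda>x. indicator K x * \<bar>u x t - u0 x\<bar> + \<eta> * indicator K x)"
    proof (rule integral_mono_AE)
      show "AE x in lebesgue. F x \<le> indicator K x * \<bar>u x t - u0 x\<bar> + \<eta> * indicator K x"
        using u0(2)
      proof eventually_elim
        case (elim x)
        show ?case
        proof (cases "x \<in> K")
          case True
          have "max 0 (u x t - V x t) \<le> \<bar>u x t - u0 x\<bar> + \<eta>"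
            using near[OF True t(1-3)] elim by linarith
          moreover have "F x \<le> max 0 (u x t - V x t)"
            unfolding F_def using \<Psi>(2,3)[of x] by (intro mult_left_le) auto
          ultimately have "F x \<le> \<bar>u x t - u0 x\<bar> + \<eta>" by (rule order_trans[rotated])
          thus ?thesis using True by simp
        next
          case False
          thus ?thesis using \<Psi>(4)[of x] by (simp add: F_def K_def)
        qed
      qed
    qed (use FL intabs ind in auto)
    also have "\<dots> = (LINT x:K|lebesgue. \<bar>u x t - u0 x\<bar>) + \<eta> * \<mu>"
      using intabs ind KL K
      by (simp add: set_lebesgue_integral_def \<mu>_def K_def)
    also have "\<dots> < \<epsilon>" using elim(1) \<eta>(2) by linarith
    finally have "integral\<^sup>L lborel F < \<epsilon>" using FL by simp
    moreover have "0 \<le> integral\<^sup>L lborel F" using F0 by simp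
    ultimately show ?case by (simp add: F_def[abs_def])
  qed
qed

text \<open>Young's inequality, applied pointwise, trades the sublinear \<open>e powr m\<close> for
  \<theta> times the weighted excess itself plus a constant; the constant part integrates to the
  weight over the ball.\<close>

lemma smooth_pos_test_bound:
  fixes X L e :: "'a::euclidean_space \<Rightarrow> real"
  assumes m: "0 < m" "m < 1" and P: "2 / (1 - m) \<le> real P" "3 \<le> P" and R: "1 \<le> R" and \<theta>: "0 < \<theta>"
    and X: "\<And>x. 0 \<le> X x" "\<And>x. X x \<le> e x powr m" "\<And>x. 0 \<le> e x"
    and A: "0 \<le> A" "\<And>x. L x \<le> A / R\<^sup>2 * (weight c x * cutoff R (P - 2) (x \<bullet> x))"
    and cont: "continuous_on UNIV X" "continuous_on UNIV L" "continuous_on UNIV e"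
    and supp: "\<And>x. R < norm x \<Longrightarrow> L x = 0"
    and W: "integral\<^sup>L lborel (\<lambda>x::'a. indicator (cball 0 R) x * weight c x) \<le> W"
  shows "integral\<^sup>L lborel (\<lambda>x. X x * L x)
    \<le> A / R\<^sup>2 * (\<theta> * integral\<^sup>L lborel (\<lambda>x. e x * test_fun c R P x) + \<theta> powr (- m / (1 - m)) * W)"
proof -
  define k where "k = \<theta> powr (- m / (1 - m))"
  have k: "0 \<le> k" by (simp add: k_def)
  have ct: "continuous_on UNIV (test_fun c R P :: 'a \<Rightarrow> real)"
    by (rule continuous_on_test_fun)
  have i1: "integrable lborel (\<lambda>x. X x * L x)"
    by (rule integrable_continuous_compact_support[of _ R]) (auto intro!: continuous_intros cont simp: supp)
  have tf0: "test_fun c R P x = 0" if "R < norm x" for x :: 'a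
    using cutoff_eq_0[of R x P] R P that by (simp add: test_fun_def)
  have i2: "integrable lborel (\<lambda>x. e x * test_fun c R P x)"
    by (rule integrable_continuous_compact_support[of _ R]) (auto intro!: continuous_intros cont ct simp: tf0)
  have i3: "integrable lborel (\<lambda>x::'a. indicator (cball 0 R) x * weight c x)"
    using borel_integrable_compact[OF compact_cball continuous_on_weight[of "cball 0 R" c]] by simp
  have "integral\<^sup>L lborel (\<lambda>x. X x * L x)
     \<le> integral\<^sup>L lborel (\<lambda>x. A / R\<^sup>2 * (\<theta> * (e x * test_fun c R P x) + k * (indicator (cball 0 R) x * weight c x)))"
  proof (rule integral_mono[OF i1])
    fix x :: 'a
    define \<zeta> where "\<zeta> = max 0 (1 - x \<bullet> x / R\<^sup>2)"
    have cut: "cutoff R q (x \<bullet> x) = \<zeta> ^ q" for q by (simp add: cutoff_def \<zeta>_def)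
    have \<zeta>01: "0 \<le> \<zeta>" "\<zeta> \<le> 1" by (auto simp: \<zeta>_def)
    have wp: "0 < weight c x" by (rule weight_pos)
    show "X x * L x \<le> A / R\<^sup>2 * (\<theta> * (e x * test_fun c R P x) + k * (indicator (cball 0 R) x * weight c x))"
    proof (cases "norm x \<le> R")
      case False
      thus ?thesis using supp[of x] A(1) k cutoff_eq_0[of R x P] R P by (simp add: test_fun_def)
    next
      case True
      have young: "e x powr m * \<zeta> ^ (P - 2) \<le> \<theta> * (e x * \<zeta> ^ P) + k"
      proof (cases "\<zeta> = 0")
        case True
        thus ?thesis using P k X(3)[of x] \<theta> by (simp add: zero_power)
      next
        case False
        hence \<zeta>: "0 < \<zeta>" using \<zeta>01 by simp
        have lt1: "(\<zeta>\<^sup>2) powr (- m / (1 - m)) * \<zeta> ^ (P - 2) \<le> 1"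
        proof -
          have "(\<zeta>\<^sup>2) powr (- m / (1 - m)) * \<zeta> ^ (P - 2) = (\<zeta> powr 2) powr (- m / (1 - m)) * \<zeta> powr real (P - 2)"
            using \<zeta> by (simp add: powr_realpow)
          also have "\<dots> = \<zeta> powr (2 * (- m / (1 - m)) + real (P - 2))"
            by (simp only: powr_powr powr_add)
          also have "\<dots> \<le> 1"
          proof (rule powr_le1)
            have "2 * (- m / (1 - m)) = 2 - 2 / (1 - m)" using m by (simp add: field_simps)
            thus "0 \<le> 2 * (- m / (1 - m)) + real (P - 2)" using P by (simp add: of_nat_diff)
          qed (use \<zeta>01 in auto)
          finally show ?thesis .
        qed
        \<comment> \<open>The parameter \<open>\<theta> * \<zeta>^2\<close> restores the two lost
          powers of the cutoff. The price is a negative power of \<zeta>, compensated in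
          \<open>lt1\<close> because \<open>2 / (1 - m) \<le> P\<close>.\<close>
        have "e x powr m \<le> (\<theta> * \<zeta>\<^sup>2) * e x + (\<theta> * \<zeta>\<^sup>2) powr (- m / (1 - m))"
          by (rule young_powr) (use m X(3) \<theta> \<zeta> in auto)
        hence "e x powr m * \<zeta> ^ (P - 2)
            \<le> ((\<theta> * \<zeta>\<^sup>2) * e x + (\<theta> * \<zeta>\<^sup>2) powr (- m / (1 - m))) * \<zeta> ^ (P - 2)"
          using \<zeta> by (intro mult_right_mono) auto
        also have "\<dots> = \<theta> * (e x * (\<zeta>\<^sup>2 * \<zeta> ^ (P - 2))) + k * ((\<zeta>\<^sup>2) powr (- m / (1 - m)) * \<zeta> ^ (P - 2))"
          using \<theta> \<zeta> by (simp add: powr_mult k_def algebra_simps)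
        also have "\<zeta>\<^sup>2 * \<zeta> ^ (P - 2) = \<zeta> ^ (2 + (P - 2))" by (simp only: power_add)
        also have "2 + (P - 2) = P" using P by simp
        also have "\<theta> * (e x * \<zeta> ^ P) + k * ((\<zeta>\<^sup>2) powr (- m / (1 - m)) * \<zeta> ^ (P - 2))
            \<le> \<theta> * (e x * \<zeta> ^ P) + k * 1"
          using lt1 k by (intro add_left_mono mult_left_mono)
        finally show ?thesis by simp
      qed
      have "X x * L x \<le> X x * (A / R\<^sup>2 * (weight c x * \<zeta> ^ (P - 2)))"
        using A(2)[of x] X(1)[of x] by (intro mult_left_mono) (auto simp: cut)
      also have "\<dots> \<le> e x powr m * (A / R\<^sup>2 * (weight c x * \<zeta> ^ (P - 2)))"
        using X(2)[of x] A(1) wp \<zeta>01 by (intro mult_right_mono) auto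
      also have "\<dots> = A / R\<^sup>2 * weight c x * (e x powr m * \<zeta> ^ (P - 2))" by simp
      also have "\<dots> \<le> A / R\<^sup>2 * weight c x * (\<theta> * (e x * \<zeta> ^ P) + k)"
        using young A(1) wp by (intro mult_left_mono) auto
      also have "\<dots> = A / R\<^sup>2 * (\<theta> * (e x * test_fun c R P x) + k * (indicator (cball 0 R) x * weight c x))"
        using True by (simp add: test_fun_def cut algebra_simps add_divide_distrib)
      finally show ?thesis .
    qed
  qed (use i2 i3 in auto)
  also have "\<dots> = A / R\<^sup>2 * (\<theta> * integral\<^sup>L lborel (\<lambda>x. e x * test_fun c R P x)
      + k * integral\<^sup>L lborel (\<lambda>x::'a. indicator (cball 0 R) x * weight c x))"
    using i2 i3 by simp
  also have "\<dots> \<le> A / R\<^sup>2 * (\<theta> * integral\<^sup>L lborel (\<lambda>x. e x * test_fun c R P x) + k * W)"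
    using W A(1) k by (intro mult_left_mono add_left_mono) auto
  finally show ?thesis by (simp add: k_def)
qed

text \<open>Subadditivity of the concave power, normalized by \<open>a = y / x\<close> in the unit
  interval, where a number is at most its \<open>m\<close>-th power.\<close>

lemma powr_diff_le:
  fixes x y m :: real
  assumes "0 < m" "m < 1" "0 < y" "0 < x"
  shows "max 0 (x powr m - y powr m) \<le> (max 0 (x - y)) powr m"
proof (cases "y < x")
  case False
  hence "x powr m \<le> y powr m" using assms by (intro powr_mono2) auto
  thus ?thesis by simp
next
  case True
  define a where "a = y / x"
  have a: "0 < a" "a < 1" using True assms by (auto simp: a_def)
  have "a \<le> a powr m" "1 - a \<le> (1 - a) powr m"
    using a assms powr_mono'[of m 1 a] powr_mono'[of m 1 "1 - a"] by auto
  hence "1 - a powr m \<le> (1 - a) powr m" by linarith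
  hence "x powr m * (1 - a powr m) \<le> x powr m * (1 - a) powr m" by (rule mult_left_mono) simp
  moreover have "x powr m * a powr m = (x * a) powr m" "x powr m * (1 - a) powr m = (x * (1 - a)) powr m"
    using assms a by (simp_all add: powr_mult)
  moreover have "x * a = y" "x * (1 - a) = x - y" using assms by (simp_all add: a_def algebra_simps)
  ultimately have "x powr m - y powr m \<le> (x - y) powr m" by (simp add: algebra_simps)
  thus ?thesis using True by simp
qed

lemma power4_powr_LIMSEQ:
  fixes K b s :: real
  assumes "0 < b" "0 < s"
  shows "(\<lambda>J. K * (4 ^ J / b) powr (- s)) \<longlonglongrightarrow> 0"
proof -
  have "4 powr (- s) < (4::real) powr 0" using assms by (intro powr_less_mono) auto
  hence "(\<lambda>J. ((4::real) powr (- s)) ^ J) \<longlonglongrightarrow> 0" by (intro LIMSEQ_realpow_zero) auto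
  hence "(\<lambda>J. (K * b powr s) * ((4::real) powr (- s)) ^ J) \<longlonglongrightarrow> 0" by (rule tendsto_mult_right_zero)
  moreover have eq: "K * (4 ^ J / b) powr (- s) = (K * b powr s) * ((4::real) powr (- s)) ^ J" for J
  proof -
    have "((4::real) ^ J) powr (- s) = (4 powr real J) powr (- s)" by (simp add: powr_realpow)
    also have "\<dots> = (4 powr (- s)) powr real J" by (simp only: powr_powr mult.commute)
    also have "\<dots> = (4 powr (- s)) ^ J" by (simp add: powr_realpow)
    finally show ?thesis using assms by (simp add: powr_divide powr_minus field_simps)
  qed
  ultimately show ?thesis by (simp only: eq)
qed

lemma test_fun_bounds:
  assumes "0 \<le> c"
  shows "0 \<le> test_fun c R P x" "test_fun c R P x \<le> 1"
proof -
  have w: "0 < weight c x" by (rule weight_pos)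
  have "weight c x \<le> (1 + x \<bullet> x) powr 0"
    unfolding weight_def using assms by (intro powr_mono) auto
  also have "(1 + x \<bullet> x) powr 0 \<le> 1" by simp
  finally have "weight c x \<le> 1" .
  thus "test_fun c R P x \<le> 1"
    unfolding test_fun_def using w cutoff_bounds(1)[of R P "x \<bullet> x"] cutoff_bounds(2)[of "x \<bullet> x" R P] by (intro mult_le_one) auto
  show "0 \<le> test_fun c R P x" using w cutoff_bounds(1)[of R P] by (simp add: test_fun_def)
qed

text \<open>The bound does not depend on \<open>R\<close>, so an excess of \<open>u\<close> over
  \<open>V\<close> near one point stays visible as \<open>R\<close> grows.\<close>

lemma test_fun_lower:
  fixes x :: "'a::euclidean_space"
  assumes "0 \<le> c" "norm x \<le> r" "2 * r \<le> R" "0 < R"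
  shows "(1 + r\<^sup>2) powr (- c) * (3 / 4) ^ P \<le> test_fun c R P x"
  unfolding test_fun_def
proof (rule mult_mono)
  have r: "x \<bullet> x \<le> r\<^sup>2" using assms(2) power_mono[of "norm x" r 2] by (simp add: dot_square_norm)
  show "(1 + r\<^sup>2) powr (- c) \<le> weight c x"
    unfolding weight_def
  proof (rule powr_mono2')
    show "0 < 1 + x \<bullet> x" by (smt (verit) inner_ge_zero)
  qed (use r assms in auto)
  have "0 \<le> r" using assms(2) norm_ge_zero order_trans by blast
  hence "(2 * r)\<^sup>2 \<le> R\<^sup>2" using assms(3) by (intro power_mono) auto
  hence "4 * (x \<bullet> x) \<le> R\<^sup>2" using r by (simp add: power_mult_distrib)
  hence "3 / 4 \<le> 1 - x \<bullet> x / R\<^sup>2" using assms by (simp add: field_simps)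
  hence "3 / 4 \<le> max 0 (1 - x \<bullet> x / R\<^sup>2)" by linarith
  thus "(3 / 4) ^ P \<le> cutoff R P (x \<bullet> x)" unfolding cutoff_def by (rule power_mono) simp
qed (use less_imp_le[OF weight_pos] in auto)

text \<open>A local mass estimate of Herrero-Pierre type. Let \<open>M\<close> be the supremum over
  \<open>{0<..t0}\<close> of the excess integrated against the test function. The inequalities of
  Kato and Young bound \<open>M\<close> by \<open>M / 2\<close> plus a term of order
  \<open>R powr (- 2 * m / (1 - m))\<close>, and \<open>M / 2\<close> is absorbed.\<close>

lemma fde_positive_part_decay:
  fixes u V :: "'a::euclidean_space \<Rightarrow> real \<Rightarrow> real"
  assumes dim: "3 \<le> DIM('a)" and m: "0 < m" "m < 1"
    and u: "fde_solution m T u" and V: "fde_solution m T V"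
    and Vc: "continuous_on (UNIV \<times> {..<T}) (\<lambda>(x, t). V x t)"
    and u0: "L1_loc u0" "AE x in lebesgue. u0 x \<le> V x 0"
    and lim: "\<And>K. compact K \<Longrightarrow> ((\<lambda>t. LINT x:K|lebesgue. \<bar>u x t - u0 x\<bar>) \<longlongrightarrow> 0) (at_right 0)"
    and t0: "0 < t0" "t0 < T" and P: "2 / (1 - m) \<le> real P" "3 \<le> P"
    and c: "c = (real DIM('a) - 2) / 2" and A: "A = 8 * c * P + 4 * P\<^sup>2"
    and C: "0 < C" "\<And>J. integral\<^sup>L lborel (\<lambda>x::'a. indicator (cball 0 (2 ^ J)) x * weight c x) \<le> C * 4 ^ J"
  shows "integral\<^sup>L lborel (\<lambda>x. max 0 (u x t0 - V x t0) * test_fun c (2 ^ J) P x)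
    \<le> 2 * A * C * t0 * (4 ^ J / (2 * A * t0)) powr (- (m / (1 - m)))"
proof -
  define R :: real where "R = 2 ^ J"
  have R: "1 \<le> R" "R\<^sup>2 = 4 ^ J" by (auto simp: R_def power2_eq_square simp flip: power_mult_distrib)
  have c0: "0 \<le> c" using dim by (simp add: c)
  have A0: "0 < A" using P c0 by (simp add: A add_nonneg_pos)
  obtain \<Psi>1 \<Psi>2 :: "'a \<Rightarrow> 'a \<Rightarrow> real" where \<Psi>:
    "\<And>i x. i \<in> Basis \<Longrightarrow> has_pd i (test_fun c R P) x (\<Psi>1 i x)"
    "\<And>i x. i \<in> Basis \<Longrightarrow> has_pd i (\<Psi>1 i) x (\<Psi>2 i x)"
    "continuous_on UNIV (test_fun c R P :: 'a \<Rightarrow> real)"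
    "\<And>i. i \<in> Basis \<Longrightarrow> continuous_on UNIV (\<Psi>1 i)"
    "\<And>i. i \<in> Basis \<Longrightarrow> continuous_on UNIV (\<Psi>2 i)"
    "\<And>i x. i \<in> Basis \<Longrightarrow> R < norm x \<Longrightarrow> \<Psi>1 i x = 0"
    "\<And>i x. i \<in> Basis \<Longrightarrow> R < norm x \<Longrightarrow> \<Psi>2 i x = 0"
    "\<And>x. (\<Sum>i\<in>Basis. \<Psi>2 i x) \<le> A / R\<^sup>2 * (weight c x * cutoff R (P - 2) (x \<bullet> x))"
    using test_fun_laplacian[OF R(1) P(2) dim] unfolding c[symmetric] A by blast
  have tf0: "test_fun c R P x = 0" if "R < norm x" for x :: 'a
    using cutoff_eq_0[of R x P] R P that by (simp add: test_fun_def)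
  note tf = test_fun_bounds[OF c0, of R P]
  define e where "e x t = max 0 (u x t - V x t)" for x t
  define g where "g t = integral\<^sup>L lborel (\<lambda>x. e x t * test_fun c R P x)" for t
  have cu: "continuous_on UNIV (\<lambda>x. u x t)" and cV: "continuous_on UNIV (\<lambda>x. V x t)" if "0 < t" "t < T" for t
    using fde_solutionD(4)[OF u that] fde_solutionD(4)[OF V that] by (auto simp: C2_def)
  have ce: "continuous_on UNIV (\<lambda>x. e x t)" if "0 < t" "t < T" for t
    unfolding e_def using that by (intro continuous_intros cu cV)
  have int: "integrable lborel (\<lambda>x. e x t * test_fun c R P x)" if "0 < t" "t < T" for t
    by (rule integrable_continuous_compact_support[of _ R])
       (auto intro!: continuous_intros ce that \<Psi>(3) simp: tf0)
  have g0: "0 \<le> g t" for t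
    unfolding g_def using tf(1) by (intro integral_nonneg_AE AE_I2 mult_nonneg_nonneg) (auto simp: e_def)
  have glim: "(g \<longlongrightarrow> 0) (at_right 0)"
    unfolding g_def[abs_def] e_def
    by (rule integral_positive_part_tendsto_0[OF _ cu Vc u0 lim \<Psi>(3) tf tf0]) (use t0 in auto)
  \<comment> \<open>Absorbing \<open>M / 2\<close> requires \<open>M\<close> to be finite: near time
    0 this follows from the limit, away from it from compactness.\<close>
  have "bdd_above (g ` {0<..t0})"
  proof -
    have "\<forall>\<^sub>F t in at_right 0. g t < 1" using glim by (rule order_tendstoD) simp
    then obtain s where s: "0 < s" "\<And>t. 0 < t \<Longrightarrow> t < s \<Longrightarrow> g t < 1"
      unfolding eventually_at_right_field by auto
    define s' where "s' = min s t0 / 2"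
    have s': "0 < s'" "s' < s" "s' < t0" using s t0 by (auto simp: s'_def min_def)
    have Q: "cball (0::'a) R \<times> {s'..t0} \<subseteq> UNIV \<times> {0<..<T}" using s' t0 by auto
    have "continuous_on (cball 0 R \<times> {s'..t0}) (\<lambda>z. e (fst z) (snd z))"
      unfolding e_def using fde_solution_continuous(1)[OF u Q] fde_solution_continuous(1)[OF V Q]
      by (intro continuous_intros) (auto simp: case_prod_unfold)
    hence "bdd_above ((\<lambda>z. e (fst z) (snd z)) ` (cball 0 R \<times> {s'..t0}))"
      by (intro bounded_imp_bdd_above compact_imp_bounded compact_continuous_image compact_Times) auto
    then obtain B where B: "\<And>x t. norm x \<le> R \<Longrightarrow> s' \<le> t \<Longrightarrow> t \<le> t0 \<Longrightarrow> e x t \<le> B"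
      unfolding bdd_above_def by force
    have inttf: "integrable lborel (test_fun c R P :: 'a \<Rightarrow> real)"
      by (rule integrable_continuous_compact_support[OF \<Psi>(3) tf0])
    have "g t \<le> max 1 (B * integral\<^sup>L lborel (test_fun c R P :: 'a \<Rightarrow> real))" if t: "0 < t" "t \<le> t0" for t
    proof (cases "t < s")
      case True
      thus ?thesis using s(2)[of t] t by (simp add: max_def)
    next
      case False
      have "g t \<le> integral\<^sup>L lborel (\<lambda>x::'a. B * test_fun c R P x)"
        unfolding g_def
      proof (rule integral_mono)
        show "e x t * test_fun c R P x \<le> B * test_fun c R P x" for x
          using B[of x t] tf0[of x] tf(1)[of x] False s' t
          by (cases "norm x \<le> R") (auto intro: mult_right_mono)
      qed (use int[of t] inttf t t0 in auto)
      thus ?thesis by simp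
    qed
    thus ?thesis by (intro bdd_aboveI2) auto
  qed
  define M where "M = (SUP t\<in>{0<..t0}. g t)"
  have gM: "g t \<le> M" if "0 < t" "t \<le> t0" for t
    unfolding M_def by (rule cSUP_upper) (use that \<open>bdd_above _\<close> in auto)
  have M0: "0 \<le> M" using gM[of t0] g0[of t0] t0 by simp
  \<comment> \<open>Chosen so that \<open>A / R^2 * \<theta> * t0 = 1 / 2\<close>, the factor with
    which \<open>M\<close> reappears on the right.\<close>
  define \<theta> where "\<theta> = 4 ^ J / (2 * A * t0)"
  have \<theta>: "0 < \<theta>" using A0 t0 by (simp add: \<theta>_def)
  define k where "k = \<theta> powr (- m / (1 - m))"
  define \<kappa> where "\<kappa> = A / R\<^sup>2 * (\<theta> * M + k * (C * 4 ^ J))"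
  have \<kappa>0: "0 \<le> \<kappa>" using A0 \<theta> M0 C(1) by (simp add: \<kappa>_def k_def)
  have step: "g t2 \<le> g t1 + \<kappa> * (t2 - t1)" if t: "0 < t1" "t1 \<le> t2" "t2 \<le> t0" for t1 t2
    unfolding g_def e_def
  proof (rule kato_in_time[OF u V m \<Psi>(1-5) tf(1) tf0 \<Psi>(6,7) t(1,2)])
    show "t2 < T" using t t0 by simp
    fix t \<delta> :: real assume tt: "t1 \<le> t" "t \<le> t2" and \<delta>: "0 < \<delta>"
    have tT: "0 < t" "t < T" "t \<le> t0" using tt that t0 by auto
    have cs: "continuous_on UNIV (smooth_pos \<delta>)"
      using smooth_pos_deriv[OF \<delta>] by (intro continuous_at_imp_continuous_on ballI DERIV_isCont) auto
    have cX: "continuous_on UNIV (\<lambda>x. smooth_pos \<delta> (u x t powr m - V x t powr m))"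
      using fde_solutionD(1)[OF u tT(1,2)] fde_solutionD(1)[OF V tT(1,2)]
      by (intro continuous_on_compose2[OF cs] continuous_intros cu cV tT) (auto simp: less_imp_neq[THEN not_sym])
    have "integral\<^sup>L lborel (\<lambda>x. smooth_pos \<delta> (u x t powr m - V x t powr m) * (\<Sum>i\<in>Basis. \<Psi>2 i x))
      \<le> A / R\<^sup>2 * (\<theta> * integral\<^sup>L lborel (\<lambda>x. e x t * test_fun c R P x) + \<theta> powr (- m / (1 - m)) * (C * 4 ^ J))"
    proof (rule smooth_pos_test_bound[OF m P R(1) \<theta> _ _ _ less_imp_le[OF A0] \<Psi>(8) cX _ ce[OF tT(1,2)]])
      show "0 \<le> smooth_pos \<delta> (u x t powr m - V x t powr m)" for x by (rule smooth_pos_bounds[OF \<delta>])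
      show "smooth_pos \<delta> (u x t powr m - V x t powr m) \<le> e x t powr m" for x
        unfolding e_def
        by (rule order_trans[OF smooth_pos_bounds(2)[OF \<delta>]
              powr_diff_le[OF m fde_solutionD(1)[OF V tT(1,2)] fde_solutionD(1)[OF u tT(1,2)]]])
      show "0 \<le> e x t" for x by (simp add: e_def)
      show "continuous_on UNIV (\<lambda>x. \<Sum>i\<in>Basis. \<Psi>2 i x)" by (intro continuous_intros \<Psi>(5))
      show "(\<Sum>i\<in>Basis. \<Psi>2 i x) = 0" if "R < norm x" for x using \<Psi>(7)[OF _ that] by simp
      show "integral\<^sup>L lborel (\<lambda>x::'a. indicator (cball 0 R) x * weight c x) \<le> C * 4 ^ J"
        using C(2)[of J] by (simp add: R_def)
    qed
    also have "\<dots> \<le> \<kappa>"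
      unfolding \<kappa>_def k_def[symmetric] g_def[symmetric] using A0 \<theta> gM[OF tT(1,3)]
      by (intro mult_left_mono add_right_mono) auto
    finally show "integral\<^sup>L lborel (\<lambda>x. smooth_pos \<delta> (u x t powr m - V x t powr m) * (\<Sum>i\<in>Basis. \<Psi>2 i x)) \<le> \<kappa>" .
  qed
  have "g t \<le> \<kappa> * t0" if t: "0 < t" "t \<le> t0" for t
  proof -
    \<comment> \<open>The excess at the earlier time \<open>s\<close> tends to 0, so the estimate
      can be started from the initial trace.\<close>
    have "((\<lambda>s. g s + \<kappa> * t0) \<longlongrightarrow> 0 + \<kappa> * t0) (at_right 0)" by (intro tendsto_intros glim)
    moreover have "\<forall>\<^sub>F s in at_right 0. g t \<le> g s + \<kappa> * t0"
    proof -
      have "\<forall>\<^sub>F s in at_right 0. s \<in> {0<..<t}" by (rule eventually_at_right_real[OF t(1)])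
      thus ?thesis
      proof eventually_elim
        case (elim s)
        have "g t \<le> g s + \<kappa> * (t - s)" by (rule step) (use elim t in auto)
        moreover have "\<kappa> * (t - s) \<le> \<kappa> * t0" using \<kappa>0 elim t by (intro mult_left_mono) auto
        ultimately show ?case by linarith
      qed
    qed
    ultimately show ?thesis by (intro tendsto_lowerbound[of _ "\<kappa> * t0" "at_right 0"]) auto
  qed
  hence "M \<le> \<kappa> * t0"
    unfolding M_def using t0 by (intro cSUP_least) auto
  also have "\<kappa> * t0 = M / 2 + A * C * t0 * k"
    unfolding \<kappa>_def R(2) \<theta>_def using A0 t0 by (simp add: field_simps)
  finally have "M \<le> 2 * A * C * t0 * k" by simp
  moreover have "g t0 \<le> M" using gM t0 by simp
  ultimately show ?thesis by (simp add: g_def e_def R_def k_def \<theta>_def)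
qed

text \<open>Along \<open>R = 2 ^ J\<close> the bound of \<open>fde_positive_part_decay\<close> tends
  to 0, because the exponent \<open>- m / (1 - m)\<close> is negative. A point with
  \<open>V < u\<close> would keep the integral above a positive constant.\<close>

theorem comparison_from_initial_trace:
  fixes u V :: "'a::euclidean_space \<Rightarrow> real \<Rightarrow> real"
  assumes dim: "3 \<le> DIM('a)" and m: "0 < m" "m < 1"
    and u: "fde_solution m T u" and V: "fde_solution m T V"
    and Vc: "continuous_on (UNIV \<times> {..<T}) (\<lambda>(x, t). V x t)"
    and u0: "L1_loc u0" "AE x in lebesgue. u0 x \<le> V x 0"
    and lim: "\<And>K. compact K \<Longrightarrow> ((\<lambda>t. LINT x:K|lebesgue. \<bar>u x t - u0 x\<bar>) \<longlongrightarrow> 0) (at_right 0)"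
    and t0: "0 < t0" "t0 < T"
  shows "u x0 t0 \<le> V x0 t0"
proof (rule ccontr)
  assume contr: "\<not> u x0 t0 \<le> V x0 t0"
  define c where "c = (real DIM('a) - 2) / 2"
  \<comment> \<open>Large enough for Young's inequality, which needs
    \<open>2 / (1 - m) \<le> P\<close>, and for two derivatives of the cutoff, which need
    \<open>3 \<le> P\<close>.\<close>
  define P where "P = max 3 (nat \<lceil>2 / (1 - m)\<rceil>)"
  have P: "2 / (1 - m) \<le> real P" "3 \<le> P" by (auto simp: P_def) linarith
  define A where "A = 8 * c * P + 4 * P\<^sup>2"
  have c0: "0 \<le> c" using dim by (simp add: c_def)
  have A0: "0 < A" using P c0 by (simp add: A_def add_nonneg_pos)
  obtain C where C: "0 < C" "\<And>J. integral\<^sup>L lborel (\<lambda>x::'a. indicator (cball 0 (2 ^ J)) x * weight c x) \<le> C * 4 ^ J"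
    using weight_integral_bound[OF dim] unfolding c_def by blast
  note decay = fde_positive_part_decay[OF dim m u V Vc u0 lim t0 P c_def A_def C]
  define e where "e x = max 0 (u x t0 - V x t0)" for x
  have ce: "continuous_on UNIV e"
    unfolding e_def using fde_solutionD(4)[OF u t0] fde_solutionD(4)[OF V t0]
    by (intro continuous_intros) (auto simp: C2_def)
  have e0: "0 < e x0" using contr by (simp add: e_def)
  have "isCont e x0" using ce by (simp add: continuous_on_eq_continuous_at)
  then obtain d where d: "0 < d" "\<And>x. dist x x0 < d \<Longrightarrow> dist (e x) (e x0) < e x0 / 2"
    unfolding continuous_at_eps_delta using e0 by (metis half_gt_zero)
  define \<rho> where "\<rho> = d / 2"
  have \<rho>: "0 < \<rho>" using d by (simp add: \<rho>_def)
  have low: "e x0 / 2 \<le> e x" if "x \<in> cball x0 \<rho>" for x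
  proof -
    have "dist x x0 < d" using that d(1) by (simp add: \<rho>_def dist_commute)
    from d(2)[OF this] show ?thesis unfolding dist_real_def by linarith
  qed
  define r where "r = norm x0 + \<rho>"
  define q where "q = e x0 / 2 * ((1 + r\<^sup>2) powr (- c) * (3 / 4) ^ P)"
  have "0 < 1 + r\<^sup>2" by (simp add: add_pos_nonneg)
  hence "0 < (1 + r\<^sup>2) powr (- c)" by (metis less_irrefl powr_gt_zero)
  hence q: "0 < q" unfolding q_def using e0 by (intro mult_pos_pos) auto
  define v where "v = measure lborel (cball x0 \<rho>)"
  have v: "0 < v" using \<rho> by (simp add: v_def content_cball_pos)
  have ind: "integrable lborel (indicator (cball x0 \<rho>) :: 'a \<Rightarrow> real)"
    using emeasure_bounded_finite[OF bounded_cball, of x0 \<rho>] by (intro integrable_real_indicator) auto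
  have "\<forall>\<^sub>F J in sequentially. q * v \<le> 2 * A * C * t0 * (4 ^ J / (2 * A * t0)) powr (- (m / (1 - m)))"
  proof -
    obtain J0 :: nat where J0: "2 * r < 2 ^ J0" using real_arch_pow[of 2 "2 * r"] by auto
    have "q * v \<le> 2 * A * C * t0 * (4 ^ J / (2 * A * t0)) powr (- (m / (1 - m)))" if J: "J0 \<le> J" for J
    proof -
      have R: "2 * r \<le> 2 ^ J" using J0 power_increasing[OF J, of "2::real"] by linarith
      have tf0: "test_fun c (2 ^ J) P x = 0" if "2 ^ J < norm x" for x :: 'a
        using cutoff_eq_0[of "2 ^ J" x P] P that by (simp add: test_fun_def)
      have tc: "continuous_on UNIV (test_fun c (2 ^ J) P :: 'a \<Rightarrow> real)"
        by (rule continuous_on_test_fun)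
      have "q * v = integral\<^sup>L lborel (\<lambda>x. q * indicator (cball x0 \<rho>) x)"
        by (simp add: v_def)
      also have "\<dots> \<le> integral\<^sup>L lborel (\<lambda>x. e x * test_fun c (2 ^ J) P x)"
      proof (rule integral_mono)
        show "integrable lborel (\<lambda>x. e x * test_fun c (2 ^ J) P x)"
          by (rule integrable_continuous_compact_support[of _ "2 ^ J"])
             (auto intro!: continuous_intros ce tc simp: tf0)
        show "q * indicator (cball x0 \<rho>) x \<le> e x * test_fun c (2 ^ J) P x" for x
        proof (cases "x \<in> cball x0 \<rho>")
          case True
          have "norm x \<le> r"
            using True norm_triangle_ineq2[of x x0] by (simp add: r_def dist_norm norm_minus_commute)
          from test_fun_lower[OF c0 this R]
          have "q \<le> e x * test_fun c (2 ^ J) P x"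
            unfolding q_def using low[OF True] e0 by (intro mult_mono) auto
          thus ?thesis using True by simp
        next
          case False
          thus ?thesis using test_fun_bounds(1)[OF c0] by (auto simp: e_def intro!: mult_nonneg_nonneg)
        qed
      qed (use ind in auto)
      finally show ?thesis using decay[of J] unfolding e_def by linarith
    qed
    thus ?thesis unfolding eventually_sequentially by blast
  qed
  moreover have "(\<lambda>J. 2 * A * C * t0 * (4 ^ J / (2 * A * t0)) powr (- (m / (1 - m)))) \<longlonglongrightarrow> 0"
    by (rule power4_powr_LIMSEQ) (use A0 t0 m in auto)
  ultimately have "q * v \<le> 0" by (intro tendsto_lowerbound[of _ 0 sequentially]) auto
  thus False using q v by (simp add: mult_le_0_iff)
qed

section \<open>Sliding along the family of profiles\<close>

context parameter_range begin

text \<open>The order of the choices is the point: \<open>M\<close>, \<open>a\<close> and \<theta>0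
  depend only on \<mu>, \<open>l2\<close> and the profile; \<open>l'\<close> is then taken so close
  to \<mu> that \<open>l' * \<theta>0 powr \<beta> < \<mu>\<close>; only afterwards come
  \<open>l\<close>, its time \<open>t1\<close>, the gap between \<open>f l\<close> and
  \<open>f l'\<close>, and the shift. A smaller gap means a smaller shift, but the level reached,
  \<open>lm = l' * \<theta>0 powr \<beta>\<close>, remains the same.\<close>

lemma self_similar_family_slides_to_0:
  fixes f :: "real \<Rightarrow> 'a::euclidean_space \<Rightarrow> real" and u :: "'a \<Rightarrow> real \<Rightarrow> real"
  assumes dim: "DIM('a) = n" and f: "\<And>l. 0 < l \<Longrightarrow> is_profile m \<alpha> \<beta> l (f l)"
    and T: "0 < T" and l12: "0 < l1" "l1 < l2"
    and u: "fde_solution m T u"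
    and u1: "\<And>x t. 0 < t \<Longrightarrow> t < T \<Longrightarrow> u x t \<le> self_similar \<alpha> \<beta> T (f l1) x t"
    and u2: "\<And>x t. 0 < t \<Longrightarrow> t < T \<Longrightarrow> u x t \<le> self_similar \<alpha> \<beta> T (f l2) x t"
    and \<epsilon>: "0 < \<epsilon>"
  shows "\<exists>l t0. 0 < l \<and> l < \<epsilon> \<and> l \<le> l1 \<and> 0 < t0 \<and> t0 < T \<and>
    (\<forall>x t. t0 \<le> t \<longrightarrow> t < T \<longrightarrow> u x t \<le> self_similar \<alpha> \<beta> T (f l) x t)"
proof (rule ccontr)
  assume contr: "\<not> ?thesis"
  define q where "q = 2 / (1 - m)"
  have q: "0 < q" using m by (simp add: q_def)
  \<comment> \<open>This exponent remains when a shifted solution is rewritten as a profile with a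
    smaller parameter, see \<open>\<Phi>f\<close>; being positive, it gives a factor of at most 1
    for \<open>\<theta> \<le> 1\<close>.\<close>
  have \<alpha>\<beta>q: "\<alpha> - \<beta> * q = 1 / (1 - m)" using m by (simp add: \<alpha> q_def field_simps)
  define w where "w = 1 / (1 - m)"
  have w: "0 < w" using m by (simp add: w_def)
  have dim2: "2 \<le> DIM('a)" using dim n by simp
  obtain e :: 'a where e: "e \<in> Basis" using nonempty_Basis by blast
  have ne: "norm e = 1" using e by simp
  define \<omega> where "\<omega> r = r powr q * f 1 (r *\<^sub>R e)" for r
  obtain r0 where r0: "0 < r0" "\<And>r s. 0 < r \<Longrightarrow> r < s \<Longrightarrow> s \<le> r0 \<Longrightarrow> \<omega> r < \<omega> s"
    "\<And>r s. r0 \<le> r \<Longrightarrow> r < s \<Longrightarrow> \<omega> s < \<omega> r"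
    using profile_unimodal[OF f[of 1] dim e] unfolding \<omega>_def q_def by auto
  have inc: "\<omega> r \<le> \<omega> s" if "0 < r" "r \<le> s" "s \<le> r0" for r s
    using r0(2)[of r s] that by (cases "r = s") auto
  have dec: "\<omega> s \<le> \<omega> r" if "r0 \<le> r" "r \<le> s" for r s
    using r0(3)[of r s] that by (cases "r = s") auto
  have fpos: "0 < f l y" if "0 < l" for l y using f[OF that] unfolding is_profile_def by blast
  have f1pos: "0 < f 1 y" for y by (rule fpos) simp
  have rad: "f 1 x = f 1 y" if "norm x = norm y" for x y
    using f[OF zero_less_one] that unfolding is_profile_def by blast
  have cf: "continuous_on S (f l)" if "0 < l" for l S
  proof -
    have "C2 (f l)" using f[OF that] unfolding is_profile_def by blast
    thus ?thesis using continuous_on_subset[OF _ subset_UNIV] unfolding C2_def by blast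
  qed
  have \<omega>pos: "0 < \<omega> r" if "0 < r" for r using f1pos that by (simp add: \<omega>_def)
  have scal: "f l y = l powr q * f 1 (l *\<^sub>R y)" if "0 < l" for l y
    unfolding q_def by (rule profile_scaling[OF f that dim2 m])
  have f\<omega>: "f l y = norm y powr (- q) * \<omega> (l * norm y)" if l: "0 < l" and y: "y \<noteq> 0" for l y
  proof -
    have "f 1 (l *\<^sub>R y) = f 1 ((l * norm y) *\<^sub>R e)" by (rule rad) (use l ne in simp)
    moreover have "norm y powr q * norm y powr (- q) = 1" using y by (simp flip: powr_add)
    ultimately show ?thesis
      unfolding scal[OF l] \<omega>_def using l y by (simp add: powr_mult mult.left_commute)
  qed
  have fle: "f l y \<le> f l' y" if "0 < l" "0 < l'" "y \<noteq> 0" "\<omega> (l * norm y) \<le> \<omega> (l' * norm y)" for l l' y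
    unfolding f\<omega>[OF that(1,3)] f\<omega>[OF that(2,3)] using that(4) by (intro mult_left_mono) auto
  \<comment> \<open>The profile of a self-similar solution whose extinction time is shifted, seen in the
      similarity variables of extinction time \<open>T\<close>.\<close>
  define \<Phi> where "\<Phi> l \<theta> y = \<theta> powr \<alpha> * f l (\<theta> powr \<beta> *\<^sub>R y)" for l \<theta> y
  have \<Phi>f: "\<Phi> l \<theta> y = \<theta> powr w * f (l * \<theta> powr \<beta>) y" if "0 < l" "0 < \<theta>" for l \<theta> y
  proof -
    have "\<theta> powr \<alpha> = \<theta> powr w * \<theta> powr (\<beta> * q)"
      unfolding powr_add[symmetric] using \<alpha>\<beta>q by (simp add: w_def algebra_simps)
    moreover have "(\<theta> powr \<beta>) powr q = \<theta> powr (\<beta> * q)" by (rule powr_powr)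
    ultimately show ?thesis
      using that by (simp add: \<Phi>_def scal[of l] scal[of "l * \<theta> powr \<beta>"] powr_mult mult.assoc mult.left_commute)
  qed
  have \<Phi>le: "\<Phi> l \<theta> y \<le> f (l * \<theta> powr \<beta>) y" if "0 < l" "0 < \<theta>" "\<theta> \<le> 1" for l \<theta> y
  proof -
    have "\<theta> powr w \<le> 1" using that w by (intro powr_le1) auto
    moreover have "0 < f (l * \<theta> powr \<beta>) y" using that by (intro fpos) simp
    ultimately show ?thesis unfolding \<Phi>f[OF that(1,2)] by (simp add: mult_left_le_one_le)
  qed
  \<comment> \<open>The negated claim makes \<epsilon> a lower bound of this set, so its infimum
    \<mu> is positive.\<close>
  define \<Lambda> where "\<Lambda> = {l. 0 < l \<and> l \<le> l1 \<and> (\<exists>t0. 0 < t0 \<and> t0 < T \<and>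
    (\<forall>x t. t0 \<le> t \<longrightarrow> t < T \<longrightarrow> u x t \<le> self_similar \<alpha> \<beta> T (f l) x t))}"
  have "l1 \<in> \<Lambda>" unfolding \<Lambda>_def using l12 T u1 by (auto intro!: exI[of _ "T / 2"])
  define \<mu> where "\<mu> = Inf \<Lambda>"
  have \<Lambda>\<epsilon>: "\<epsilon> \<le> l" if "l \<in> \<Lambda>" for l using contr that unfolding \<Lambda>_def by (force simp: not_less)
  have bdd: "bdd_below \<Lambda>" using \<Lambda>\<epsilon> by (meson bdd_belowI)
  have \<mu>le: "\<mu> \<le> l" if "l \<in> \<Lambda>" for l unfolding \<mu>_def by (rule cInf_lower[OF that bdd])
  have "\<epsilon> \<le> \<mu>" unfolding \<mu>_def using \<open>l1 \<in> \<Lambda>\<close> \<Lambda>\<epsilon> by (intro cInf_greatest) auto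
  hence \<mu>: "0 < \<mu>" "\<mu> < l2" using \<epsilon> \<mu>le[OF \<open>l1 \<in> \<Lambda>\<close>] l12 by auto
  \<comment> \<open>\<open>l' < M\<close> will keep \<open>l2 * R = l2 * r0 / l'\<close> above
    \<open>l2 * r0 / M > r0\<close>, so that \<open>a\<close> bounds \<omega> at
    \<open>l2 * norm z\<close> for all \<open>norm z \<ge> R\<close> while staying strictly below
    the maximum \<open>\<omega> r0\<close>.\<close>
  define M where "M = (\<mu> + l2) / 2"
  have M: "\<mu> < M" "M < l2" "0 < M" using \<mu> by (auto simp: M_def)
  define a where "a = \<omega> (l2 * r0 / M)"
  have "r0 < l2 * r0 / M" using M r0(1) by (simp add: field_simps)
  hence ar0: "a < \<omega> r0" unfolding a_def by (intro r0(3)) auto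
  \<comment> \<open>Since \<open>l' * R = r0\<close>, this is \<open>R powr q\<close> times the
    shifted profile \<open>\<Phi> l' \<theta>\<close> on the sphere of radius \<open>R\<close>, and
    it does not involve \<open>l'\<close>. At \<open>\<theta> = 1\<close> it is
    \<open>\<omega> r0 > a\<close>, which leaves room for a fixed \<theta>0 below 1.\<close>
  define h where "h \<theta> = \<theta> powr w * \<omega> (\<theta> powr \<beta> * r0)" for \<theta>
  have "isCont h 1"
  proof -
    have "continuous_on {0<..} \<omega>"
      unfolding \<omega>_def by (intro continuous_intros continuous_on_compose2[OF cf[of 1 UNIV]]) auto
    hence c\<omega>: "isCont \<omega> r" if "0 < r" for r using that by (simp add: continuous_on_eq_continuous_at)
    have "isCont (\<lambda>\<theta>. \<theta> powr \<beta> * r0) 1" by (intro continuous_intros) auto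
    from isCont_o2[OF this] c\<omega>[of "1 powr \<beta> * r0"] r0(1)
    have "isCont (\<lambda>\<theta>. \<omega> (\<theta> powr \<beta> * r0)) 1" by simp
    thus ?thesis unfolding h_def[abs_def] by (intro continuous_intros) auto
  qed
  moreover have "h 1 = \<omega> r0" by (simp add: h_def)
  ultimately obtain d where d: "0 < d" "\<And>\<theta>. dist \<theta> 1 < d \<Longrightarrow> dist (h \<theta>) (\<omega> r0) < \<omega> r0 - a"
    unfolding continuous_at_eps_delta using ar0 by (metis diff_gt_0_iff_gt)
  define \<theta>0 where "\<theta>0 = 1 - min d 1 / 2"
  have \<theta>0: "0 < \<theta>0" "\<theta>0 < 1" using d(1) by (auto simp: \<theta>0_def min_def)
  have ha: "a \<le> h \<theta>" if "\<theta>0 \<le> \<theta>" "\<theta> \<le> 1" for \<theta>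
  proof -
    have "dist \<theta> 1 < d" using that d(1) unfolding dist_real_def \<theta>0_def by (auto simp: min_def split: if_splits)
    from d(2)[OF this] show ?thesis unfolding dist_real_def by linarith
  qed
  have \<theta>0\<beta>: "0 < \<theta>0 powr \<beta>" "\<theta>0 powr \<beta> < 1"
    using \<theta>0 \<beta> powr_less_mono2[of \<beta> \<theta>0 1] by auto
  obtain l' where l': "\<mu> < l'" "l' < M" "l' * \<theta>0 powr \<beta> < \<mu>"
  proof -
    have "\<mu> < min M (\<mu> / \<theta>0 powr \<beta>)" using M \<mu> \<theta>0\<beta> by (simp add: field_simps)
    then obtain l' where "\<mu> < l'" "l' < min M (\<mu> / \<theta>0 powr \<beta>)" using dense by blast
    thus ?thesis using that[of l'] \<theta>0\<beta> by (simp add: field_simps)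
  qed
  have l'0: "0 < l'" using l' \<mu> by linarith
  obtain l where l: "l \<in> \<Lambda>" "l < l'"
    using cInf_lessD[of \<Lambda> l'] \<open>l1 \<in> \<Lambda>\<close> l'(1) unfolding \<mu>_def by blast
  obtain t1 where t1: "0 < t1" "t1 < T" "\<And>x t. t1 \<le> t \<Longrightarrow> t < T \<Longrightarrow> u x t \<le> self_similar \<alpha> \<beta> T (f l) x t"
    and l0: "0 < l" using l(1) unfolding \<Lambda>_def by blast
  \<comment> \<open>On this ball the arguments \<open>l * norm y\<close> stay on the increasing
    branch of \<omega> for all \<open>l \<le> l'\<close>.\<close>
  define R where "R = r0 / l'"
  have R: "0 < R" "l' * R = r0" using r0(1) l'0 by (auto simp: R_def)
  have gap: "f l y < f l' y" if y: "norm y \<le> R" for y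
  proof (cases "y = 0")
    case True
    thus ?thesis using scal[OF l0, of 0] scal[OF l'0, of 0] f1pos[of 0] l(2) l0 q by (simp add: powr_less_mono2)
  next
    case False
    have "l' * norm y \<le> r0" using y l'0 R(2) mult_left_mono[of "norm y" R l'] by simp
    hence "\<omega> (l * norm y) < \<omega> (l' * norm y)" using l(2) l0 False by (intro r0(2)) auto
    thus ?thesis unfolding f\<omega>[OF l0 False] f\<omega>[OF l'0 False] using False by simp
  qed
  \<comment> \<open>Compactness turns the strict gap into a decrease of \<theta> below 1; how small
    it is does not matter.\<close>
  obtain \<theta>1 where \<theta>1: "\<theta>0 < \<theta>1" "\<theta>1 < 1" "\<And>y. norm y \<le> R \<Longrightarrow> f l y \<le> \<Phi> l' \<theta>1 y"
  proof -
    have "continuous_on (cball 0 R) (\<lambda>y. f l' y - f l y)"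
      by (intro continuous_intros cf l0 l'0)
    then obtain y0 where y0: "y0 \<in> cball 0 R" "\<And>y. y \<in> cball 0 R \<Longrightarrow> f l' y0 - f l y0 \<le> f l' y - f l y"
      using continuous_attains_inf[of "cball 0 R" "\<lambda>y. f l' y - f l y"] R by auto
    define \<eta> where "\<eta> = f l' y0 - f l y0"
    have \<eta>: "0 < \<eta>" using gap[of y0] y0(1) by (simp add: \<eta>_def)
    have "continuous_on ({\<theta>0..1} \<times> cball 0 R) (\<lambda>z. \<Phi> l' (fst z) (snd z))"
      unfolding \<Phi>_def using \<theta>0
      by (intro continuous_intros continuous_on_compose2[OF cf[OF l'0, of UNIV]]) auto
    moreover have "compact ({\<theta>0..1} \<times> cball (0::'a) R)" by (intro compact_Times) auto
    ultimately have "uniformly_continuous_on ({\<theta>0..1} \<times> cball 0 R) (\<lambda>z. \<Phi> l' (fst z) (snd z))"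
      by (rule compact_uniformly_continuous)
    then obtain \<delta> where \<delta>: "0 < \<delta>" "\<And>z z'. z \<in> {\<theta>0..1} \<times> cball 0 R \<Longrightarrow> z' \<in> {\<theta>0..1} \<times> cball 0 R
        \<Longrightarrow> dist z' z < \<delta> \<Longrightarrow> dist (\<Phi> l' (fst z') (snd z')) (\<Phi> l' (fst z) (snd z)) < \<eta>"
      using \<eta> unfolding uniformly_continuous_on_def by metis
    define \<theta>1 where "\<theta>1 = 1 - min \<delta> (1 - \<theta>0) / 2"
    have \<theta>1: "\<theta>0 < \<theta>1" "\<theta>1 < 1" "1 - \<theta>1 < \<delta>" using \<delta>(1) \<theta>0 by (auto simp: \<theta>1_def min_def field_simps)
    have "f l y \<le> \<Phi> l' \<theta>1 y" if y: "norm y \<le> R" for y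
    proof -
      have "dist (\<Phi> l' \<theta>1 y) (\<Phi> l' 1 y) < \<eta>"
        using \<delta>(2)[of "(1, y)" "(\<theta>1, y)"] y \<theta>1 \<theta>0 by (simp add: dist_Pair_Pair dist_real_def)
      moreover have "\<Phi> l' 1 y = f l' y" by (simp add: \<Phi>_def)
      moreover have "\<eta> \<le> f l' y - f l y" using y0(2)[of y] y by (simp add: \<eta>_def)
      ultimately show ?thesis unfolding dist_real_def by linarith
    qed
    thus ?thesis using that \<theta>1 by blast
  qed
  \<comment> \<open>The extinction time \<open>T' = T - \<delta>\<close> is such that \<theta>
    equals \<theta>1 at \<open>t1\<close>; \<open>t2\<close> is the time at which \<theta> has
    fallen to \<theta>0.\<close>
  define \<delta> where "\<delta> = (1 - \<theta>1) * (T - t1)"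
  define T' where "T' = T - \<delta>"
  define t2 where "t2 = T - \<delta> / (1 - \<theta>0)"
  have \<delta>: "0 < \<delta>" using \<theta>1 t1 by (simp add: \<delta>_def)
  have d2: "\<delta> < \<delta> / (1 - \<theta>0)" "\<delta> / (1 - \<theta>0) < T - t1"
  proof -
    have "\<delta> * (1 - \<theta>0) < \<delta> * 1" using \<delta> \<theta>0 by (intro mult_strict_left_mono) auto
    thus "\<delta> < \<delta> / (1 - \<theta>0)" using \<theta>0 by (simp add: pos_less_divide_eq)
    have "(1 - \<theta>1) * (T - t1) < (1 - \<theta>0) * (T - t1)" using \<theta>1 t1 by (intro mult_strict_right_mono) auto
    thus "\<delta> / (1 - \<theta>0) < T - t1" using \<theta>0 by (simp add: pos_divide_less_eq \<delta>_def mult.commute)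
  qed
  hence t2: "t1 < t2" "t2 < T'" "T' < T" using \<delta> by (auto simp: t2_def T'_def)
  define \<theta> where "\<theta> t = (T' - t) / (T - t)" for t
  have \<theta>eq: "\<theta> t = 1 - \<delta> / (T - t)" if "t < T" for t using that by (simp add: \<theta>_def T'_def field_simps)
  have \<theta>t1: "\<theta> t1 = \<theta>1" using \<theta>eq[of t1] t1 by (simp add: \<delta>_def)
  have \<theta>t2: "\<theta> t2 = \<theta>0" using \<theta>eq[of t2] t2 \<theta>0 \<delta> by (simp add: t2_def)
  have \<theta>rng: "\<theta>0 \<le> \<theta> t" "\<theta> t \<le> 1" if "t \<le> t2" for t
  proof -
    have "\<delta> / (T - t) \<le> \<delta> / (T - t2)" using that t2 \<delta> by (intro divide_left_mono mult_pos_pos) auto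
    thus "\<theta>0 \<le> \<theta> t" using \<theta>eq[of t] \<theta>eq[of t2] \<theta>t2 that t2 by simp
    show "\<theta> t \<le> 1" using \<theta>eq[of t] that t2 \<delta> by simp
  qed
  define y where "y x t = (T - t) powr \<beta> *\<^sub>R x" for x :: 'a and t
  define \<rho> where "\<rho> t = R * (T - t) powr (- \<beta>)" for t
  have \<rho>y: "norm x \<le> \<rho> t \<longleftrightarrow> norm (y x t) \<le> R" "norm x = \<rho> t \<longleftrightarrow> norm (y x t) = R" if "t < T" for x t
    using that by (auto simp: \<rho>_def y_def powr_minus field_simps)
  have c\<rho>: "continuous_on {s..s'} \<rho>" if "s' < T" for s s'
    unfolding \<rho>_def using that by (intro continuous_intros) auto
  have ss: "self_similar \<alpha> \<beta> T (f l) x t = (T - t) powr \<alpha> * f l (y x t)" for l x t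
    by (simp add: self_similar_def y_def)
  have ss': "self_similar \<alpha> \<beta> T' (f l) x t = (T - t) powr \<alpha> * \<Phi> l (\<theta> t) (y x t)" if "t < T'" for l x t
  proof -
    have "0 < \<theta> t" "T' - t = \<theta> t * (T - t)" using that t2 by (auto simp: \<theta>_def)
    thus ?thesis using that t2 by (simp add: self_similar_def \<Phi>_def y_def powr_mult mult.commute)
  qed
  have sol: "fde_solution m T (self_similar \<alpha> \<beta> T (f l))" if "0 < l" for T l
    using self_similar_solution[OF f[OF that] m \<alpha>] by (auto simp: fde_solution_def)
  have lat0: "f l2 z \<le> norm z powr (- q) * a" if "R \<le> norm z" for z
  proof -
    have z0: "z \<noteq> 0" using that R by auto
    have "l2 * r0 / M \<le> l2 * R" using l'(2) l'0 l12 M r0(1) by (simp add: R_def frac_le)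
    also have "\<dots> \<le> l2 * norm z" using that l12 by simp
    finally have "\<omega> (l2 * norm z) \<le> a"
      unfolding a_def using \<open>r0 < l2 * r0 / M\<close> by (intro dec) auto
    thus ?thesis using f\<omega>[of l2 z] z0 l12 by (simp add: mult_left_mono)
  qed
  have lat1: "f l2 z \<le> \<Phi> l' \<theta> z" if "norm z = R" "\<theta>0 \<le> \<theta>" "\<theta> \<le> 1" for \<theta> z
  proof -
    have z0: "z \<noteq> 0" using that R by auto
    have \<theta>p: "0 < \<theta>" using that \<theta>0 by linarith
    have "\<Phi> l' \<theta> z = norm z powr (- q) * h \<theta>"
    proof -
      have arg: "l' * \<theta> powr \<beta> * norm z = \<theta> powr \<beta> * r0" unfolding R(2)[symmetric] that(1) by simp
      have "f (l' * \<theta> powr \<beta>) z = norm z powr (- q) * \<omega> (l' * \<theta> powr \<beta> * norm z)"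
        by (rule f\<omega>) (use l'0 \<theta>p z0 in auto)
      thus ?thesis unfolding \<Phi>f[OF l'0 \<theta>p] arg h_def by simp
    qed
    moreover have "norm z powr (- q) * a \<le> norm z powr (- q) * h \<theta>"
      using ha[OF that(2,3)] by (intro mult_left_mono) auto
    ultimately show ?thesis using lat0[of z] that(1) by simp
  qed
  define lm where "lm = l' * \<theta>0 powr \<beta>"
  have lm: "0 < lm" "lm < \<mu>" using l'0 l'(3) \<theta>0\<beta> by (auto simp: lm_def)
  \<comment> \<open>Where \<open>lm * norm z\<close> is on the increasing branch, \<open>a\<close>
    separates the two values; beyond \<open>r0\<close> both arguments lie on the decreasing branch,
    where the larger parameter gives the smaller value.\<close>
  have out: "f l2 z \<le> f lm z" if "R \<le> norm z" for z
  proof -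
    have z0: "z \<noteq> 0" using that R by auto
    have "a \<le> \<omega> (\<theta>0 powr \<beta> * r0)"
    proof -
      have "\<theta>0 powr w \<le> 1" using \<theta>0 w by (intro powr_le1) auto
      moreover have "0 < \<omega> (\<theta>0 powr \<beta> * r0)" using r0(1) \<theta>0 by (intro \<omega>pos) simp
      ultimately have "h \<theta>0 \<le> \<omega> (\<theta>0 powr \<beta> * r0)" by (simp add: h_def mult_left_le_one_le)
      thus ?thesis using ha[of \<theta>0] \<theta>0 by simp
    qed
    moreover have lmz: "\<theta>0 powr \<beta> * r0 \<le> lm * norm z"
      using that l'0 \<theta>0\<beta> R(2)[symmetric] by (simp add: lm_def)
    ultimately show ?thesis
    proof (cases "lm * norm z \<le> r0")
      case True
      have "a \<le> \<omega> (lm * norm z)"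
        using \<open>a \<le> _\<close> inc[OF _ lmz True] \<theta>0\<beta> r0(1) by simp
      hence "norm z powr (- q) * a \<le> f lm z" using f\<omega>[OF lm(1) z0] by (simp add: mult_left_mono)
      thus ?thesis using lat0[OF that] by linarith
    next
      case False
      have "\<omega> (l2 * norm z) \<le> \<omega> (lm * norm z)"
        using False lm \<mu> by (intro dec mult_right_mono) auto
      thus ?thesis using lm l12 z0 by (intro fle) auto
    qed
  qed
  have u2': "u x t \<le> (T - t) powr \<alpha> * f l2 (y x t)" if "0 < t" "t < T" for x t
    using u2[OF that] by (simp add: ss)
  have inner: "u x t2 \<le> (T - t2) powr \<alpha> * f lm (y x t2)" if x: "norm (y x t2) \<le> R" for x
  proof -
    \<comment> \<open>The barrier exists only before \<open>T'\<close>, so \<open>u\<close> is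
      restricted to that time interval; the decrease to \<theta>0 is complete at
      \<open>t2 < T'\<close>.\<close>
    have "u x t2 \<le> self_similar \<alpha> \<beta> T' (f l') x t2"
    proof (rule moving_ball_comparison[OF fde_solution_mono[OF u, of T'] sol[OF l'0] m t1(1) t2(2) c\<rho>])
      show "u x t1 \<le> self_similar \<alpha> \<beta> T' (f l') x t1" if "norm x \<le> \<rho> t1" for x
      proof -
        have "u x t1 \<le> (T - t1) powr \<alpha> * f l (y x t1)" using t1(3)[of t1 x] t1(2) by (simp add: ss)
        also have "\<dots> \<le> (T - t1) powr \<alpha> * \<Phi> l' (\<theta> t1) (y x t1)"
          unfolding \<theta>t1 using \<theta>1(3)[of "y x t1"] that \<rho>y(1)[OF t1(2)] by (intro mult_left_mono) auto
        finally show ?thesis using t2 by (simp add: ss')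
      qed
      show "u x t \<le> self_similar \<alpha> \<beta> T' (f l') x t" if "t1 \<le> t" "t \<le> t2" "norm x = \<rho> t" for x t
      proof -
        have tT: "0 < t" "t < T" "t < T'" using that t1 t2 by auto
        have "u x t \<le> (T - t) powr \<alpha> * f l2 (y x t)" using u2'[OF tT(1,2)] .
        also have "\<dots> \<le> (T - t) powr \<alpha> * \<Phi> l' (\<theta> t) (y x t)"
          using lat1[OF _ \<theta>rng[OF that(2)]] that(3) \<rho>y(2)[OF tT(2)] by (intro mult_left_mono) auto
        finally show ?thesis using tT by (simp add: ss')
      qed
      show "norm x \<le> \<rho> t2" using x \<rho>y(1) t2 by simp
    qed (use t2 in auto)
    also have "\<dots> = (T - t2) powr \<alpha> * \<Phi> l' \<theta>0 (y x t2)" using ss'[OF t2(2)] \<theta>t2 by simp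
    also have "\<dots> \<le> (T - t2) powr \<alpha> * f lm (y x t2)"
      unfolding lm_def using \<Phi>le[OF l'0] \<theta>0 by (intro mult_left_mono) auto
    finally show ?thesis .
  qed
  \<comment> \<open>The bound at \<open>t2\<close> propagates to all later times: inside the ball by
    comparison with lateral data from \<open>out\<close>, outside by \<open>out\<close>
    alone.\<close>
  have "u x t \<le> self_similar \<alpha> \<beta> T (f lm) x t" if t: "t2 \<le> t" "t < T" for x t
  proof (cases "norm (y x t) \<le> R")
    case True
    have t20: "0 < t2" using t1 t2 by linarith
    show ?thesis
    proof (rule moving_ball_comparison[OF u sol[OF lm(1)] m t20 t(2) c\<rho>[OF t(2)]])
      show "u x t2 \<le> self_similar \<alpha> \<beta> T (f lm) x t2" if "norm x \<le> \<rho> t2" for x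
        using inner[of x] that \<rho>y(1)[of t2] t2 by (simp add: ss)
      show "u x s \<le> self_similar \<alpha> \<beta> T (f lm) x s" if s: "t2 \<le> s" "s \<le> t" "norm x = \<rho> s" for x s
      proof -
        have sT: "0 < s" "s < T" using s t t20 by auto
        have "(T - s) powr \<alpha> * f l2 (y x s) \<le> (T - s) powr \<alpha> * f lm (y x s)"
          using out[of "y x s"] s(3) \<rho>y(2)[OF sT(2)] by (intro mult_left_mono) auto
        thus ?thesis using u2'[OF sT, of x] by (simp add: ss)
      qed
      show "norm x \<le> \<rho> t" using True \<rho>y(1) t by simp
    qed (use t in auto)
  next
    case False
    have t0: "0 < t" using t t1 t2 by linarith
    have "(T - t) powr \<alpha> * f l2 (y x t) \<le> (T - t) powr \<alpha> * f lm (y x t)"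
      using out[of "y x t"] False by (intro mult_left_mono) auto
    thus ?thesis unfolding ss by (rule order_trans[OF u2'[OF t0 t(2)]])
  qed
  moreover have "0 < t2" "t2 < T" "lm \<le> l1" using t1 t2 lm \<mu>le[OF \<open>l1 \<in> \<Lambda>\<close>] by auto
  ultimately have "lm \<in> \<Lambda>" unfolding \<Lambda>_def using lm(1) by blast
  thus False using \<mu>le lm(2) by force
qed

end

theorem theorem1p7:
  fixes n :: nat and m \<alpha> \<beta> T l0 l1 l2 :: real
    and f :: "real \<Rightarrow> real ^ 'n \<Rightarrow> real"
    and u0 :: "real ^ 'n \<Rightarrow> real"
    and u :: "real ^ 'n \<Rightarrow> real \<Rightarrow> real"
  assumes dim: "n = CARD('n)"
    and range:
      "(3 \<le> n \<and> n \<le> 4 \<and> 0 < m \<and> m < (real n - 2) / real n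
          \<and> beta_0 n m < \<beta> \<and> \<beta> < beta_1 n m)
       \<or> (4 < n \<and> (real n - 4) / (real n - 2) < m \<and> m < (real n - 2) / real n
          \<and> beta_0 n m < \<beta> \<and> \<beta> < beta_1 n m)"
    and alpha: "\<alpha> = (2 * \<beta> + 1) / (1 - m)"
    and T: "0 < T"
    and profiles: "\<And>l. 0 < l \<Longrightarrow> is_profile m \<alpha> \<beta> l (f l)"
    and lambdas: "0 < l0" "0 < l1" "l1 < l2"
    and u0_L1: "integrable lebesgue (\<lambda>x. u0 x - self_similar \<alpha> \<beta> T (f l0) x 0)"
    and u0_bounds:
      "AE x in lebesgue. 0 \<le> u0 x \<and>
         u0 x \<le> min (self_similar \<alpha> \<beta> T (f l1) x 0) (self_similar \<alpha> \<beta> T (f l2) x 0)"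
    and solution: "cauchy_solution m T u0 u"
    and u_t_bound: "\<And>x t. 0 < t \<Longrightarrow> t < T \<Longrightarrow> deriv (u x) t \<le> u x t / ((1 - m) * t)"
  shows "\<forall>K. compact K \<longrightarrow> uniform_limit K (\<lambda>\<tau> y. rescaled \<alpha> \<beta> T u y \<tau>) (\<lambda>y. 0) at_top"
proof (intro allI impI)
  fix K :: "(real ^ 'n) set" assume K: "compact K"
  interpret parameter_range n m \<alpha> \<beta> "real n - 2 / (1 - m)" "2 * m / (1 - m)" "\<alpha> - real n * \<beta>"
    by (rule parameter_range_intro[OF range alpha])
  have DIM: "DIM(real ^ 'n) = n" by (simp add: dim)
  have sol: "fde_solution m T u"
    using solution by (auto simp: cauchy_solution_def fde_solution_def)
  have below: "u x t \<le> self_similar \<alpha> \<beta> T (f l) x t"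
    if "0 < l" "AE x in lebesgue. u0 x \<le> self_similar \<alpha> \<beta> T (f l) x 0" "0 < t" "t < T" for l x t
  proof (rule comparison_from_initial_trace[where u = u and V = "self_similar \<alpha> \<beta> T (f l)" and ?u0.0 = u0,
        OF _ m sol _ _ _ that(2) _ that(3,4)])
    show "3 \<le> DIM(real ^ 'n)" using n by (simp add: dim)
    note ss = self_similar_solution[OF profiles[OF that(1)] m alpha]
    show "fde_solution m T (self_similar \<alpha> \<beta> T (f l))"
      using ss by (auto simp: fde_solution_def)
    show "continuous_on (UNIV \<times> {..<T}) (\<lambda>(x, t). self_similar \<alpha> \<beta> T (f l) x t)" by (rule ss(4))
  qed (use solution in \<open>auto simp: cauchy_solution_def\<close>)
  have l2: "0 < l2" using lambdas by linarith
  have u0: "AE x in lebesgue. u0 x \<le> self_similar \<alpha> \<beta> T (f l1) x 0"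
    "AE x in lebesgue. u0 x \<le> self_similar \<alpha> \<beta> T (f l2) x 0"
    using u0_bounds by (auto elim: eventually_mono)
  note slide = self_similar_family_slides_to_0[OF DIM profiles T lambdas(2,3) sol
      below[OF lambdas(2) u0(1)] below[OF l2 u0(2)]]
  define q where "q = 2 / (1 - m)"
  have q: "0 < q" using m by (simp add: q_def)
  obtain B where B: "\<And>y. y \<in> K \<Longrightarrow> norm y \<le> B" using compact_imp_bounded[OF K] unfolding bounded_iff by blast
  have prof1: "C2 (f 1)" "0 < f 1 y" for y
    using profiles[OF zero_less_one] unfolding is_profile_def by blast+
  \<comment> \<open>This ball contains \<open>l *\<^sub>R y\<close> for all \<open>y\<close> in
    \<open>K\<close> and \<open>0 < l \<le> l1\<close>, which is why the sliding lemma also returns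
    \<open>l \<le> l1\<close>. The absolute value keeps the radius nonnegative when \<open>K\<close>
    is empty.\<close>
  have "bdd_above (f 1 ` cball 0 (l1 * \<bar>B\<bar>))"
    using prof1(1) unfolding C2_def
    by (intro bounded_imp_bdd_above compact_imp_bounded compact_continuous_image)
       (auto intro: continuous_on_subset)
  then obtain C where C: "\<And>z. norm z \<le> l1 * \<bar>B\<bar> \<Longrightarrow> f 1 z \<le> C"
    unfolding bdd_above_def by (metis image_eqI mem_cball_0)
  have C0: "0 < C" using C[of 0] prof1(2)[of 0] lambdas(2) by simp
  show "uniform_limit K (\<lambda>\<tau> y. rescaled \<alpha> \<beta> T u y \<tau>) (\<lambda>y. 0) at_top"
    unfolding uniform_limit_iff
  proof (intro allI impI)
    fix e :: real assume e: "0 < e"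
    \<comment> \<open>By scaling \<open>f l \<le> l powr q * C\<close> on \<open>K\<close>, and this
      threshold makes the bound less than \<open>e\<close>.\<close>
    define \<epsilon> where "\<epsilon> = (e / C) powr (1 / q)"
    have \<epsilon>: "0 < \<epsilon>" "\<epsilon> powr q = e / C" using e C0 q by (auto simp: \<epsilon>_def powr_powr)
    obtain l t0 where l: "0 < l" "l < \<epsilon>" "l \<le> l1" and t0: "0 < t0" "t0 < T"
      and ub: "\<And>x t. t0 \<le> t \<Longrightarrow> t < T \<Longrightarrow> u x t \<le> self_similar \<alpha> \<beta> T (f l) x t"
      using slide[OF _ _ _ _ _ \<epsilon>(1)] by blast
    have small: "f l y < e" if "y \<in> K" for y
    proof -
      have "norm (l *\<^sub>R y) \<le> l1 * \<bar>B\<bar>"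
        using B[OF that] l lambdas(2) by (simp add: mult_mono)
      hence "f 1 (l *\<^sub>R y) \<le> C" by (rule C)
      hence "f l y \<le> l powr q * C"
        using profile_scaling[OF profiles l(1) _ m, of y] n by (simp add: q_def dim mult_left_mono)
      also have "l powr q < \<epsilon> powr q" using l q by (intro powr_less_mono2) auto
      hence "l powr q * C < e" using C0 by (simp add: \<epsilon>(2) pos_less_divide_eq)
      finally show ?thesis .
    qed
    have "\<forall>\<^sub>F \<tau> in at_top. ln (T / (T - t0)) \<le> \<tau>" by (rule eventually_ge_at_top)
    thus "\<forall>\<^sub>F \<tau> in at_top. \<forall>y\<in>K. dist (rescaled \<alpha> \<beta> T u y \<tau>) 0 < e"
    proof eventually_elim
      case (elim \<tau>)
      define t where "t = T * (1 - exp (- \<tau>))"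
      have Tt: "T - t = T * exp (- \<tau>)" by (simp add: t_def algebra_simps)
      hence tT: "0 < T - t" using T by simp
      have "T / (T - t0) \<le> exp \<tau>"
        using elim t0 T by (metis diff_gt_0_iff_gt divide_pos_pos exp_le_cancel_iff exp_ln)
      hence "T * exp (- \<tau>) \<le> T - t0" using t0 T by (simp add: exp_minus field_simps)
      hence t: "t0 \<le> t" "t < T" "0 < t" using Tt tT t0(1) by linarith+
      show ?case
      proof
        fix y assume y: "y \<in> K"
        have r: "rescaled \<alpha> \<beta> T u y \<tau> = (T - t) powr (- \<alpha>) * u ((T - t) powr (- \<beta>) *\<^sub>R y) t"
          by (simp add: rescaled_def t_def Let_def)
        have c: "(T - t) powr a * (T - t) powr (- a) = 1" for a
          using tT by (simp flip: powr_add)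
        have "rescaled \<alpha> \<beta> T u y \<tau>
            \<le> (T - t) powr (- \<alpha>) * self_similar \<alpha> \<beta> T (f l) ((T - t) powr (- \<beta>) *\<^sub>R y) t"
          unfolding r by (intro mult_left_mono ub t) auto
        also have "\<dots> = ((T - t) powr \<alpha> * (T - t) powr (- \<alpha>)) * f l (((T - t) powr \<beta> * (T - t) powr (- \<beta>)) *\<^sub>R y)"
          by (simp add: self_similar_def mult.commute mult.left_commute)
        also have "\<dots> = f l y" unfolding c by simp
        finally have "rescaled \<alpha> \<beta> T u y \<tau> < e" using small[OF y] by linarith
        moreover have "0 \<le> rescaled \<alpha> \<beta> T u y \<tau>"
          unfolding r using less_imp_le[OF fde_solutionD(1)[OF sol t(3,2)]] by (intro mult_nonneg_nonneg) auto
        ultimately show "dist (rescaled \<alpha> \<beta> T u y \<tau>) 0 < e" by (simp add: dist_real_def)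
      qed
    qed
  qed
qed

end
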